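(* Let $n\ge 4$. The number of isomorphism classes of integral domains of rank $n$ over $\mathbb{Z}$ with discriminant less than or equal to $X$ is $$\gg_n X^{\frac{1}{2}+\frac{1}{n-\frac{4}{3}}}$$ as $X\to\infty$.
   Context: A ring of rank $n$ over $\mathbb{Z}$ is a commutative ring with identity whose additive group is isomorphic to $\mathbb{Z}^n$; its discriminant is the determinant of the trace form $\mathrm{Tr}(x_ix_j)$ with respect to any $\mathbb{Z}$-basis $x_1,\dots,x_n$. The notation $A\gg_n B$ means $A\ge cB$ for some constant $c>0$ depending only on $n$, for all sufficiently large $X$. *)

theory Defs
  imports
    "HOL-Algebra.Product_Groups"
    "HOL-Algebra.QuotRing"
    "HOL-Analysis.Measure_Space"
    "Jordan_Normal_Form.Determinant"
begin

definition ring_of_rank :: "nat \<Rightarrow> ('a, 'm) ring_scheme \<Rightarrow> bool" where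
  "ring_of_rank n R \<longleftrightarrow>
     cring R \<and> add_monoid R \<cong> product_group {..<n} (\<lambda>_. integer_group)"

definition int_comb :: "('a, 'm) ring_scheme \<Rightarrow> nat \<Rightarrow> (nat \<Rightarrow> 'a) \<Rightarrow> (nat \<Rightarrow> int) \<Rightarrow> 'a" where
  "int_comb R n x c = (\<Oplus>\<^bsub>R\<^esub> i\<in>{..<n}. [c i] \<cdot>\<^bsub>R\<^esub> x i)"

definition is_int_basis :: "('a, 'm) ring_scheme \<Rightarrow> nat \<Rightarrow> (nat \<Rightarrow> 'a) \<Rightarrow> bool" where
  "is_int_basis R n x \<longleftrightarrow>
     (\<forall>i<n. x i \<in> carrier R) \<and>
     (\<forall>a\<in>carrier R. \<exists>!c. c \<in> {..<n} \<rightarrow>\<^sub>E (UNIV :: int set) \<and> a = int_comb R n x c)"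

definition int_coords :: "('a, 'm) ring_scheme \<Rightarrow> nat \<Rightarrow> (nat \<Rightarrow> 'a) \<Rightarrow> 'a \<Rightarrow> nat \<Rightarrow> int" where
  "int_coords R n x a = (THE c. c \<in> {..<n} \<rightarrow>\<^sub>E UNIV \<and> a = int_comb R n x c)"

text \<open>The trace of multiplication by \<open>a\<close>, read off its matrix in the basis \<open>x\<close>: the
  \<open>j\<close>-th column of that matrix consists of the coordinates of \<open>a \<otimes> x j\<close>.\<close>

definition ring_trace :: "('a, 'm) ring_scheme \<Rightarrow> nat \<Rightarrow> (nat \<Rightarrow> 'a) \<Rightarrow> 'a \<Rightarrow> int" where
  "ring_trace R n x a = (\<Sum>j<n. int_coords R n x (a \<otimes>\<^bsub>R\<^esub> x j) j)"

text \<open>Neither the trace nor the determinant of the trace form depends on the basis, so the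
  choice made here is immaterial.\<close>

definition ring_discriminant :: "nat \<Rightarrow> ('a, 'm) ring_scheme \<Rightarrow> int" where
  "ring_discriminant n R =
     (let x = (SOME x. is_int_basis R n x)
      in det (mat n n (\<lambda>(i, j). ring_trace R n x (x i \<otimes>\<^bsub>R\<^esub> x j))))"

text \<open>A ring of positive finite rank is countably infinite, so every isomorphism class of such
  rings is represented by a ring with elements in \<^typ>\<open>nat\<close>. The discriminant is bounded in
  absolute value.\<close>

definition domains_of_rank :: "nat \<Rightarrow> real \<Rightarrow> nat ring set" where
  "domains_of_rank n X =
     {R. domain R \<and> ring_of_rank n R \<and> \<bar>real_of_int (ring_discriminant n R)\<bar> \<le> X}"

text \<open>Counting measure serves as cardinality, because \<^const>\<open>card\<close> sends infinite sets
  to \<open>0\<close>.\<close>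

definition num_domain_classes :: "nat \<Rightarrow> real \<Rightarrow> ennreal" where
  "num_domain_classes n X =
     emeasure (count_space UNIV)
       (domains_of_rank n X //
          {(R, S). R \<in> domains_of_rank n X \<and> S \<in> domains_of_rank n X \<and> R \<simeq> S})"

end

theory Submission
  imports
    Defs
    "Jordan_Normal_Form.Char_Poly"
    "HOL-Algebra.Weak_Morphisms"
    "HOL-Computational_Algebra.Primes"
    "HOL-Real_Asymp.Real_Asymp"
begin

text \<open>
  A binary form \<open>f\<close> of degree \<open>n\<close> with coefficients of size \<open>H\<close> defines a ring of rank \<open>n\<close> and
  discriminant about \<open>H^(2 n - 2)\<close>. If \<open>f\<close> has a root \<open>r\<close> modulo \<open>m\<^sup>2\<close> that is double modulo \<open>m\<close>, this
  ring has an overring of index \<open>m\<close>, generated by \<open>f(r) / (m (r - \<alpha>))\<close> for a root \<open>\<alpha>\<close> of \<open>f\<close>. For a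
  prime \<open>m\<close> there are about \<open>m\<close> residues \<open>r\<close>, and each of them is a root of this kind for one form in
  \<open>m\<^sup>3\<close>. With \<open>m\<close> of size \<open>M\<close> and \<open>H\<close> a large multiple of \<open>M\<^sup>2\<close> this gives about \<open>M^(2 n + 1)\<close> triples
  \<open>(f, m, r)\<close> with rings of discriminant at most about \<open>M^(4 n - 6)\<close>, up to factors \<open>M^\<epsilon>\<close>. The resulting
  exponent \<open>1/2 + 1/(n - 3/2)\<close> exceeds \<open>1/2 + 1/(n - 4/3)\<close>, which absorbs these factors.

  Each ring arises from boundedly many triples: the multiples \<open>m \<alpha>^j / f'(\<alpha>)\<close> of Euler's dual basis of
  \<open>f\<close> have the form \<open>d_j(\<beta>) / g'(\<beta>)\<close> for another such form \<open>g\<close> with root \<open>\<beta>\<close> and integral polynomials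
  \<open>d_j\<close> with coefficients of size \<open>m\<close>. Since \<open>g\<close> divides \<open>d_0 d_(j+1) - d_1 d_j\<close>, whose coefficients
  are smaller than the leading coefficient of \<open>g\<close>, the \<open>d_j\<close> are in geometric progression, so that
  \<open>\<alpha>\<close> is a Moebius transform of \<open>\<beta>\<close>. The transformation is one of boundedly many, and it determines
  \<open>f\<close>, and then \<open>m\<close> and \<open>r\<close>.
\<close>

section \<open>Integral polynomials with a common root\<close>

text \<open>The size of \<open>H\<close> is dictated by the fiber argument. Since
  \<open>f'(y)\<close> has size \<open>H\<close> at every root and so do the coefficients of
  \<open>g(x)/(x - z)\<close>, the factor \<open>H\<close> cancels in the pairings that give the
  \<open>d_j\<close>; their coefficients are at most \<open>K m\<close> with \<open>K\<close>
  depending on \<open>n\<close> alone. A nonzero multiple of \<open>g\<close> has leading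
  coefficient at least \<open>H\<close> in absolute value, so \<open>H\<close> only has to exceed
  \<open>2 n (K m)^2\<close>, and a higher power of \<open>M\<close> would lower the final exponent.
  Comparing \<open>f\<close> with \<open>g\<close> in both directions gives
  \<open>m m' = s s' k^(n - 2)\<close>. For primes \<open>m\<close>, \<open>m'\<close> and
  \<open>n - 2 \<ge> 2\<close> two cases remain: a unit \<open>k\<close>, with Moebius coefficients
  at most \<open>K^2\<close>, or \<open>m = m'\<close> with a unit \<open>s\<close>, where the
  coefficients may grow like the square root of \<open>m\<close> but satisfy congruences modulo
  \<open>m\<close> that again leave boundedly many. The rings are domains because the forms are
  Eisenstein at 2, which is why \<open>m\<close> is taken odd. An elementary bound of Chebyshev type
  for the number of primes suffices, as factors \<open>M^\<epsilon>\<close> are affordable.\<close>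

lemma primitive_dvd_of_smult_eq:
  fixes g P q :: "int poly"
  assumes "content g = 1" "c \<noteq> 0" "smult c P = g * q"
  shows "g dvd P"
proof -
  have "content (smult c P) = content g * content q"
    using assms(3) by (simp add: content_mult)
  hence "normalize c * content P = content q"
    using assms(1) by simp
  hence "c dvd content q"
    by (metis dvd_triv_left normalize_dvd_iff)
  hence "[:c:] dvd q" by (simp add: const_poly_dvd_iff_dvd_content)
  then obtain h where h: "q = [:c:] * h" by (elim dvdE)
  have "smult c P = smult c (g * h)" using assms(3) h by simp
  hence "P = g * h" using assms(2) by (metis smult_cancel)
  thus ?thesis by simp
qed

lemma int_pseudo_division:
  fixes P g :: "int poly"
  assumes "g \<noteq> 0"
  obtains c q r where "c \<noteq> 0" "smult c P = g * q + r" "r = 0 \<or> degree r < degree g"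
proof -
  obtain q r where qr: "pseudo_divmod P g = (q, r)" by fastforce
  show ?thesis
    using pseudo_divmod[OF assms qr] that assms
    by (metis leading_coeff_neq_0 power_not_zero)
qed

text \<open>The pseudo-remainder of \<open>P\<close> has degree below \<open>degree g\<close> but
  vanishes at \<open>degree g\<close> points, so it is 0, and Gauss's lemma removes the constant
  factor. Divisibility over the integers is thus read off from values at complex roots.\<close>

lemma primitive_dvd_of_common_roots:
  fixes P g :: "int poly" and Z :: "complex set"
  assumes g: "content g = 1" and card: "card Z = degree g" and pos: "degree g > 0"
    and gz: "\<And>z. z \<in> Z \<Longrightarrow> poly (of_int_poly g) z = 0"
    and Pz: "\<And>z. z \<in> Z \<Longrightarrow> poly (of_int_poly P) z = 0"
  shows "g dvd P"
proof -
  have g0: "g \<noteq> 0" using g by auto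
  obtain c q r where c: "c \<noteq> 0" "smult c P = g * q + r" "r = 0 \<or> degree r < degree g"
    using int_pseudo_division[OF g0] by metis
  have "r = smult c P - g * q" using c(2) by simp
  hence "\<And>z. z \<in> Z \<Longrightarrow> poly (of_int_poly r) z = 0"
    using gz Pz by (simp add: of_int_poly_hom.hom_minus of_int_poly_hom.hom_mult map_poly_smult hom_distribs)
  hence sub: "Z \<subseteq> {z. poly (of_int_poly r) z = 0}" by auto
  have "r = 0"
  proof (rule ccontr)
    assume r: "r \<noteq> 0"
    hence r': "(of_int_poly r :: complex poly) \<noteq> 0" by simp
    have "card Z \<le> card {z. poly (of_int_poly r :: complex poly) z = 0}"
      by (rule card_mono[OF poly_roots_finite[OF r'] sub])
    also have "\<dots> \<le> degree (of_int_poly r :: complex poly)"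
      by (rule card_poly_roots_bound[OF r'])
    finally show False using c(3) r card by simp
  qed
  thus ?thesis using primitive_dvd_of_smult_eq[OF g c(1)] c(2) by auto
qed

text \<open>At the first index \<open>i\<close> where \<open>p\<close> has an odd coefficient, the
  coefficient of \<open>p * q\<close> is odd because \<open>q\<close> has odd constant term. Only
  the top coefficient of \<open>p * q\<close> is odd, so \<open>i\<close> is the full degree and
  \<open>q\<close> is constant.\<close>

lemma eisenstein_two_factor:
  fixes p q :: "int poly"
  assumes lead: "odd (lead_coeff (p * q))"
    and mid: "\<And>i. i < degree (p * q) \<Longrightarrow> even (coeff (p * q) i)"
    and p0: "even (coeff p 0)" and q0: "odd (coeff q 0)"
  shows "degree q = 0"
proof (rule ccontr)
  assume dq: "degree q \<noteq> 0"
  have ne: "p \<noteq> 0" "q \<noteq> 0" using lead by auto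
  have lp: "odd (coeff p (degree p))" using lead by (simp add: lead_coeff_mult)
  define i where "i = (LEAST i. odd (coeff p i))"
  have i: "odd (coeff p i)" unfolding i_def by (rule LeastI[of _ "degree p"]) (rule lp)
  have ile: "i \<le> degree p" unfolding i_def by (rule Least_le) (rule lp)
  have il: "even (coeff p j)" if "j < i" for j
    using not_less_Least that unfolding i_def by blast
  have "coeff (p * q) i = (\<Sum>j\<le>i. coeff p j * coeff q (i - j))" by (simp add: coeff_mult)
  also have "\<dots> = (\<Sum>j<i. coeff p j * coeff q (i - j)) + coeff p i * coeff q 0"
    by (simp add: lessThan_Suc_atMost[symmetric])
  finally have sp: "coeff (p * q) i = (\<Sum>j<i. coeff p j * coeff q (i - j)) + coeff p i * coeff q 0" .
  have "even (\<Sum>j<i. coeff p j * coeff q (i - j))"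
    by (rule dvd_sum) (use il in auto)
  hence o: "odd (coeff (p * q) i)" unfolding sp using i q0 by simp
  have "i < degree (p * q)" using ile dq ne by (simp add: degree_mult_eq)
  from mid[OF this] o show False by (rule notE[rotated])
qed

lemma eisenstein_two_irreducible:
  fixes p q :: "int poly"
  assumes "odd (lead_coeff (p * q))"
    and "\<And>i. i < degree (p * q) \<Longrightarrow> even (coeff (p * q) i)"
    and "\<not> 4 dvd coeff (p * q) 0"
  shows "degree p = 0 \<or> degree q = 0"
proof (cases "degree (p * q) = 0")
  case True
  moreover have "p \<noteq> 0" "q \<noteq> 0" using assms(1) by auto
  ultimately show ?thesis by (simp add: degree_mult_eq)
next
  case False
  hence ev: "even (coeff p 0 * coeff q 0)" using assms(2)[of 0] by (simp add: coeff_mult)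
  have "\<not> (even (coeff p 0) \<and> even (coeff q 0))"
  proof
    assume "even (coeff p 0) \<and> even (coeff q 0)"
    hence "2 * 2 dvd coeff p 0 * coeff q 0" by (intro mult_dvd_mono) auto
    thus False using assms(3) by (simp add: coeff_mult)
  qed
  then consider "even (coeff p 0)" "odd (coeff q 0)" | "even (coeff q 0)" "odd (coeff p 0)"
    using ev by auto
  thus ?thesis
  proof cases
    case 1 thus ?thesis using eisenstein_two_factor[OF assms(1,2)] by simp
  next
    case 2
    have "degree p = 0"
      by (rule eisenstein_two_factor[of q p, unfolded mult.commute[of q p], OF assms(1,2) 2])
    thus ?thesis ..
  qed
qed

text \<open>An integral polynomial of least degree that vanishes at \<open>z\<close> has a primitive
  part dividing \<open>f\<close>, which by Eisenstein's criterion has full degree. Later this makes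
  evaluation at a single root injective on the ring, which is then a domain.\<close>

lemma eisenstein_two_root:
  fixes f p :: "int poly" and z :: complex
  assumes "odd (lead_coeff f)" "\<And>i. i < degree f \<Longrightarrow> even (coeff f i)" "\<not> 4 dvd coeff f 0"
    and fz: "poly (of_int_poly f) z = 0" and pz: "poly (of_int_poly p) z = 0"
    and deg: "degree p < degree f"
  shows "p = 0"
proof (rule ccontr)
  assume "p \<noteq> 0"
  define Q where "Q = (\<lambda>d. \<exists>h::int poly. h \<noteq> 0 \<and> poly (of_int_poly h) z = 0 \<and> degree h = d)"
  define d where "d = (LEAST d. Q d)"
  have Qp: "Q (degree p)" using \<open>p \<noteq> 0\<close> pz unfolding Q_def by blast
  have "Q d" unfolding d_def by (rule LeastI) (rule Qp)
  then obtain h where h: "h \<noteq> 0" "poly (of_int_poly h) z = 0" "degree h = d"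
    unfolding Q_def by blast
  have dle: "d \<le> degree p" unfolding d_def by (rule Least_le) (rule Qp)
  have least: "\<not> Q e" if "e < d" for e using not_less_Least that unfolding d_def by blast
  define g where "g = primitive_part h"
  have hg: "h = smult (content h) g" unfolding g_def by simp
  have g: "content g = 1" "degree g = d" using h by (auto simp: g_def)
  have g0: "g \<noteq> 0" using g by auto
  have gz: "poly (of_int_poly g) z = 0"
  proof -
    have "poly (of_int_poly h) z = of_int (content h) * poly (of_int_poly g) z"
      by (subst hg) (simp add: hom_distribs)
    thus ?thesis using h by simp
  qed
  obtain c q r where c: "c \<noteq> 0" "smult c f = g * q + r" "r = 0 \<or> degree r < degree g"
    using int_pseudo_division[OF g0] by metis
  have "r = smult c f - g * q" using c(2) by simp
  hence "poly (of_int_poly r) z = 0"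
    using gz fz by (simp add: hom_distribs)
  hence "r = 0" using c(3) least[of "degree r"] g(2) unfolding Q_def by blast
  hence "g dvd f" using primitive_dvd_of_smult_eq[OF g(1) c(1)] c(2) by auto
  then obtain k where k: "f = g * k" by (elim dvdE)
  have "degree g = 0 \<or> degree k = 0"
    by (rule eisenstein_two_irreducible) (use assms(1-3) in \<open>simp_all add: k\<close>)
  moreover have "degree g \<noteq> 0"
  proof
    assume "degree g = 0"
    then obtain a where "g = [:a:]" by (rule degree_eq_zeroE)
    thus False using gz g0 by simp
  qed
  ultimately have "degree f \<le> degree g" using k degree_mult_le[of g k] by simp
  thus False using g(2) dle deg by simp
qed

section \<open>Discriminants through evaluations\<close>

text \<open>The maps \<open>\<sigma> k\<close> play the role of the complex embeddings. They are
  kept abstract so that the results apply both to a ring of functions and to its copy on the natural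
  numbers.\<close>

locale evaluated_ring = cring N for N :: "('a, 'b) ring_scheme" (structure) +
  fixes n :: nat and \<sigma> :: "nat \<Rightarrow> 'a \<Rightarrow> complex" and e :: "nat \<Rightarrow> 'a"
  assumes eval_add: "k < n \<Longrightarrow> a \<in> carrier N \<Longrightarrow> b \<in> carrier N \<Longrightarrow> \<sigma> k (a \<oplus> b) = \<sigma> k a + \<sigma> k b"
    and eval_mult: "k < n \<Longrightarrow> a \<in> carrier N \<Longrightarrow> b \<in> carrier N \<Longrightarrow> \<sigma> k (a \<otimes> b) = \<sigma> k a * \<sigma> k b"
    and eval_inj: "a \<in> carrier N \<Longrightarrow> b \<in> carrier N \<Longrightarrow> (\<And>k. k < n \<Longrightarrow> \<sigma> k a = \<sigma> k b) \<Longrightarrow> a = b"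
    and e_closed: "i < n \<Longrightarrow> e i \<in> carrier N"
    and e_span: "a \<in> carrier N \<Longrightarrow> \<exists>c :: nat \<Rightarrow> int. \<forall>k<n. \<sigma> k a = (\<Sum>i<n. of_int (c i) * \<sigma> k (e i))"
    and det_nz: "det (mat n n (\<lambda>(i, k). \<sigma> k (e i))) \<noteq> 0"
begin

abbreviation evmat :: "(nat \<Rightarrow> 'a) \<Rightarrow> complex mat" where
  "evmat x \<equiv> mat n n (\<lambda>(i, k). \<sigma> k (x i))"

lemma eval_zero: "k < n \<Longrightarrow> \<sigma> k \<zero> = 0"
  using eval_add[of k \<zero> \<zero>] by simp

lemma eval_minus: "k < n \<Longrightarrow> a \<in> carrier N \<Longrightarrow> \<sigma> k (\<ominus> a) = - \<sigma> k a"
  using eval_add[of k a "\<ominus> a"] eval_zero[of k] by (simp add: r_neg add_eq_0_iff)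

lemma eval_nat_pow: "k < n \<Longrightarrow> a \<in> carrier N \<Longrightarrow> \<sigma> k ([(m::nat)] \<cdot> a) = of_nat m * \<sigma> k a"
  by (induction m) (simp_all add: eval_zero eval_add algebra_simps)

lemma eval_int_pow: "k < n \<Longrightarrow> a \<in> carrier N \<Longrightarrow> \<sigma> k ([(m::int)] \<cdot> a) = of_int m * \<sigma> k a"
  by (cases "m \<ge> 0") (simp_all add: add_pow_int_ge add_pow_int_lt eval_nat_pow eval_minus)

lemma comb_closed:
  assumes "\<forall>i<n. x i \<in> carrier N"
  shows "int_comb N n x c \<in> carrier N"
  unfolding int_comb_def by (rule finsum_closed) (use assms in auto)

lemma eval_comb:
  assumes x: "\<forall>i<n. x i \<in> carrier N" and k: "k < n"
  shows "\<sigma> k (int_comb N n x c) = (\<Sum>i<n. of_int (c i) * \<sigma> k (x i))"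
proof -
  have "m \<le> n \<Longrightarrow> (\<Oplus>i\<in>{..<m}. [c i] \<cdot> x i) \<in> carrier N \<and>
     \<sigma> k (\<Oplus>i\<in>{..<m}. [c i] \<cdot> x i) = (\<Sum>i<m. of_int (c i) * \<sigma> k (x i))" for m
  proof (induction m)
    case 0 show ?case using eval_zero k by simp
  next
    case (Suc m)
    have xm: "x m \<in> carrier N" using x Suc.prems by simp
    have cl: "(\<lambda>i. [c i] \<cdot> x i) \<in> {..<m} \<rightarrow> carrier N" using x Suc.prems by auto
    have "(\<Oplus>i\<in>{..<Suc m}. [c i] \<cdot> x i) = [c m] \<cdot> x m \<oplus> (\<Oplus>i\<in>{..<m}. [c i] \<cdot> x i)"
      unfolding lessThan_Suc by (rule finsum_insert) (use cl xm in auto)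
    thus ?case using Suc k xm by (simp add: eval_add eval_int_pow)
  qed
  thus ?thesis unfolding int_comb_def by blast
qed

lemma evmat_basis_change:
  assumes "\<And>i k. i < n \<Longrightarrow> k < n \<Longrightarrow> \<sigma> k (x i) = (\<Sum>j<n. of_int (U i j) * \<sigma> k (y j))"
  shows "evmat x = map_mat of_int (mat n n (\<lambda>(i, j). U i j)) * evmat y"
  by (rule eq_matI) (auto simp: scalar_prod_def assms lessThan_atLeast0)

lemma e_is_int_basis: "is_int_basis N n e"
proof -
  have "\<exists>!c. c \<in> {..<n} \<rightarrow>\<^sub>E (UNIV :: int set) \<and> a = int_comb N n e c" if a: "a \<in> carrier N" for a
  proof -
    obtain c :: "nat \<Rightarrow> int" where c: "\<forall>k<n. \<sigma> k a = (\<Sum>i<n. of_int (c i) * \<sigma> k (e i))"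
      using e_span[OF a] by blast
    let ?c = "restrict c {..<n}"
    have "a = int_comb N n e ?c"
      by (rule eval_inj[OF a comb_closed]) (use e_closed c in \<open>auto simp: eval_comb\<close>)
    moreover have "d = ?c" if d: "d \<in> {..<n} \<rightarrow>\<^sub>E (UNIV :: int set)" "a = int_comb N n e d" for d
    proof -
      define v where "v = vec n (\<lambda>i. of_int (d i - ?c i) :: complex)"
      have "transpose_mat (evmat e) *\<^sub>v v = 0\<^sub>v n"
      proof (rule eq_vecI)
        fix k assume "k < dim_vec (0\<^sub>v n :: complex vec)"
        hence k: "k < n" by simp
        have "(\<Sum>i<n. of_int (d i) * \<sigma> k (e i)) = (\<Sum>i<n. of_int (c i) * \<sigma> k (e i))"
          using eval_comb[of e k d] e_closed d(2) c k by simp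
        thus "(transpose_mat (evmat e) *\<^sub>v v) $ k = 0\<^sub>v n $ k"
          using k by (simp add: scalar_prod_def v_def algebra_simps sum_subtractf lessThan_atLeast0)
      qed auto
      moreover have v_carrier: "v \<in> carrier_vec n" by (simp add: v_def)
      moreover have "det (transpose_mat (evmat e)) \<noteq> 0"
        using det_nz by (simp add: det_transpose[of _ n])
      ultimately have "v = 0\<^sub>v n"
        using det_0_iff_vec_prod_zero_field[of "transpose_mat (evmat e)" n]
        by (metis mat_carrier transpose_carrier_mat v_carrier)
      have "d i = ?c i" if "i < n" for i
        using arg_cong[OF \<open>v = 0\<^sub>v n\<close>, of "\<lambda>v. v $ i"] that by (simp add: v_def)
      thus ?thesis by (intro PiE_ext[OF d(1), of ?c]) auto
    qed
    ultimately show ?thesis by (intro ex1I[of _ ?c]) auto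
  qed
  thus ?thesis unfolding is_int_basis_def by (intro conjI allI impI ballI e_closed)
qed

context
  fixes x assumes bas: "is_int_basis N n x"
begin

lemma basis_closed: "\<forall>i<n. x i \<in> carrier N"
  using bas unfolding is_int_basis_def by blast

lemma coords:
  assumes "a \<in> carrier N"
  shows "int_coords N n x a \<in> {..<n} \<rightarrow>\<^sub>E UNIV" "int_comb N n x (int_coords N n x a) = a"
proof -
  have "\<exists>!c. c \<in> {..<n} \<rightarrow>\<^sub>E (UNIV :: int set) \<and> a = int_comb N n x c"
    using bas assms unfolding is_int_basis_def by blast
  from theI'[OF this] show "int_coords N n x a \<in> {..<n} \<rightarrow>\<^sub>E UNIV" "int_comb N n x (int_coords N n x a) = a"
    unfolding int_coords_def by auto
qed

lemma coords_unique:
  assumes "c \<in> {..<n} \<rightarrow>\<^sub>E UNIV"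
  shows "int_coords N n x (int_comb N n x c) = c"
  using coords[OF comb_closed[OF basis_closed, of c]] bas comb_closed[OF basis_closed, of c] assms
  unfolding is_int_basis_def by metis

lemma eval_coords:
  assumes "a \<in> carrier N" "k < n"
  shows "\<sigma> k a = (\<Sum>i<n. of_int (int_coords N n x a i) * \<sigma> k (x i))"
  using eval_comb[OF basis_closed assms(2), of "int_coords N n x a"] coords(2)[OF assms(1)] by simp

text \<open>The discriminant is defined through a basis picked by \<open>SOME\<close>, so its value
  must not depend on the basis. The transition matrices \<open>U\<close> and \<open>V\<close> are
  integral with \<open>det V * det U = 1\<close>, hence of determinant 1 or -1.\<close>

lemma det_basis_squared: "(det (evmat x))\<^sup>2 = (det (evmat e))\<^sup>2"
proof -
  define U where "U = mat n n (\<lambda>(i, j). int_coords N n e (x i) j)"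
  define V where "V = mat n n (\<lambda>(i, j). int_coords N n x (e i) j)"
  have 1: "evmat x = map_mat of_int U * evmat e" unfolding U_def
  proof (rule evmat_basis_change)
    fix i k assume "i < n" "k < n"
    thus "\<sigma> k (x i) = (\<Sum>j<n. of_int (int_coords N n e (x i) j) * \<sigma> k (e j))"
      using evaluated_ring.eval_coords[OF evaluated_ring_axioms e_is_int_basis] basis_closed by simp
  qed
  have 2: "evmat e = map_mat of_int V * evmat x" unfolding V_def
    by (rule evmat_basis_change) (use eval_coords e_closed in simp)
  have d1: "det (evmat x) = of_int (det U) * det (evmat e)"
    by (subst 1, subst det_mult[of _ n]) (auto simp: U_def)
  have d2: "det (evmat e) = of_int (det V) * det (evmat x)"
    by (subst 2, subst det_mult[of _ n]) (auto simp: V_def)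
  have "det (evmat e) = of_int (det V * det U) * det (evmat e)"
    by (subst (1) d2, subst d1) simp
  hence "(of_int (det V * det U) :: complex) = 1" using det_nz by simp
  hence "det V * det U = 1" by (simp only: of_int_eq_1_iff)
  hence "(det U)\<^sup>2 = 1" by (auto simp: zmult_eq_1_iff)
  hence "(of_int ((det U)\<^sup>2) :: complex) = 1" by simp
  thus ?thesis unfolding d1 by (simp add: power_mult_distrib)
qed

text \<open>The matrix \<open>evmat x\<close> diagonalises multiplication by \<open>a\<close>, with
  eigenvalues \<open>\<sigma> k a\<close>; \<open>B\<close> is its inverse.\<close>

lemma trace_eq_sum_eval:
  assumes a: "a \<in> carrier N"
  shows "of_int (ring_trace N n x a) = (\<Sum>k<n. \<sigma> k a)"
proof -
  have "det (evmat x) \<noteq> 0" using det_basis_squared det_nz by auto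
  then obtain B where B: "B \<in> carrier_mat n n" "B * evmat x = 1\<^sub>m n" "evmat x * B = 1\<^sub>m n"
    using det_non_zero_imp_unit[of "evmat x" n "()"]
    unfolding Units_def ring_mat_def by auto
  have B1: "(\<Sum>j<n. B $$ (k, j) * \<sigma> k (x j)) = 1" if "k < n" for k
  proof -
    have "(B * evmat x) $$ (k, k) = 1" using B that by simp
    thus ?thesis using B(1) that by (simp add: scalar_prod_def lessThan_atLeast0)
  qed
  have B2: "(\<Sum>k<n. \<sigma> k (x i) * B $$ (k, j)) = (if i = j then 1 else 0)" if "i < n" "j < n" for i j
  proof -
    have "(evmat x * B) $$ (i, j) = (if i = j then 1 else 0)" using B that by simp
    thus ?thesis using B(1) that by (simp add: scalar_prod_def lessThan_atLeast0)
  qed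
  let ?M = "\<lambda>j i. (of_int (int_coords N n x (a \<otimes> x j) i) :: complex)"
  have "?M j j = (\<Sum>k<n. \<sigma> k a * (B $$ (k, j) * \<sigma> k (x j)))" if j: "j < n" for j
  proof -
    have "?M j j = (\<Sum>i<n. ?M j i * (if i = j then 1 else 0))"
      using j by (simp add: if_distrib[of "(*) _"] cong: if_cong)
    also have "\<dots> = (\<Sum>i<n. ?M j i * (\<Sum>k<n. \<sigma> k (x i) * B $$ (k, j)))"
      by (rule sum.cong) (use B2 j in auto)
    also have "\<dots> = (\<Sum>k<n. (\<Sum>i<n. ?M j i * \<sigma> k (x i)) * B $$ (k, j))"
      by (simp add: sum_distrib_left sum_distrib_right mult.assoc) (rule sum.swap)
    also have "\<dots> = (\<Sum>k<n. \<sigma> k (a \<otimes> x j) * B $$ (k, j))"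
      by (rule sum.cong) (use eval_coords[of "a \<otimes> x j"] a basis_closed j in auto)
    also have "\<dots> = (\<Sum>k<n. \<sigma> k a * (B $$ (k, j) * \<sigma> k (x j)))"
      by (rule sum.cong) (use a basis_closed j in \<open>auto simp: eval_mult\<close>)
    finally show ?thesis .
  qed
  hence "of_int (ring_trace N n x a) = (\<Sum>j<n. \<Sum>k<n. \<sigma> k a * (B $$ (k, j) * \<sigma> k (x j)))"
    unfolding ring_trace_def by simp
  also have "\<dots> = (\<Sum>k<n. \<sigma> k a * (\<Sum>j<n. B $$ (k, j) * \<sigma> k (x j)))"
    by (subst sum.swap) (simp add: sum_distrib_left)
  also have "\<dots> = (\<Sum>k<n. \<sigma> k a)" using B1 by simp
  finally show ?thesis .
qed

lemma det_trace_form: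
  "of_int (det (mat n n (\<lambda>(i, j). ring_trace N n x (x i \<otimes> x j)))) = (det (evmat e))\<^sup>2"
proof -
  let ?T = "mat n n (\<lambda>(i, j). ring_trace N n x (x i \<otimes> x j))"
  have "map_mat of_int ?T = evmat x * transpose_mat (evmat x)"
    by (rule eq_matI)
      (use basis_closed in \<open>auto simp: trace_eq_sum_eval eval_mult scalar_prod_def lessThan_atLeast0\<close>)
  hence "det (map_mat of_int ?T :: complex mat) = det (evmat x) * det (evmat x)"
    by (simp add: det_mult[of _ n] det_transpose[of _ n])
  thus ?thesis using det_basis_squared by (simp add: power2_eq_square)
qed

end

theorem discriminant_eq: "of_int (ring_discriminant n N) = (det (evmat e))\<^sup>2"
  unfolding ring_discriminant_def Let_def
  by (rule det_trace_form[OF someI[of "is_int_basis N n", OF e_is_int_basis]])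

theorem has_rank: "ring_of_rank n N"
proof -
  let ?h = "int_coords N n e"
  have bas: "is_int_basis N n e" by (rule e_is_int_basis)
  have sum: "int_comb N n e (\<lambda>i\<in>{..<n}. ?h a i + ?h b i) = a \<oplus> b" if "a \<in> carrier N" "b \<in> carrier N" for a b
  proof (rule eval_inj)
    fix k assume k: "k < n"
    show "\<sigma> k (int_comb N n e (\<lambda>i\<in>{..<n}. ?h a i + ?h b i)) = \<sigma> k (a \<oplus> b)"
      using that k e_closed eval_coords[OF bas that(1) k] eval_coords[OF bas that(2) k]
      by (simp add: eval_comb eval_add algebra_simps sum.distrib)
  qed (use that e_closed in \<open>auto simp: comb_closed\<close>)
  have "?h \<in> iso (add_monoid N) (product_group {..<n} (\<lambda>_. integer_group))"
  proof (rule isoI)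
    show "?h \<in> hom (add_monoid N) (product_group {..<n} (\<lambda>_. integer_group))"
    proof (rule homI)
      show "?h a \<in> carrier (product_group {..<n} (\<lambda>_. integer_group))" if "a \<in> carrier (add_monoid N)" for a
        using coords(1)[OF bas] that by simp
      show "?h (a \<otimes>\<^bsub>add_monoid N\<^esub> b) = ?h a \<otimes>\<^bsub>product_group {..<n} (\<lambda>_. integer_group)\<^esub> ?h b"
        if "a \<in> carrier (add_monoid N)" "b \<in> carrier (add_monoid N)" for a b
      proof -
        have "?h (int_comb N n e (\<lambda>i\<in>{..<n}. ?h a i + ?h b i)) = (\<lambda>i\<in>{..<n}. ?h a i + ?h b i)"
          by (rule coords_unique[OF bas]) auto
        thus ?thesis using sum[of a b] that by simp
      qed
    qed
    show "bij_betw ?h (carrier (add_monoid N)) (carrier (product_group {..<n} (\<lambda>_. integer_group)))"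
      by (rule bij_betw_byWitness[where f' = "int_comb N n e"])
        (use coords[OF bas] coords_unique[OF bas] comb_closed e_closed in auto)
  qed
  thus ?thesis unfolding ring_of_rank_def using is_isoI is_cring by blast
qed

end

section \<open>Roots of a form and Euler's formula\<close>

abbreviation ev :: "int poly \<Rightarrow> complex \<Rightarrow> complex" where
  "ev p z \<equiv> poly (of_int_poly p) z"

definition croots :: "int poly \<Rightarrow> complex set" where
  "croots f = {z. ev f z = 0}"

lemma poly_shift_Suc_rec: "poly_shift j p = pCons (coeff p j) (poly_shift (Suc j) p)"
  by (rule poly_eqI) (auto simp: coeff_poly_shift coeff_pCons split: nat.split)

lemma coeff_synthetic_div:
  "coeff (synthetic_div p c) i = poly (poly_shift (Suc i) p) c"
proof (induction p arbitrary: i)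
  case 0 show ?case by simp
next
  case (pCons a p)
  have sh: "poly_shift (Suc i) (pCons a p) = poly_shift i p"
    by (rule poly_eqI) (simp add: coeff_poly_shift)
  show ?case
  proof (cases i)
    case 0 thus ?thesis using sh by simp
  next
    case (Suc k) thus ?thesis using sh pCons.IH by simp
  qed
qed

lemma synthetic_div_mult:
  fixes p :: "'a::comm_ring_1 poly"
  assumes "poly p c = 0"
  shows "[:- c, 1:] * synthetic_div p c = p"
  using synthetic_div_correct'[of c p] assms by simp

lemma poly_synthetic_div_self:
  fixes p :: "'a::idom poly"
  shows "poly (synthetic_div p c) c = poly (pderiv p) c"
proof -
  have *: "poly (pderiv ([:- c, 1:] * s + [:k:])) c = poly s c" for s and k :: 'a
    by (simp add: pderiv_add pderiv_diff pderiv_smult pderiv_pCons)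
  show ?thesis using *[of "synthetic_div p c" "poly p c"] unfolding synthetic_div_correct' ..
qed

text \<open>For a root \<open>z\<close> of \<open>f\<close>, the numbers \<open>tail f (Suc j) z\<close> are the coefficients
  of \<open>f(x)/(x - z)\<close>.\<close>

definition tail :: "int poly \<Rightarrow> nat \<Rightarrow> complex \<Rightarrow> complex" where
  "tail f j z = ev (poly_shift j f) z"

lemma tail_rec: "tail f j z = of_int (coeff f j) + z * tail f (Suc j) z"
  unfolding tail_def by (subst poly_shift_Suc_rec) (simp add: of_int_hom.map_poly_pCons_hom)

lemma tail_0: "z \<in> croots f \<Longrightarrow> tail f 0 z = 0"
  by (simp add: tail_def croots_def)

lemma tail_gt: "degree f < j \<Longrightarrow> tail f j z = 0"
proof -
  assume "degree f < j"
  hence "poly_shift j f = 0" by (intro poly_eqI) (simp add: coeff_poly_shift coeff_eq_0)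
  thus ?thesis by (simp add: tail_def)
qed

lemma tail_degree: "tail f (degree f) z = of_int (lead_coeff f)"
  by (subst tail_rec) (simp add: tail_gt)

definition quot :: "int poly \<Rightarrow> complex \<Rightarrow> complex poly" where
  "quot f z = synthetic_div (of_int_poly f) z"

lemma coeff_quot: "coeff (quot f z) j = tail f (Suc j) z"
proof -
  have "poly_shift (Suc j) (of_int_poly f) = (of_int_poly (poly_shift (Suc j) f) :: complex poly)"
    by (rule poly_eqI) (simp add: coeff_poly_shift)
  thus ?thesis by (simp add: quot_def coeff_synthetic_div tail_def)
qed

lemma degree_quot: "degree (quot f z) = degree f - 1"
  by (simp add: quot_def degree_synthetic_div)

lemma poly_quot_sum: "degree f > 0 \<Longrightarrow> poly (quot f z) x = (\<Sum>j<degree f. tail f (Suc j) z * x ^ j)"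
  unfolding poly_altdef degree_quot coeff_quot
  by (rule sum.cong) auto

lemma poly_quot_mult: "z \<in> croots f \<Longrightarrow> (x - z) * poly (quot f z) x = ev f x"
  unfolding quot_def croots_def
  using arg_cong[OF synthetic_div_mult[of "of_int_poly f" z], of "\<lambda>p. poly p x"]
  by (simp add: left_diff_distrib)

lemma poly_quot_self: "poly (quot f z) z = ev (pderiv f) z"
  unfolding quot_def poly_synthetic_div_self by (simp add: of_int_hom.map_poly_pderiv)

lemma poly_quot_other: "z \<in> croots f \<Longrightarrow> y \<in> croots f \<Longrightarrow> y \<noteq> z \<Longrightarrow> poly (quot f z) y = 0"
  using poly_quot_mult[of z f y] by (simp add: croots_def)

locale simple_roots =
  fixes n :: nat and f :: "int poly"
  assumes deg: "degree f = n" and n_pos: "n \<ge> 2"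
    and simple: "z \<in> croots f \<Longrightarrow> ev (pderiv f) z \<noteq> 0"
begin

lemma f_nz: "f \<noteq> 0" and lead_nz: "lead_coeff f \<noteq> 0"
  using deg n_pos by auto

lemma finite_roots: "finite (croots f)"
  unfolding croots_def by (rule poly_roots_finite) (simp add: f_nz)

lemma card_roots: "card (croots f) = n"
proof -
  have "rsquarefree (of_int_poly f :: complex poly)"
    unfolding rsquarefree_roots using simple
    by (auto simp: croots_def of_int_hom.map_poly_pderiv)
  hence "card {z. ev f z = 0} = degree (of_int_poly f :: complex poly)"
    using rsquarefree_card_degree[of "of_int_poly f"] f_nz by simp
  thus ?thesis by (simp add: croots_def deg)
qed

lemma eq_of_roots:
  fixes p q :: "complex poly"
  assumes "degree p < n" "degree q < n" "\<And>z. z \<in> croots f \<Longrightarrow> poly p z = poly q z"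
  shows "p = q"
proof (rule ccontr)
  assume "p \<noteq> q"
  hence nz: "p - q \<noteq> 0" by simp
  have "n \<le> card {z. poly (p - q) z = 0}"
    unfolding card_roots[symmetric]
    by (rule card_mono[OF poly_roots_finite[OF nz]]) (use assms(3) in auto)
  also have "\<dots> \<le> degree (p - q)" by (rule card_poly_roots_bound[OF nz])
  also have "\<dots> < n" by (rule degree_diff_less[OF assms(1,2)])
  finally show False by simp
qed

text \<open>Euler's formula: Lagrange interpolation of \<open>x ^ j\<close> at the roots of \<open>f\<close>.\<close>

lemma euler_sum:
  assumes "i < n" "j < n"
  shows "(\<Sum>z\<in>croots f. z ^ j / ev (pderiv f) z * tail f (Suc i) z) = (if i = j then 1 else 0)"
proof -
  define P where "P = (\<Sum>z\<in>croots f. smult (z ^ j / ev (pderiv f) z) (quot f z))"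
  have "P = monom 1 j"
  proof (rule eq_of_roots)
    have "degree P \<le> n - 1" unfolding P_def
      by (rule degree_sum_le[OF finite_roots]) (metis deg degree_quot degree_smult_le)
    thus "degree P < n" using n_pos by simp
    show "degree (monom 1 j :: complex poly) < n" using assms by (simp add: degree_monom_eq)
    fix y assume y: "y \<in> croots f"
    have "poly P y = (\<Sum>z\<in>croots f. z ^ j / ev (pderiv f) z * poly (quot f z) y)"
      by (simp add: P_def poly_sum)
    also have "\<dots> = (\<Sum>z\<in>croots f. if z = y then y ^ j else 0)"
      by (rule sum.cong[OF refl]) (use y simple in \<open>auto simp: poly_quot_other poly_quot_self\<close>)
    also have "\<dots> = y ^ j" using y finite_roots by simp
    finally show "poly P y = poly (monom 1 j) y" by (simp add: poly_monom)
  qed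
  hence "coeff P i = (if i = j then 1 else 0)" by simp
  thus ?thesis by (simp add: P_def coeff_sum coeff_quot)
qed

text \<open>This is the top coefficient in Euler's formula, where the tail is the constant leading
  coefficient. It removes additive constants from the pairing with
  \<open>z^j / f'(z)\<close>.\<close>

lemma euler_sum_power:
  assumes "j < n - 1"
  shows "(\<Sum>z\<in>croots f. z ^ j / ev (pderiv f) z) = 0"
proof -
  have "(\<Sum>z\<in>croots f. z ^ j / ev (pderiv f) z * tail f (Suc (n - 1)) z) = 0"
    using euler_sum[of "n - 1" j] assms by auto
  hence "(\<Sum>z\<in>croots f. z ^ j / ev (pderiv f) z) * of_int (lead_coeff f) = 0"
    using n_pos tail_degree[of f] deg by (simp add: sum_distrib_right)
  thus ?thesis using lead_nz by simp
qed

end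

section \<open>The ring of a form with a double root modulo \<open>m\<close>\<close>

lemma ev_pCons [simp]: "ev (pCons a p) z = of_int a + z * ev p z"
  by (simp add: of_int_hom.map_poly_pCons_hom)

locale double_root = simple_roots +
  fixes m r :: int
  assumes m_pos: "m > 0" and div1: "m dvd poly (pderiv f) r" and div2: "m\<^sup>2 dvd poly f r"
begin

text \<open>At a root \<open>z\<close> different from \<open>r\<close> this is
  \<open>f(r) / (m (r - z))\<close>. Written through \<open>quot\<close>, \<open>m\<close> times it
  is visibly an integral combination of tails, with coefficients \<open>r^j\<close>.\<close>

definition w :: "complex \<Rightarrow> complex" where
  "w z = poly (quot f z) (of_int r) / of_int m"

text \<open>The ring of \<open>f\<close> itself has the basis
  \<open>tail f 1, ..., tail f (n - 1), 1\<close>; in the overring \<open>w\<close> takes the place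
  of \<open>tail f 1\<close>.\<close>

definition bas :: "nat \<Rightarrow> complex \<Rightarrow> complex" where
  "bas j z = (if j = 0 then w z else if j < n - 1 then tail f (Suc j) z else 1)"

definition lat :: "(complex \<Rightarrow> complex) \<Rightarrow> bool" where
  "lat u \<longleftrightarrow> (\<exists>c :: nat \<Rightarrow> int. \<forall>z\<in>croots f. u z = (\<Sum>j<n. of_int (c j) * bas j z))"

lemma lat_cong: "(\<And>z. z \<in> croots f \<Longrightarrow> u z = v z) \<Longrightarrow> lat u \<longleftrightarrow> lat v"
  unfolding lat_def by (simp cong: ball_cong)

lemma lat_bas: "j < n \<Longrightarrow> lat (bas j)"
  unfolding lat_def
  by (rule exI[of _ "\<lambda>i. of_bool (i = j)"]) (simp add: of_bool_def[symmetric])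

lemma lat_add: "lat u \<Longrightarrow> lat v \<Longrightarrow> lat (\<lambda>z. u z + v z)"
  unfolding lat_def
proof (elim exE)
  fix c d :: "nat \<Rightarrow> int"
  assume "\<forall>z\<in>croots f. u z = (\<Sum>j<n. of_int (c j) * bas j z)"
    "\<forall>z\<in>croots f. v z = (\<Sum>j<n. of_int (d j) * bas j z)"
  thus "\<exists>c::nat \<Rightarrow> int. \<forall>z\<in>croots f. u z + v z = (\<Sum>j<n. of_int (c j) * bas j z)"
    by (intro exI[of _ "\<lambda>j. c j + d j"]) (simp add: algebra_simps sum.distrib)
qed

lemma lat_scale: "lat u \<Longrightarrow> lat (\<lambda>z. of_int k * u z)"
  unfolding lat_def
proof (elim exE)
  fix c :: "nat \<Rightarrow> int"
  assume "\<forall>z\<in>croots f. u z = (\<Sum>j<n. of_int (c j) * bas j z)"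
  thus "\<exists>c::nat \<Rightarrow> int. \<forall>z\<in>croots f. of_int k * u z = (\<Sum>j<n. of_int (c j) * bas j z)"
    by (intro exI[of _ "\<lambda>j. k * c j"]) (simp add: sum_distrib_left mult.assoc)
qed

lemma lat_0: "lat (\<lambda>_. 0)"
  unfolding lat_def by (rule exI[of _ "\<lambda>_. 0"]) simp

lemma lat_minus: "lat u \<Longrightarrow> lat (\<lambda>z. - u z)"
  using lat_scale[of u "-1"] by simp

lemma lat_diff: "lat u \<Longrightarrow> lat v \<Longrightarrow> lat (\<lambda>z. u z - v z)"
  using lat_add[of u "\<lambda>z. - v z"] lat_minus[of v] by simp

lemma lat_sum: "(\<And>i. i \<in> I \<Longrightarrow> lat (u i)) \<Longrightarrow> lat (\<lambda>z. \<Sum>i\<in>I. u i z)"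
  by (induction I rule: infinite_finite_induct) (auto simp: lat_0 intro: lat_add)

lemma lat_1: "lat (\<lambda>_. 1)"
  using lat_bas[of "n - 1"] n_pos unfolding bas_def by simp

lemma lat_w: "lat w"
  using lat_bas[of 0] n_pos unfolding bas_def by simp

lemma m_w: "of_int m * w z = (\<Sum>j<n. tail f (Suc j) z * of_int r ^ j)"
  using poly_quot_sum[of f z "of_int r"] deg n_pos m_pos by (simp add: w_def)

lemma lat_tail: "lat (tail f j)"
proof -
  have ge2: "lat (tail f j)" if "j \<ge> 2" for j
  proof (cases "j < n")
    case True
    hence "bas (j - 1) = tail f j" using that by (auto simp: bas_def fun_eq_iff)
    thus ?thesis using lat_bas[of "j - 1"] True by simp
  next
    case False
    have "lat (\<lambda>_. of_int (lead_coeff f) * 1)" by (rule lat_scale[OF lat_1])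
    moreover have "tail f j = (\<lambda>z. if j = n then of_int (lead_coeff f) else 0)"
      using tail_degree[of f] tail_gt[of f j] deg False by (auto simp: fun_eq_iff)
    ultimately show ?thesis using lat_0 by auto
  qed
  \<comment> \<open>In \<open>m_w\<close> the coefficient of \<open>tail f 1\<close> is
    \<open>r^0 = 1\<close>, so the tail absent from the basis is recovered integrally.\<close>
  have "tail f 1 = (\<lambda>z. of_int m * w z - (\<Sum>j\<in>{1..<n}. of_int (r ^ j) * tail f (Suc j) z))"
  proof
    fix z
    have "(\<Sum>j<n. tail f (Suc j) z * of_int r ^ j)
        = tail f 1 z + (\<Sum>j\<in>{1..<n}. tail f (Suc j) z * of_int r ^ j)"
      using n_pos by (simp add: lessThan_atLeast0 sum.atLeast_Suc_lessThan)
    thus "tail f 1 z = of_int m * w z - (\<Sum>j\<in>{1..<n}. of_int (r ^ j) * tail f (Suc j) z)"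
      unfolding m_w by (simp add: mult.commute)
  qed
  moreover have "lat (\<lambda>z. of_int m * w z - (\<Sum>j\<in>{1..<n}. of_int (r ^ j) * tail f (Suc j) z))"
    by (intro lat_diff lat_scale lat_sum lat_w ge2) auto
  ultimately have one: "lat (tail f 1)" by simp
  have zero: "lat (tail f 0)" using lat_0 lat_cong[of "tail f 0" "\<lambda>_. 0"] tail_0 by blast
  consider "j = 0" | "j = 1" | "j \<ge> 2" by linarith
  thus ?thesis using zero one ge2 by cases auto
qed

lemma tail_down_induct:
  assumes top: "\<And>i. i > n \<Longrightarrow> P i" and step: "\<And>i. i \<le> n \<Longrightarrow> P (Suc i) \<Longrightarrow> P i"
  shows "P (i :: nat)"
proof (cases "i > n")
  case True thus ?thesis by (rule top)
next
  case False
  hence "i \<le> Suc n" by simp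
  thus ?thesis by (induction i rule: inc_induct) (auto intro: top step)
qed

text \<open>The factor \<open>z\<close> in \<open>tail f i = f_i + z * tail f (Suc i)\<close> is
  absorbed by the other tail, since \<open>z * tail f (Suc k) = tail f k - f_k\<close>. One index
  goes up and the other down, until the first passes \<open>n\<close> or the second is 0, and then
  the product vanishes on the roots.\<close>

lemma lat_tail_tail: "lat (\<lambda>z. tail f i z * tail f j z)"
proof -
  have "\<forall>j. lat (\<lambda>z. tail f i z * tail f j z)"
  proof (induction i rule: tail_down_induct)
    case (1 i) thus ?case using deg lat_0 by (simp add: tail_gt)
  next
    case (2 i)
    show ?case
    proof
      fix j show "lat (\<lambda>z. tail f i z * tail f j z)"
      proof (cases j)
        case 0
        thus ?thesis using lat_0 lat_cong[of "\<lambda>z. tail f i z * tail f j z" "\<lambda>_. 0"] tail_0 by auto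
      next
        case (Suc k)
        have eq: "tail f i z * tail f j z = of_int (coeff f i) * tail f j z +
          (tail f (Suc i) z * tail f k z - of_int (coeff f k) * tail f (Suc i) z)" for z
          unfolding Suc tail_rec[of f i] tail_rec[of f k] by (simp add: algebra_simps)
        show ?thesis unfolding eq
          by (intro lat_add lat_diff lat_scale lat_tail) (use 2 in blast)
      qed
    qed
  qed
  thus ?thesis by blast
qed

lemma w_root: "z \<in> croots f \<Longrightarrow> z * w z = of_int r * w z - of_int (poly f r) / of_int m"
  using poly_quot_mult[of z f "of_int r"] m_pos
  by (simp add: w_def field_simps)

text \<open>This is the divided difference of \<open>poly_shift i f\<close> between \<open>r\<close>
  and \<open>z\<close>, because the quotient of \<open>poly_shift i f\<close> by
  \<open>x - z\<close> has the later tails as its coefficients.\<close>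

definition E :: "nat \<Rightarrow> complex \<Rightarrow> complex" where
  "E i z = (\<Sum>l\<in>{i..<n}. of_int r ^ (l - i) * tail f (Suc l) z)"

lemma E_rec: "i \<le> n \<Longrightarrow> E i z = tail f (Suc i) z + of_int r * E (Suc i) z"
proof -
  assume "i \<le> n"
  consider "i = n" | "i < n" using \<open>i \<le> n\<close> by linarith
  thus ?thesis
  proof cases
    case 1 thus ?thesis using deg by (simp add: E_def tail_gt)
  next
    case 2
    have "(\<Sum>l\<in>{Suc i..<n}. of_int r ^ (l - i) * tail f (Suc l) z) =
      (\<Sum>l\<in>{Suc i..<n}. of_int r * (of_int r ^ (l - Suc i) * tail f (Suc l) z))"
    proof (rule sum.cong[OF refl])
      fix l assume "l \<in> {Suc i..<n}"
      hence "l - i = Suc (l - Suc i)" by auto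
      thus "of_int r ^ (l - i) * tail f (Suc l) z = of_int r * (of_int r ^ (l - Suc i) * tail f (Suc l) z)"
        by simp
    qed
    thus ?thesis using 2 by (simp add: E_def sum.atLeast_Suc_lessThan sum_distrib_left)
  qed
qed

lemma lat_E: "lat (E i)"
  unfolding E_def using lat_scale[OF lat_tail, of "r ^ (_ - i)"] by (intro lat_sum) simp

text \<open>The value of \<open>poly_shift i f\<close> at \<open>r\<close> minus the one at
  \<open>z\<close> is \<open>(r - z) * E i z\<close>, and \<open>(r - z) * w z = f(r) / m\<close> at
  a root.\<close>

lemma w_tail:
  assumes z: "z \<in> croots f"
  shows "w z * tail f i z = of_int (poly (poly_shift i f) r) * w z - of_int (poly f r div m) * E i z"
proof -
  have md: "(of_int (poly f r) :: complex) / of_int m = of_int (poly f r div m)"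
  proof -
    obtain k where "poly f r = m * k" using div2 by (metis dvdE dvd_mult_left power2_eq_square)
    thus ?thesis using m_pos by simp
  qed
  show ?thesis
  proof (induction i rule: tail_down_induct)
    case (1 i)
    have "poly_shift i f = 0" using 1 deg by (intro poly_eqI) (simp add: coeff_poly_shift coeff_eq_0)
    thus ?case using 1 deg by (simp add: tail_gt E_def)
  next
    case (2 i)
    have "w z * tail f i z = of_int (coeff f i) * w z + (z * w z) * tail f (Suc i) z"
      by (subst tail_rec) (simp add: algebra_simps)
    also have "\<dots> = of_int (coeff f i) * w z + of_int r * (w z * tail f (Suc i) z)
        - of_int (poly f r div m) * tail f (Suc i) z"
      unfolding w_root[OF z] md by (simp add: algebra_simps)
    also have "\<dots> = of_int (poly (poly_shift i f) r) * w z - of_int (poly f r div m) * E i z"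
      unfolding 2(2) by (subst poly_shift_Suc_rec) (simp add: E_rec[OF 2(1)] algebra_simps)
    finally show ?case .
  qed
qed

lemma lat_w_tail: "lat (\<lambda>z. w z * tail f i z)"
  by (subst lat_cong[OF w_tail]) (auto intro!: lat_diff lat_scale lat_w lat_E)

text \<open>Here both divisibility conditions are used in full. Expanding one factor of
  \<open>m * w^2\<close> by \<open>m_w\<close> gives \<open>f'(r) * w\<close> minus
  \<open>f(r) / m\<close> times an integral combination of tails; division by \<open>m\<close> needs
  \<open>m\<close> to divide \<open>f'(r)\<close> and \<open>m^2\<close> to divide
  \<open>f(r)\<close>.\<close>

lemma lat_w_w: "lat (\<lambda>z. w z * w z)"
proof -
  obtain k1 where k1: "poly (pderiv f) r = m * k1" using div1 by (elim dvdE)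
  obtain k2 where k2: "poly f r = m * m * k2" using div2 unfolding power2_eq_square by (elim dvdE)
  have dv: "poly f r div m = m * k2" using m_pos k2 by simp
  have der: "(\<Sum>j<n. poly (poly_shift (Suc j) f) r * r ^ j) = poly (pderiv f) r"
  proof -
    have "(\<Sum>j<n. poly (poly_shift (Suc j) f) r * r ^ j) = poly (synthetic_div f r) r"
      unfolding poly_altdef degree_synthetic_div coeff_synthetic_div deg
      by (rule sum.cong) (use n_pos in auto)
    thus ?thesis by (simp add: poly_synthetic_div_self)
  qed
  have "w z * w z = of_int k1 * w z - of_int k2 * (\<Sum>j<n. of_int (r ^ j) * E (Suc j) z)"
    if z: "z \<in> croots f" for z
  proof -
    have "of_int m * (w z * w z) = (\<Sum>j<n. tail f (Suc j) z * of_int r ^ j) * w z"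
      unfolding m_w[symmetric] by simp
    also have "\<dots> = (\<Sum>j<n. of_int r ^ j * (w z * tail f (Suc j) z))"
      unfolding sum_distrib_right by (rule sum.cong) simp_all
    also have "\<dots> = (\<Sum>j<n. of_int (poly (poly_shift (Suc j) f) r * r ^ j) * w z
        - of_int m * of_int k2 * (of_int (r ^ j) * E (Suc j) z))"
      unfolding w_tail[OF z] dv by (rule sum.cong) (simp_all add: algebra_simps)
    also have "\<dots> = of_int (\<Sum>j<n. poly (poly_shift (Suc j) f) r * r ^ j) * w z
        - of_int m * of_int k2 * (\<Sum>j<n. of_int (r ^ j) * E (Suc j) z)"
      by (simp add: sum_subtractf sum_distrib_left sum_distrib_right)
    finally have "of_int m * (w z * w z) = of_int m * (of_int k1 * w z - of_int k2 * (\<Sum>j<n. of_int (r ^ j) * E (Suc j) z))"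
      unfolding der k1 by (simp add: algebra_simps)
    thus ?thesis using m_pos by simp
  qed
  thus ?thesis
    by (subst lat_cong) (auto intro!: lat_diff lat_scale lat_w lat_sum lat_E simp del: of_int_power)
qed

lemma lat_bas_mult: "lat (\<lambda>z. bas i z * bas j z)"
proof -
  have cases: "bas i = w \<or> (\<exists>k. bas i = tail f k) \<or> bas i = (\<lambda>_. 1)" for i
    by (cases "i = 0"; cases "i < n - 1") (auto simp: bas_def fun_eq_iff)
  show ?thesis
    using cases[of i] cases[of j]
    by (elim disjE exE)
      (simp_all add: lat_w lat_1 lat_tail lat_tail_tail lat_w_tail lat_w_w
        lat_w_tail[unfolded mult.commute[of "w _"]])
qed

lemma lat_mult:
  assumes "lat u" "lat v" shows "lat (\<lambda>z. u z * v z)"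
proof -
  obtain c :: "nat \<Rightarrow> int" where c: "\<forall>z\<in>croots f. u z = (\<Sum>j<n. of_int (c j) * bas j z)"
    using assms(1) unfolding lat_def by blast
  obtain d :: "nat \<Rightarrow> int" where d: "\<forall>z\<in>croots f. v z = (\<Sum>j<n. of_int (d j) * bas j z)"
    using assms(2) unfolding lat_def by blast
  have eq: "u z * v z = (\<Sum>i<n. \<Sum>j<n. of_int (c i * d j) * (bas i z * bas j z))" if "z \<in> croots f" for z
    using c d that by (simp add: sum_product algebra_simps)
  show ?thesis
    by (subst lat_cong[OF eq]) (auto intro!: lat_sum lat_scale lat_bas_mult simp del: of_int_mult)
qed

text \<open>Elements are functions on the roots of \<open>f\<close>, so that all embeddings into the complex
  numbers are evaluations.\<close>

definition wring :: "(complex \<Rightarrow> complex) ring" where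
  "wring = \<lparr>carrier = {u. lat u \<and> (\<forall>z. z \<notin> croots f \<longrightarrow> u z = 0)},
     monoid.mult = (\<lambda>u v z. u z * v z), one = (\<lambda>z. if z \<in> croots f then 1 else 0),
     zero = (\<lambda>_. 0), add = (\<lambda>u v z. u z + v z)\<rparr>"

lemma wring_simps [simp]:
  "u \<in> carrier wring \<longleftrightarrow> lat u \<and> (\<forall>z. z \<notin> croots f \<longrightarrow> u z = 0)"
  "u \<otimes>\<^bsub>wring\<^esub> v = (\<lambda>z. u z * v z)" "\<one>\<^bsub>wring\<^esub> = (\<lambda>z. if z \<in> croots f then 1 else 0)"
  "\<zero>\<^bsub>wring\<^esub> = (\<lambda>_. 0)" "u \<oplus>\<^bsub>wring\<^esub> v = (\<lambda>z. u z + v z)"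
  by (simp_all add: wring_def)

lemma cring_wring: "cring wring"
proof (rule cringI)
  show "abelian_group wring"
  proof (rule abelian_groupI)
    fix u assume u: "u \<in> carrier wring"
    show "\<exists>v\<in>carrier wring. v \<oplus>\<^bsub>wring\<^esub> u = \<zero>\<^bsub>wring\<^esub>"
      by (rule bexI[of _ "\<lambda>z. - u z"]) (use u lat_minus in auto)
  qed (auto simp: fun_eq_iff algebra_simps lat_add lat_0)
  have "lat (\<lambda>z. if z \<in> croots f then 1 else 0)"
    using lat_1 by (subst lat_cong[of _ "\<lambda>_. 1"]) auto
  thus "comm_monoid wring"
    by (intro comm_monoidI) (auto simp: fun_eq_iff lat_mult)
qed (auto simp: fun_eq_iff algebra_simps)

end

section \<open>Transport along isomorphisms, size of the discriminant, and integrality\<close>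

lemma evaluated_ring_iso:
  assumes "evaluated_ring R n \<sigma> e" and h: "h \<in> ring_iso R N" and N: "cring N"
  shows "evaluated_ring N n (\<lambda>k a. \<sigma> k (inv_into (carrier R) h a)) (\<lambda>i. h (e i))"
proof -
  interpret R: evaluated_ring R n \<sigma> e by fact
  interpret N: cring N by fact
  let ?g = "inv_into (carrier R) h"
  have g: "?g \<in> ring_iso N R" by (rule ring_iso_set_sym[OF R.ring_axioms h])
  have bij: "bij_betw h (carrier R) (carrier N)" using h by (simp add: ring_iso_def)
  have gh: "?g (h a) = a" if "a \<in> carrier R" for a
    using bij_betw_inv_into_left[OF bij that] .
  have ghe: "mat n n (\<lambda>(i, k). \<sigma> k (?g (h (e i)))) = R.evmat e"
    by (rule eq_matI) (simp_all add: gh R.e_closed)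
  show ?thesis
  proof (unfold_locales)
    fix k a b assume "k < n" and ab: "a \<in> carrier N" "b \<in> carrier N"
    thus "\<sigma> k (?g (a \<oplus>\<^bsub>N\<^esub> b)) = \<sigma> k (?g a) + \<sigma> k (?g b)"
      "\<sigma> k (?g (a \<otimes>\<^bsub>N\<^esub> b)) = \<sigma> k (?g a) * \<sigma> k (?g b)"
      using ring_iso_memE[OF g] R.eval_add R.eval_mult by simp_all
  next
    fix a b assume ab: "a \<in> carrier N" "b \<in> carrier N" and eq: "\<And>k. k < n \<Longrightarrow> \<sigma> k (?g a) = \<sigma> k (?g b)"
    have "?g a = ?g b" by (rule R.eval_inj[OF _ _ eq]) (use ring_iso_memE(1)[OF g] ab in auto)
    thus "a = b" using ab bij by (metis bij_betw_inv_into_right)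
  next
    fix i assume "i < n" thus "h (e i) \<in> carrier N" using ring_iso_memE(1)[OF h] R.e_closed by simp
  next
    fix a assume "a \<in> carrier N"
    hence "?g a \<in> carrier R" using ring_iso_memE(1)[OF g] by simp
    from R.e_span[OF this] show "\<exists>c. \<forall>k<n. \<sigma> k (?g a) = (\<Sum>i<n. complex_of_int (c i) * \<sigma> k (?g (h (e i))))"
      using gh R.e_closed by simp
  next
    show "det (mat n n (\<lambda>(i, k). \<sigma> k (?g (h (e i))))) \<noteq> 0" unfolding ghe by (rule R.det_nz)
  qed
qed

text \<open>The bound may depend on the row: the row of the basis element 1 contributes no factor of
  the size of the coefficients, which gives the exponent \<open>n - 1\<close> in
  \<open>nat_copy\<close>.\<close>

lemma norm_det_le:
  fixes A :: "complex mat"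
  assumes A: "A \<in> carrier_mat n n" and le: "\<And>i j. i < n \<Longrightarrow> j < n \<Longrightarrow> norm (A $$ (i, j)) \<le> b i"
  shows "norm (det A) \<le> fact n * (\<Prod>i<n. b i)"
proof -
  have "norm (det A) \<le> (\<Sum>p\<in>{p. p permutes {0..<n}}. norm (signof p * (\<Prod>i = 0..<n. A $$ (i, p i))))"
    unfolding det_def'[OF A] by (rule norm_sum)
  also have "\<dots> \<le> (\<Sum>p\<in>{p. p permutes {0..<n}}. (\<Prod>i<n. b i))"
  proof (rule sum_mono)
    fix p assume "p \<in> {p. p permutes {0..<n}}"
    hence p: "\<And>i. i < n \<Longrightarrow> p i < n" using permutes_in_image[of p "{0..<n}"] by auto
    have s: "norm (signof p :: complex) = 1" by (simp add: sign_def)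
    have "norm (\<Prod>i = 0..<n. A $$ (i, p i)) \<le> (\<Prod>i<n. b i)"
      unfolding prod_norm[symmetric] lessThan_atLeast0
      by (rule prod_mono) (use le p in auto)
    thus "norm (signof p * (\<Prod>i = 0..<n. A $$ (i, p i))) \<le> (\<Prod>i<n. b i)"
      unfolding norm_mult s by simp
  qed
  also have "\<dots> = fact n * (\<Prod>i<n. b i)" by (simp add: card_permutations)
  finally show ?thesis .
qed

context double_root
begin

text \<open>The only denominator in the basis is that of \<open>w\<close>. With the independence of
  powers of a root, this shows that an element vanishing at one root is zero.\<close>

lemma lat_poly:
  assumes "lat u"
  shows "\<exists>p. degree p < n \<and> (\<forall>z\<in>croots f. of_int m * u z = ev p z)"
proof -
  have dsh: "degree (poly_shift (Suc j) f) < n" for j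
    by (rule le_less_trans[OF degree_le[of "n - 1"]]) (use n_pos deg in \<open>auto simp: coeff_poly_shift coeff_eq_0\<close>)
  have b: "\<exists>p. degree p < n \<and> (\<forall>z. of_int m * bas j z = ev p z)" for j
  proof -
    consider "j = 0" | "j \<noteq> 0" "j < n - 1" | "j \<noteq> 0" "\<not> j < n - 1" by blast
    thus ?thesis
    proof cases
      case 1
      let ?p = "\<Sum>j<n. smult (r ^ j) (poly_shift (Suc j) f)"
      have "degree ?p \<le> n - 1"
      proof (rule degree_sum_le)
        fix j show "degree (smult (r ^ j) (poly_shift (Suc j) f)) \<le> n - 1"
          using dsh[of j] degree_smult_le[of "r ^ j" "poly_shift (Suc j) f"] by linarith
      qed simp
      moreover have "of_int m * bas j z = ev ?p z" for z
        using 1 m_w[of z] by (simp add: bas_def tail_def hom_distribs poly_sum mult.commute)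
      ultimately show ?thesis using n_pos by (intro exI[of _ ?p]) auto
    next
      case 2
      thus ?thesis
        by (intro exI[of _ "smult m (poly_shift (Suc j) f)"])
          (auto simp: bas_def tail_def hom_distribs dsh)
    next
      case 3
      thus ?thesis using n_pos by (intro exI[of _ "[:m:]"]) (auto simp: bas_def)
    qed
  qed
  then obtain P where P: "\<And>j. degree (P j) < n" "\<And>j z. of_int m * bas j z = ev (P j) z" by metis
  obtain c :: "nat \<Rightarrow> int" where c: "\<forall>z\<in>croots f. u z = (\<Sum>j<n. of_int (c j) * bas j z)"
    using assms unfolding lat_def by blast
  let ?p = "\<Sum>j<n. smult (c j) (P j)"
  have "degree ?p \<le> n - 1"
  proof (rule degree_sum_le)
    fix j show "degree (smult (c j) (P j)) \<le> n - 1"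
      using P(1)[of j] degree_smult_le[of "c j" "P j"] by linarith
  qed simp
  moreover have "of_int m * u z = ev ?p z" if "z \<in> croots f" for z
    using c that by (simp add: hom_distribs poly_sum P(2)[symmetric] sum_distrib_left algebra_simps)
  ultimately show ?thesis using n_pos by (intro exI[of _ ?p]) auto
qed

definition rfbas :: "nat \<Rightarrow> complex \<Rightarrow> complex" where
  "rfbas i z = (if i < n - 1 then tail f (Suc i) z else 1)"

text \<open>Row 0 is \<open>m_w\<close> solved for \<open>tail f 1\<close>. The sum in
  \<open>m_w\<close> ends with \<open>tail f n\<close>, which is the constant leading coefficient;
  this explains the last column. The determinant \<open>m\<close> is the index of the ring of
  \<open>f\<close> in the overring.\<close>

definition trans_mat :: "int mat" where
  "trans_mat = mat n n (\<lambda>(i, j). if i = 0 then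
     (if j = 0 then m else if j < n - 1 then - (r ^ j) else - (lead_coeff f * r ^ j)) else of_bool (i = j))"

lemma det_trans_mat: "det trans_mat = m"
proof -
  have "det trans_mat = (\<Prod>i = 0..<n. trans_mat $$ (i, i))"
    by (subst det_upper_triangular[of _ n])
      (auto simp: trans_mat_def prod_list_diag_prod)
  also have "\<dots> = m * (\<Prod>i = 1..<n. trans_mat $$ (i, i))"
    using n_pos by (subst prod.atLeast_Suc_lessThan) (auto simp: trans_mat_def)
  also have "(\<Prod>i = 1..<n. trans_mat $$ (i, i)) = 1"
    by (rule prod.neutral) (auto simp: trans_mat_def)
  finally show ?thesis by simp
qed

lemma rfbas_bas:
  assumes "i < n"
  shows "rfbas i z = (\<Sum>j<n. of_int (trans_mat $$ (i, j)) * bas j z)"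
proof (cases "i = 0")
  case False
  hence "(\<Sum>j<n. of_int (trans_mat $$ (i, j)) * bas j z) = bas i z"
    using assms by (simp add: trans_mat_def)
  thus ?thesis using False by (simp add: bas_def rfbas_def)
next
  case True
  have tm: "of_int (trans_mat $$ (0, j)) * bas j z = - (of_int r ^ j * tail f (Suc j) z)"
    if "j \<in> {1..<n}" for j
  proof (cases "j < n - 1")
    case False
    hence "Suc j = n" using that by auto
    thus ?thesis using that tail_degree[of f z] deg by (simp add: trans_mat_def bas_def)
  qed (use that in \<open>simp add: trans_mat_def bas_def\<close>)
  have "(\<Sum>j<n. of_int (trans_mat $$ (0, j)) * bas j z)
    = of_int m * w z + (\<Sum>j\<in>{1..<n}. of_int (trans_mat $$ (0, j)) * bas j z)"
    using n_pos by (simp add: lessThan_atLeast0 sum.atLeast_Suc_lessThan trans_mat_def bas_def)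
  also have "\<dots> = of_int m * w z - (\<Sum>j\<in>{1..<n}. of_int r ^ j * tail f (Suc j) z)"
    using tm by (simp add: sum_negf)
  also have "of_int m * w z = tail f 1 z + (\<Sum>j\<in>{1..<n}. of_int r ^ j * tail f (Suc j) z)"
    unfolding m_w using n_pos by (simp add: lessThan_atLeast0 sum.atLeast_Suc_lessThan mult.commute)
  finally show ?thesis using True n_pos by (simp add: rfbas_def)
qed

context
  fixes zs :: "nat \<Rightarrow> complex"
  assumes zs: "bij_betw zs {..<n} (croots f)"
begin

definition rfmat :: "complex mat" where "rfmat = mat n n (\<lambda>(i, k). rfbas i (zs k))"
definition basmat :: "complex mat" where "basmat = mat n n (\<lambda>(i, k). bas i (zs k))"

lemma sum_zs: "(\<Sum>k<n. g (zs k)) = (\<Sum>z\<in>croots f. g z)"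
  using sum.reindex_bij_betw[OF zs, of g] by simp

lemma det_rfmat_eq: "det rfmat = of_int m * det basmat"
proof -
  have "rfmat = map_mat of_int trans_mat * basmat"
    by (rule eq_matI)
      (auto simp: rfmat_def basmat_def rfbas_bas scalar_prod_def lessThan_atLeast0 trans_mat_def)
  hence "det rfmat = det (map_mat of_int trans_mat) * det basmat"
    by (simp add: det_mult[of _ n] trans_mat_def basmat_def)
  thus ?thesis by (simp add: det_trans_mat)
qed

text \<open>\<open>B\<close> is Euler's dual basis at the roots. The product with
  \<open>rfmat\<close> is the identity except for the row of 1: as \<open>tail f n\<close> is the
  leading coefficient, that row acquires its inverse.\<close>

lemma det_rfmat_nz: "det rfmat \<noteq> 0"
proof -
  define B where "B = mat n n (\<lambda>(k, j). zs k ^ j / ev (pderiv f) (zs k))"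
  define D :: "complex mat" where
    "D = mat n n (\<lambda>(i, j). if i = j then (if i < n - 1 then 1 else 1 / of_int (lead_coeff f)) else 0)"
  have "rfmat * B = D"
  proof (rule eq_matI)
    fix i j assume "i < dim_row D" "j < dim_col D"
    hence ij: "i < n" "j < n" by (auto simp: D_def)
    have "(rfmat * B) $$ (i, j) = (\<Sum>k<n. rfbas i (zs k) * (zs k ^ j / ev (pderiv f) (zs k)))"
      using ij by (simp add: rfmat_def B_def scalar_prod_def lessThan_atLeast0)
    also have "\<dots> = (\<Sum>z\<in>croots f. rfbas i z * (z ^ j / ev (pderiv f) z))" by (rule sum_zs)
    also have "\<dots> = D $$ (i, j)"
    proof (cases "i < n - 1")
      case True
      thus ?thesis using euler_sum[OF ij] ij by (simp add: rfbas_def D_def mult.commute)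
    next
      case False
      hence i: "Suc i = n" using ij by simp
      have "(\<Sum>z\<in>croots f. z ^ j / ev (pderiv f) z) * of_int (lead_coeff f) = (if i = j then 1 else 0)"
        using euler_sum[OF ij] tail_degree[of f] deg i by (simp add: sum_distrib_right)
      hence "(\<Sum>z\<in>croots f. z ^ j / ev (pderiv f) z) = (if i = j then 1 / of_int (lead_coeff f) else 0)"
        using lead_nz by (simp add: field_simps split: if_splits)
      thus ?thesis using False ij by (simp add: rfbas_def D_def)
    qed
    finally show "(rfmat * B) $$ (i, j) = D $$ (i, j)" .
  qed (auto simp: rfmat_def B_def D_def)
  moreover have "det D \<noteq> 0"
  proof -
    have "det D = (\<Prod>i = 0..<n. D $$ (i, i))"
      by (subst det_upper_triangular[of _ n]) (auto simp: D_def prod_list_diag_prod)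
    thus ?thesis using lead_nz by (simp add: D_def)
  qed
  moreover have "det (rfmat * B) = det rfmat * det B"
    by (rule det_mult[of _ n]) (auto simp: rfmat_def B_def)
  ultimately show ?thesis by auto
qed

lemma evaluated_wring:
  "evaluated_ring wring n (\<lambda>k u. u (zs k)) (\<lambda>i z. if z \<in> croots f then bas i z else 0)"
proof -
  interpret cring wring by (rule cring_wring)
  have zk: "k < n \<Longrightarrow> zs k \<in> croots f" for k using zs by (auto simp: bij_betw_def)
  have img: "\<exists>k<n. z = zs k" if "z \<in> croots f" for z
    using zs that unfolding bij_betw_def by (auto simp: image_iff)
  have mt: "mat n n (\<lambda>(i, k). if zs k \<in> croots f then bas i (zs k) else 0) = basmat"
    unfolding basmat_def by (rule eq_matI) (auto simp: zk)
  show ?thesis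
  proof unfold_locales
    fix u v assume "u \<in> carrier wring" "v \<in> carrier wring" "\<And>k. k < n \<Longrightarrow> u (zs k) = v (zs k)"
    thus "u = v" using img by (intro ext) (metis wring_simps(1))
  next
    fix i assume "i < n"
    thus "(\<lambda>z. if z \<in> croots f then bas i z else 0) \<in> carrier wring"
      using lat_bas[of i] by (subst wring_simps, subst lat_cong[of _ "bas i"]) auto
  next
    fix u assume "u \<in> carrier wring"
    then obtain c :: "nat \<Rightarrow> int" where "\<forall>z\<in>croots f. u z = (\<Sum>j<n. of_int (c j) * bas j z)"
      unfolding wring_simps lat_def by blast
    thus "\<exists>c. \<forall>k<n. u (zs k) = (\<Sum>i<n. complex_of_int (c i) * (if zs k \<in> croots f then bas i (zs k) else 0))"
      using zk by (intro exI[of _ c]) simp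
  next
    show "det (mat n n (\<lambda>(i, k). if zs k \<in> croots f then bas i (zs k) else 0)) \<noteq> 0"
      unfolding mt using det_rfmat_nz det_rfmat_eq by auto
  qed auto
qed

end

lemma countable_wring: "countable (carrier wring)"
proof -
  have "carrier wring \<subseteq> range (\<lambda>l z. if z \<in> croots f then \<Sum>j<n. of_int (l ! j :: int) * bas j z else 0)"
  proof
    fix u assume u: "u \<in> carrier wring"
    then obtain c :: "nat \<Rightarrow> int" where c: "\<forall>z\<in>croots f. u z = (\<Sum>j<n. of_int (c j) * bas j z)"
      unfolding wring_simps lat_def by blast
    show "u \<in> range (\<lambda>l z. if z \<in> croots f then \<Sum>j<n. of_int (l ! j :: int) * bas j z else 0)"
      by (rule image_eqI[of _ _ "map c [0..<n]"]) (use u c in auto)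
  qed
  thus ?thesis by (rule countable_subset) simp
qed

end

locale double_root_domain = double_root +
  assumes irred: "degree p < n \<Longrightarrow> z \<in> croots f \<Longrightarrow> ev p z = 0 \<Longrightarrow> p = 0"
begin

lemma wring_zero_at_root:
  assumes "u \<in> carrier wring" "z \<in> croots f" "u z = 0"
  shows "u = (\<lambda>_. 0)"
proof -
  obtain p where p: "degree p < n" "\<forall>z\<in>croots f. of_int m * u z = ev p z"
    using lat_poly[of u] assms(1) unfolding wring_simps by blast
  have "p = 0" by (rule irred[OF p(1) assms(2)]) (use p(2) assms in auto)
  hence "\<forall>z\<in>croots f. u z = 0" using p(2) m_pos by simp
  thus ?thesis using assms(1) by (auto simp: fun_eq_iff)
qed

lemma domain_wring: "domain wring"
proof -
  interpret cring wring by (rule cring_wring)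
  have "croots f \<noteq> {}" using card_roots n_pos by auto
  then obtain z where z: "z \<in> croots f" by blast
  show ?thesis
  proof (rule domain.intro[OF cring_wring], unfold_locales)
    show "\<one>\<^bsub>wring\<^esub> \<noteq> \<zero>\<^bsub>wring\<^esub>" using z by (auto simp: fun_eq_iff)
    fix u v assume uv: "u \<otimes>\<^bsub>wring\<^esub> v = \<zero>\<^bsub>wring\<^esub>" "u \<in> carrier wring" "v \<in> carrier wring"
    have "u z * v z = 0" using fun_cong[OF uv(1), of z] by simp
    thus "u = \<zero>\<^bsub>wring\<^esub> \<or> v = \<zero>\<^bsub>wring\<^esub>"
      using wring_zero_at_root[OF uv(2) z] wring_zero_at_root[OF uv(3) z] by auto
  qed
qed

text \<open>The count concerns rings whose elements are natural numbers, so the countable ring of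
  functions is copied. Passing to the overring of index \<open>m\<close> divides the determinant of
  the basis by \<open>m\<close>, hence the discriminant by \<open>m^2\<close>.\<close>

theorem nat_copy:
  assumes B: "\<And>j z. z \<in> croots f \<Longrightarrow> j > 0 \<Longrightarrow> norm (tail f j z) \<le> B"
  shows "\<exists>N :: nat ring. domain N \<and> ring_of_rank n N \<and> wring \<simeq> N \<and>
    \<bar>real_of_int (ring_discriminant n N)\<bar> \<le> (fact n * B ^ (n - 1) / of_int m)\<^sup>2"
proof -
  let ?h = "to_nat_on (carrier wring)"
  let ?N = "image_ring ?h wring"
  have inj: "inj_on ?h (carrier wring)" by (rule inj_on_to_nat_on[OF countable_wring])
  have h: "?h \<in> ring_iso wring ?N" by (rule inj_imp_image_ring_iso[OF inj])
  interpret W: domain wring by (rule domain_wring)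
  have dom: "domain ?N" by (rule W.inj_imp_image_ring_is_domain[OF inj])
  obtain zs where "bij_betw zs {0..<card (croots f)} (croots f)"
    using ex_bij_betw_nat_finite[OF finite_roots] by blast
  hence zs: "bij_betw zs {..<n} (croots f)" by (simp add: card_roots lessThan_atLeast0)
  have zk: "k < n \<Longrightarrow> zs k \<in> croots f" for k using zs by (auto simp: bij_betw_def)
  let ?e = "\<lambda>i z. if z \<in> croots f then bas i z else 0"
  note eW = evaluated_wring[OF zs]
  interpret N: evaluated_ring ?N n "\<lambda>k a. inv_into (carrier wring) ?h a (zs k)" "\<lambda>i. ?h (?e i)"
    by (rule evaluated_ring_iso[OF eW h domain.axioms(1)[OF dom]])
  have "N.evmat (\<lambda>i. ?h (?e i)) = basmat zs"
    unfolding basmat_def[OF zs]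
    by (rule eq_matI) (use evaluated_ring.e_closed[OF eW] inj zk in \<open>simp_all add: inv_into_f_f\<close>)
  hence "(of_int (ring_discriminant n ?N) :: complex) = (det (basmat zs))\<^sup>2"
    using N.discriminant_eq by simp
  hence "norm (of_int (ring_discriminant n ?N) :: complex) = (norm (det (basmat zs)))\<^sup>2"
    by (simp add: norm_power)
  also have "norm (det (basmat zs)) = norm (det (rfmat zs)) / of_int m"
    using det_rfmat_eq[OF zs] m_pos by (simp add: norm_mult)
  finally have eq: "\<bar>real_of_int (ring_discriminant n ?N)\<bar> = (norm (det (rfmat zs)) / of_int m)\<^sup>2"
    by simp
  have "norm (det (rfmat zs)) \<le> fact n * (\<Prod>i<n. if i < n - 1 then B else 1)"
    by (rule norm_det_le) (auto simp: rfmat_def[OF zs] rfbas_def intro: B zk)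
  also have "(\<Prod>i<n. if i < n - 1 then B else 1) = B ^ (n - 1)"
  proof -
    have "{..<n} = insert (n - 1) {..<n - 1}" using n_pos by auto
    thus ?thesis by simp
  qed
  finally have "(norm (det (rfmat zs)) / of_int m)\<^sup>2 \<le> (fact n * B ^ (n - 1) / of_int m)\<^sup>2"
    using m_pos by (intro power_mono divide_right_mono) auto
  thus ?thesis using eq dom N.has_rank h unfolding is_ring_iso_def by (intro exI[of _ ?N]) auto
qed

end

section \<open>Homomorphisms to the complex numbers and Euler's pairing\<close>

context double_root
begin

lemma lat_const: "lat (\<lambda>_. of_int k)"
  using lat_scale[OF lat_1, of k] by simp

lemma lat_lead_root: "lat (\<lambda>z. of_int (lead_coeff f) * z)"
proof -
  have "of_int (lead_coeff f) * z = tail f (n - 1) z - of_int (coeff f (n - 1))" for z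
    using tail_rec[of f "n - 1" z] tail_degree[of f z] deg n_pos by simp
  thus ?thesis using lat_diff[OF lat_tail lat_const] by simp
qed

definition res :: "(complex \<Rightarrow> complex) \<Rightarrow> complex \<Rightarrow> complex" where
  "res u z = (if z \<in> croots f then u z else 0)"

lemma res_closed: "lat u \<Longrightarrow> res u \<in> carrier wring"
  using lat_cong[of "res u" u] by (simp add: res_def)

lemma res_carrier: "u \<in> carrier wring \<Longrightarrow> res u = u"
  by (auto simp: res_def fun_eq_iff)

context
  fixes \<psi> :: "(complex \<Rightarrow> complex) \<Rightarrow> complex"
  assumes \<psi>_add: "u \<in> carrier wring \<Longrightarrow> v \<in> carrier wring \<Longrightarrow> \<psi> (u \<oplus>\<^bsub>wring\<^esub> v) = \<psi> u + \<psi> v"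
    and \<psi>_mult: "u \<in> carrier wring \<Longrightarrow> v \<in> carrier wring \<Longrightarrow> \<psi> (u \<otimes>\<^bsub>wring\<^esub> v) = \<psi> u * \<psi> v"
    and \<psi>_one: "\<psi> \<one>\<^bsub>wring\<^esub> = 1"
begin

lemma psi_cong: "(\<And>z. z \<in> croots f \<Longrightarrow> u z = v z) \<Longrightarrow> \<psi> (res u) = \<psi> (res v)"
  by (rule arg_cong[of _ _ \<psi>]) (auto simp: res_def fun_eq_iff)

lemma psi_add: "lat u \<Longrightarrow> lat v \<Longrightarrow> \<psi> (res (\<lambda>z. u z + v z)) = \<psi> (res u) + \<psi> (res v)"
  using \<psi>_add[OF res_closed res_closed, of u v] by (simp add: res_def[abs_def] if_distrib cong: if_cong)

lemma psi_mult: "lat u \<Longrightarrow> lat v \<Longrightarrow> \<psi> (res (\<lambda>z. u z * v z)) = \<psi> (res u) * \<psi> (res v)"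
  using \<psi>_mult[OF res_closed res_closed, of u v] by (simp add: res_def[abs_def] if_distrib cong: if_cong)

lemma psi_zero: "\<psi> (res (\<lambda>_. 0)) = 0"
  using psi_add[OF lat_0 lat_0] by simp

lemma psi_one: "\<psi> (res (\<lambda>_. 1)) = 1"
  using \<psi>_one by (simp add: res_def[abs_def])

lemma psi_scale: assumes "lat u" shows "\<psi> (res (\<lambda>z. of_int k * u z)) = of_int k * \<psi> (res u)"
proof (induction k rule: int_induct[of _ 0])
  case base show ?case using psi_zero by simp
next
  case (step1 k)
  have "\<psi> (res (\<lambda>z. of_int k * u z + u z)) = \<psi> (res (\<lambda>z. of_int k * u z)) + \<psi> (res u)"
    by (rule psi_add[OF lat_scale[OF assms] assms])
  thus ?case using step1 by (simp add: algebra_simps)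
next
  case (step2 k)
  have "\<psi> (res (\<lambda>z. of_int (k - 1) * u z + u z)) = \<psi> (res (\<lambda>z. of_int (k - 1) * u z)) + \<psi> (res u)"
    by (rule psi_add[OF lat_scale[OF assms] assms])
  thus ?case using step2 by (simp add: algebra_simps)
qed

lemma psi_sum:
  assumes "\<And>j. lat (u j)"
  shows "\<psi> (res (\<lambda>z. \<Sum>j<(N::nat). of_int (c j) * u j z)) = (\<Sum>j<N. of_int (c j) * \<psi> (res (u j)))"
proof (induction N)
  case 0 show ?case using psi_zero by simp
next
  case (Suc N)
  have "lat (\<lambda>z. \<Sum>j<N. of_int (c j) * u j z)" by (intro lat_sum lat_scale assms)
  from psi_add[OF this lat_scale[OF assms, of "c N" N]] Suc psi_scale[OF assms, of "c N" N]
  show ?case by simp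
qed

text \<open>The root itself need not lie in the ring, but its multiple by the leading coefficient
  does, and \<open>\<alpha>\<close> is defined by the image of this multiple. The recursion of the
  tails, multiplied by the leading coefficient, gives the image of all tails downwards from index
  \<open>n\<close>. As \<open>tail f 0\<close> is \<open>f\<close>, which is zero in the ring,
  \<open>\<alpha>\<close> is a root; the image of \<open>w\<close> follows from
  \<open>m_w\<close>.\<close>

lemma hom_is_evaluation: "\<exists>\<alpha>\<in>croots f. \<forall>u\<in>carrier wring. \<psi> u = u \<alpha>"
proof -
  define a where "a = (of_int (lead_coeff f) :: complex)"
  have a: "a \<noteq> 0" using lead_nz by (simp add: a_def)
  define \<alpha> where "\<alpha> = \<psi> (res (\<lambda>z. a * z)) / a"
  have \<alpha>: "\<psi> (res (\<lambda>z. a * z)) = a * \<alpha>" using a by (simp add: \<alpha>_def)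
  have tl: "\<psi> (res (tail f j)) = tail f j \<alpha>" for j
  proof (induction j rule: tail_down_induct)
    case (1 j) thus ?case using psi_zero deg tail_gt[of f j] by (simp add: fun_eq_iff[symmetric] cong: psi_cong)
  next
    case (2 j)
    have "a * tail f j z = of_int (lead_coeff f * coeff f j) + (a * z) * tail f (Suc j) z" for z
      by (subst tail_rec) (simp add: a_def algebra_simps)
    hence "\<psi> (res (\<lambda>z. a * tail f j z)) =
      \<psi> (res (\<lambda>z. of_int (lead_coeff f * coeff f j) * 1 + (a * z) * tail f (Suc j) z))"
      by (intro psi_cong) simp
    also have "\<dots> = \<psi> (res (\<lambda>z. of_int (lead_coeff f * coeff f j) * 1)) + \<psi> (res (\<lambda>z. (a * z) * tail f (Suc j) z))"
      unfolding a_def by (intro psi_add lat_mult lat_lead_root lat_tail lat_scale[OF lat_1])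
    also have "\<psi> (res (\<lambda>z. (a * z) * tail f (Suc j) z)) = a * \<alpha> * tail f (Suc j) \<alpha>"
      using psi_mult[OF lat_lead_root lat_tail, of "Suc j"] \<alpha> 2(2) by (simp add: a_def)
    also have "\<psi> (res (\<lambda>z. of_int (lead_coeff f * coeff f j) * 1)) = a * of_int (coeff f j)"
      using psi_scale[OF lat_1, of "lead_coeff f * coeff f j"] psi_one by (simp add: a_def)
    also have "a * of_int (coeff f j) + a * \<alpha> * tail f (Suc j) \<alpha> = a * tail f j \<alpha>"
      by (subst (2) tail_rec) (simp add: algebra_simps)
    also have "\<psi> (res (\<lambda>z. a * tail f j z)) = a * \<psi> (res (tail f j))"
      using psi_scale[OF lat_tail, of "lead_coeff f" j] by (simp add: a_def)
    finally show ?case using a by simp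
  qed
  have "\<psi> (res (tail f 0)) = \<psi> (res (\<lambda>_. 0))" by (rule psi_cong) (simp add: tail_0)
  hence "tail f 0 \<alpha> = 0" using tl psi_zero by simp
  hence root: "\<alpha> \<in> croots f" by (simp add: tail_def croots_def)
  have "of_int m * \<psi> (res w) = \<psi> (res (\<lambda>z. \<Sum>j<n. of_int (r ^ j) * tail f (Suc j) z))"
    using psi_scale[OF lat_w, of m] m_w by (simp add: mult.commute)
  also have "\<dots> = of_int m * w \<alpha>"
    unfolding psi_sum[OF lat_tail] tl m_w by (simp add: mult.commute)
  finally have pw: "\<psi> (res w) = w \<alpha>" using m_pos by simp
  have pb: "\<psi> (res (bas j)) = bas j \<alpha>" for j
  proof -
    have "bas j = (if j = 0 then w else if j < n - 1 then tail f (Suc j) else (\<lambda>_. 1))"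
      by (auto simp: bas_def fun_eq_iff)
    thus ?thesis using pw tl psi_one by simp
  qed
  have lb: "lat (bas j)" for j 
  proof (cases "j < n")
    case False
    hence "bas j = (\<lambda>_. 1)" using n_pos by (auto simp: bas_def fun_eq_iff)
    thus ?thesis using lat_1 by simp
  qed (rule lat_bas)
  have "\<psi> u = u \<alpha>" if u: "u \<in> carrier wring" for u
  proof -
    obtain c :: "nat \<Rightarrow> int" where c: "\<forall>z\<in>croots f. u z = (\<Sum>j<n. of_int (c j) * bas j z)"
      using u unfolding wring_simps lat_def by blast
    have "\<psi> u = \<psi> (res (\<lambda>z. \<Sum>j<n. of_int (c j) * bas j z))"
      using c res_carrier[OF u] psi_cong[of u "\<lambda>z. \<Sum>j<n. of_int (c j) * bas j z"] by simp
    also have "\<dots> = (\<Sum>j<n. of_int (c j) * bas j \<alpha>)"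
      unfolding psi_sum[OF lb] pb ..
    finally show ?thesis using c root by simp
  qed
  thus ?thesis using root by blast
qed

end

lemma lat_separates:
  assumes "y \<in> croots f" "z \<in> croots f" "\<And>u. lat u \<Longrightarrow> u y = u z"
  shows "y = z"
  using assms(3)[OF lat_lead_root] lead_nz by simp

lemma m_lat:
  assumes "lat u"
  shows "\<exists>(c :: nat \<Rightarrow> int) (s :: int). \<forall>z\<in>croots f. of_int m * u z =
    (\<Sum>l<n - 1. of_int (c 0 * r ^ l + (if l = 0 then 0 else m * c l)) * tail f (Suc l) z) + of_int s"
proof -
  obtain c :: "nat \<Rightarrow> int" where c: "\<forall>z\<in>croots f. u z = (\<Sum>j<n. of_int (c j) * bas j z)"
    using assms unfolding lat_def by blast
  define t where "t l = c 0 * r ^ l + (if l = 0 then 0 else m * c l)" for l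
  define s where "s = c 0 * r ^ (n - 1) * lead_coeff f + m * c (n - 1)"
  have sn: "(\<Sum>j<n. h j) = (\<Sum>j<n - 1. h j) + h (n - 1)" for h :: "nat \<Rightarrow> complex"
    using n_pos by (cases n) auto
  have "of_int m * (\<Sum>j<n. of_int (c j) * bas j z) =
    (\<Sum>l<n - 1. of_int (t l) * tail f (Suc l) z) + of_int s" for z
  proof -
    have b: "of_int (c j) * bas j z = (if j = 0 then of_int (c 0) * w z else of_int (c j) * tail f (Suc j) z)"
      if "j < n - 1" for j
      using that by (simp add: bas_def)
    have "(\<Sum>j<n. of_int (c j) * bas j z) = (\<Sum>j<n - 1. of_int (c j) * bas j z) + of_int (c (n - 1)) * bas (n - 1) z"
      by (rule sn)
    also have "bas (n - 1) z = 1" using n_pos by (simp add: bas_def)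
    also have "(\<Sum>j<n - 1. of_int (c j) * bas j z) = of_int (c 0) * w z + (\<Sum>j<n - 1. if j = 0 then 0 else of_int (c j) * tail f (Suc j) z)"
    proof -
      have "{..<n - 1} = insert 0 {1..<n - 1}" using n_pos by auto
      moreover have "bas 0 z = w z" by (simp add: bas_def)
      ultimately show ?thesis using b by simp
    qed
    finally have 1: "of_int m * (\<Sum>j<n. of_int (c j) * bas j z) = of_int (c 0) * (of_int m * w z)
        + (\<Sum>j<n - 1. if j = 0 then 0 else of_int m * (of_int (c j) * tail f (Suc j) z)) + of_int (m * c (n - 1))"
      by (simp add: algebra_simps sum_distrib_left if_distrib[of "(*) _"] cong: if_cong)
    have 2: "of_int m * w z = (\<Sum>j<n - 1. tail f (Suc j) z * of_int r ^ j) + of_int (lead_coeff f) * of_int r ^ (n - 1)"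
      unfolding m_w sn using tail_degree[of f z] deg n_pos by simp
    show ?thesis unfolding 1 2
      by (simp add: t_def s_def algebra_simps sum_distrib_left sum.distrib[symmetric] if_distrib[of "(*) _"] cong: if_cong)
        (rule sum.cong, auto simp: algebra_simps)
  qed
  thus ?thesis using c unfolding t_def by (intro exI[of _ c] exI[of _ s]) simp
qed

text \<open>By Euler's formula the pairing reads off the coefficient of
  \<open>tail f (Suc j)\<close> in \<open>m * u\<close>, while the constant part pairs to 0 for
  \<open>j < n - 1\<close>. Modulo \<open>m\<close> the resulting vector is a multiple of
  \<open>(1, r, r^2, ...)\<close>, the trace that \<open>m\<close> and \<open>r\<close> leave in the
  lattice.\<close>

lemma pairing:
  assumes "lat u"
  shows "\<exists>c :: nat \<Rightarrow> int. \<forall>j<n - 1. (\<Sum>y\<in>croots f. y ^ j / ev (pderiv f) y * (of_int m * u y)) =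
    of_int (c 0 * r ^ j + (if j = 0 then 0 else m * c j))"
proof -
  obtain c :: "nat \<Rightarrow> int" and s :: int where t: "\<forall>z\<in>croots f. of_int m * u z =
    (\<Sum>l<n - 1. of_int (c 0 * r ^ l + (if l = 0 then 0 else m * c l)) * tail f (Suc l) z) + of_int s"
    using m_lat[OF assms] by blast
  define t where "t l = (of_int (c 0 * r ^ l + (if l = 0 then 0 else m * c l)) :: complex)" for l
  have "(\<Sum>y\<in>croots f. y ^ j / ev (pderiv f) y * (of_int m * u y)) = t j" if j: "j < n - 1" for j
  proof -
    have "(\<Sum>y\<in>croots f. y ^ j / ev (pderiv f) y * (of_int m * u y)) =
      (\<Sum>y\<in>croots f. (\<Sum>l<n - 1. t l * (y ^ j / ev (pderiv f) y * tail f (Suc l) y))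
        + of_int s * (y ^ j / ev (pderiv f) y))"
    proof (rule sum.cong[OF refl])
      fix y assume "y \<in> croots f"
      hence "of_int m * u y = (\<Sum>l<n - 1. t l * tail f (Suc l) y) + of_int s"
        using t unfolding t_def by blast
      thus "y ^ j / ev (pderiv f) y * (of_int m * u y) =
        (\<Sum>l<n - 1. t l * (y ^ j / ev (pderiv f) y * tail f (Suc l) y)) + of_int s * (y ^ j / ev (pderiv f) y)"
        by (simp add: algebra_simps sum_distrib_left)
    qed
    also have "\<dots> = (\<Sum>l<n - 1. t l * (\<Sum>y\<in>croots f. y ^ j / ev (pderiv f) y * tail f (Suc l) y))
        + of_int s * (\<Sum>y\<in>croots f. y ^ j / ev (pderiv f) y)"
      by (simp add: sum.distrib sum_distrib_left) (rule sum.swap)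
    also have "\<dots> = (\<Sum>l<n - 1. t l * (if l = j then 1 else 0))"
      using euler_sum_power[OF j] euler_sum j by simp
    also have "\<dots> = t j" using j by (simp add: if_distrib[of "(*) _"] cong: if_cong)
    finally show ?thesis .
  qed
  thus ?thesis unfolding t_def by (intro exI[of _ c]) blast
qed

lemma pairing_int:
  assumes "lat u" "j < n - 1"
  shows "(\<Sum>y\<in>croots f. y ^ j / ev (pderiv f) y * (of_int m * u y)) \<in> \<int>"
  using pairing[OF assms(1)] assms(2) by (metis Ints_of_int)

lemma pairing_w:
  assumes "j < n"
  shows "(\<Sum>y\<in>croots f. y ^ j / ev (pderiv f) y * (of_int m * w y)) = of_int (r ^ j)"
proof -
  have "(\<Sum>y\<in>croots f. y ^ j / ev (pderiv f) y * (of_int m * w y)) =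
    (\<Sum>y\<in>croots f. \<Sum>l<n. of_int (r ^ l) * (y ^ j / ev (pderiv f) y * tail f (Suc l) y))"
    unfolding m_w by (simp add: sum_distrib_left algebra_simps)
  also have "\<dots> = (\<Sum>l<n. of_int (r ^ l) * (\<Sum>y\<in>croots f. y ^ j / ev (pderiv f) y * tail f (Suc l) y))"
    by (subst sum.swap) (simp add: sum_distrib_left)
  also have "\<dots> = (\<Sum>l<n. of_int (r ^ l) * (if l = j then 1 else 0))"
    using euler_sum assms by simp
  also have "\<dots> = of_int (r ^ j)" using assms by (simp add: if_distrib[of "(*) _"] cong: if_cong)
  finally show ?thesis .
qed

end

text \<open>Each lattice contains the element \<open>w\<close> of the other. Pairing with
  \<open>j = 0\<close>, where the two elements have values \<open>1/m\<close> and
  \<open>1/m'\<close>, shows that \<open>m\<close> and \<open>m'\<close> divide each other; pairing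
  with \<open>j = 1\<close> then gives \<open>r'\<close> congruent to \<open>r\<close> modulo
  \<open>m\<close>. The bound \<open>n \<ge> 3\<close> admits \<open>j = 1\<close>.\<close>

lemma lat_determines_root:
  assumes "double_root n f m r" "double_root n f m' r'" "n \<ge> 3"
    and r: "0 \<le> r" "r < m" "0 \<le> r'" "r' < m'"
    and eq: "\<And>u. double_root.lat n f m r u \<longleftrightarrow> double_root.lat n f m' r' u"
  shows "m = m' \<and> r = r'"
proof -
  interpret F: double_root n f m r by fact
  interpret G: double_root n f m' r' by fact
  define L where "L j u = (\<Sum>y\<in>croots f. y ^ j / ev (pderiv f) y * u y)" for j and u :: "complex \<Rightarrow> complex"
  have sc: "(\<Sum>y\<in>croots f. y ^ j / ev (pderiv f) y * (k * u y)) = k * L j u" for j k u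
    unfolding L_def sum_distrib_left by (rule sum.cong) (simp_all add: algebra_simps)
  have Lw: "of_int m * L j F.w = of_int (r ^ j)" "of_int m' * L j G.w = of_int (r' ^ j)" if "j < n" for j
    using F.pairing_w[OF that] G.pairing_w[OF that] unfolding sc by simp_all
  obtain c :: "nat \<Rightarrow> int" where c: "\<And>j. j < n - 1 \<Longrightarrow> of_int m * L j G.w =
    of_int (c 0 * r ^ j + (if j = 0 then 0 else m * c j))"
    using F.pairing[of G.w] G.lat_w eq unfolding sc by blast
  obtain c' :: "nat \<Rightarrow> int" where c': "\<And>j. j < n - 1 \<Longrightarrow> of_int m' * L j F.w =
    of_int (c' 0 * r' ^ j + (if j = 0 then 0 else m' * c' j))"
    using G.pairing[of F.w] F.lat_w eq unfolding sc by blast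
  have L0: "of_int m * L 0 G.w = of_int (c 0)" "of_int m' * L 0 F.w = of_int (c' 0)"
    "of_int m' * L 0 G.w = 1" "of_int m * L 0 F.w = 1"
    using c[of 0] c'[of 0] Lw[of 0] assms(3) by simp_all
  have "(of_int (m' * c 0) :: complex) = of_int m * (of_int m' * L 0 G.w)"
    "(of_int (m * c' 0) :: complex) = of_int m' * (of_int m * L 0 F.w)"
    unfolding of_int_mult L0(1,2)[symmetric] by (simp_all only: ac_simps)
  hence "(of_int (m' * c 0) :: complex) = of_int m" "(of_int (m * c' 0) :: complex) = of_int m'"
    unfolding L0(3,4) by simp_all
  hence "m' * c 0 = m" "m * c' 0 = m'" by (simp_all only: of_int_eq_iff)
  hence mm: "m = m'" using F.m_pos G.m_pos by (metis dvd_triv_left zdvd_antisym_nonneg less_imp_le)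
  hence c0: "c 0 = 1" using \<open>m' * c 0 = m\<close> F.m_pos by simp
  have "(of_int r' :: complex) = of_int (r + m * c 1)"
    using c[of 1] Lw(2)[of 1] assms(3) c0 mm by simp
  hence "r' = r + m * c 1" by (simp only: of_int_eq_iff)
  hence "r' mod m = r mod m" by simp
  thus ?thesis using mm r by simp
qed

section \<open>Isomorphic rings\<close>

locale iso_pair = F: double_root n f m r + G: double_root n g m' r'
  for n f m r g m' r' +
  fixes \<tau> \<tau>' :: "complex \<Rightarrow> complex"
  assumes tau: "z \<in> croots g \<Longrightarrow> \<tau> z \<in> croots f" and tau': "y \<in> croots f \<Longrightarrow> \<tau>' y \<in> croots g"
    and tau'_tau: "z \<in> croots g \<Longrightarrow> \<tau>' (\<tau> z) = z" and tau_tau': "y \<in> croots f \<Longrightarrow> \<tau> (\<tau>' y) = y"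
    and lat_tau: "F.lat u \<Longrightarrow> G.lat (\<lambda>z. u (\<tau> z))" and lat_tau': "G.lat v \<Longrightarrow> F.lat (\<lambda>y. v (\<tau>' y))"

text \<open>An isomorphism followed by evaluation at a root \<open>z\<close> of \<open>g\<close> is
  a complex-valued homomorphism, hence evaluation at some root \<open>\<tau> z\<close> of
  \<open>f\<close>. The maps for the two directions are inverse to each other because the lattices
  separate roots.\<close>

lemma iso_pairI:
  assumes "double_root n f m r" "double_root n g m' r'"
    and "double_root.wring n f m r \<simeq> double_root.wring n g m' r'"
  shows "\<exists>\<tau> \<tau>'. iso_pair n f m r g m' r' \<tau> \<tau>'"
proof -
  interpret F: double_root n f m r by fact
  interpret G: double_root n g m' r' by fact
  interpret WF: cring F.wring by (rule F.cring_wring)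
  interpret WG: cring G.wring by (rule G.cring_wring)
  obtain h where h: "h \<in> ring_iso F.wring G.wring" using assms(3) unfolding is_ring_iso_def by blast
  define k where "k = inv_into (carrier F.wring) h"
  have k: "k \<in> ring_iso G.wring F.wring" unfolding k_def by (rule ring_iso_set_sym[OF WF.ring_axioms h])
  have bij: "bij_betw h (carrier F.wring) (carrier G.wring)" using h by (simp add: ring_iso_def)
  have kh: "k (h u) = u" if "u \<in> carrier F.wring" for u
    unfolding k_def using bij_betw_inv_into_left[OF bij that] .
  have hk: "h (k v) = v" if "v \<in> carrier G.wring" for v
    unfolding k_def using bij_betw_inv_into_right[OF bij that] .
  have "\<exists>y\<in>croots f. \<forall>u\<in>carrier F.wring. h u z = u y" if z: "z \<in> croots g" for z
    by (rule F.hom_is_evaluation) (use ring_iso_memE[OF h] z in simp_all)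
  then obtain \<tau> where t: "\<And>z. z \<in> croots g \<Longrightarrow> \<tau> z \<in> croots f"
    "\<And>z u. z \<in> croots g \<Longrightarrow> u \<in> carrier F.wring \<Longrightarrow> h u z = u (\<tau> z)" by metis
  have "\<exists>z\<in>croots g. \<forall>v\<in>carrier G.wring. k v y = v z" if y: "y \<in> croots f" for y
    by (rule G.hom_is_evaluation) (use ring_iso_memE[OF k] y in simp_all)
  then obtain \<tau>' where t': "\<And>y. y \<in> croots f \<Longrightarrow> \<tau>' y \<in> croots g"
    "\<And>y v. y \<in> croots f \<Longrightarrow> v \<in> carrier G.wring \<Longrightarrow> k v y = v (\<tau>' y)" by metis
  have hc: "h u \<in> carrier G.wring" if "u \<in> carrier F.wring" for u using ring_iso_memE(1)[OF h that] .
  have kc: "k v \<in> carrier F.wring" if "v \<in> carrier G.wring" for v using ring_iso_memE(1)[OF k that] .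
  have "iso_pair n f m r g m' r' \<tau> \<tau>'"
  proof (unfold_locales)
    fix z assume z: "z \<in> croots g"
    show "\<tau> z \<in> croots f" by (rule t(1)[OF z])
    show "\<tau>' (\<tau> z) = z"
    proof (rule G.lat_separates[OF t'(1)[OF t(1)[OF z]] z])
      fix u assume "G.lat u"
      note c = G.res_closed[OF this]
      have "G.res u z = h (k (G.res u)) z" using hk[OF c] by simp
      also have "\<dots> = G.res u (\<tau>' (\<tau> z))" using t(2)[OF z kc[OF c]] t'(2)[OF t(1)[OF z] c] by simp
      finally show "u (\<tau>' (\<tau> z)) = u z" using z t t' by (simp add: G.res_def)
    qed
  next
    fix y assume y: "y \<in> croots f"
    show "\<tau>' y \<in> croots g" by (rule t'(1)[OF y])
    show "\<tau> (\<tau>' y) = y"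
    proof (rule F.lat_separates[OF t(1)[OF t'(1)[OF y]] y])
      fix u assume "F.lat u"
      note c = F.res_closed[OF this]
      have "F.res u y = k (h (F.res u)) y" using kh[OF c] by simp
      also have "\<dots> = F.res u (\<tau> (\<tau>' y))" using t'(2)[OF y hc[OF c]] t(2)[OF t'(1)[OF y] c] by simp
      finally show "u (\<tau> (\<tau>' y)) = u y" using y t t' by (simp add: F.res_def)
    qed
  next
    fix u assume "F.lat u"
    note c = F.res_closed[OF this]
    have "G.lat (h (F.res u))" using hc[OF c] by simp
    moreover have "h (F.res u) z = u (\<tau> z)" if "z \<in> croots g" for z
      using t(2)[OF that c] t(1)[OF that] by (simp add: F.res_def)
    ultimately show "G.lat (\<lambda>z. u (\<tau> z))" using G.lat_cong[of "h (F.res u)" "\<lambda>z. u (\<tau> z)"] by blast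
  next
    fix v assume "G.lat v"
    note c = G.res_closed[OF this]
    have "F.lat (k (G.res v))" using kc[OF c] by simp
    moreover have "k (G.res v) y = v (\<tau>' y)" if "y \<in> croots f" for y
      using t'(2)[OF that c] t'(1)[OF that] by (simp add: G.res_def)
    ultimately show "F.lat (\<lambda>y. v (\<tau>' y))" using F.lat_cong[of "k (G.res v)" "\<lambda>y. v (\<tau>' y)"] by blast
  qed
  thus ?thesis by (intro exI)
qed

section \<open>Interpolating the dual basis of one form at the roots of the other\<close>

lemma int_poly_of_Ints_coeffs:
  fixes P :: "complex poly"
  assumes "\<And>i. coeff P i \<in> \<int>"
  shows "\<exists>d. P = of_int_poly d"
proof -
  have "\<forall>i. \<exists>k. coeff P i = of_int k" using assms by (auto elim: Ints_cases)
  from choice[OF this] obtain c where c: "\<And>i. coeff P i = of_int (c i)" by auto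
  have "P = of_int_poly (\<Sum>i\<le>degree P. monom (c i) i)"
  proof (rule poly_eqI)
    fix i
    have "c i = 0" if "i > degree P" using coeff_eq_0[OF that] c[of i] by simp
    thus "coeff P i = coeff (of_int_poly (\<Sum>i\<le>degree P. monom (c i) i)) i"
      by (simp add: coeff_sum c not_le)
  qed
  thus ?thesis by blast
qed

context iso_pair
begin

lemma swap: "iso_pair n g m' r' f m r \<tau>' \<tau>"
  by unfold_locales (use tau tau' tau'_tau tau_tau' lat_tau lat_tau' in auto)

lemma sum_tau: "(\<Sum>z\<in>croots g. h (\<tau> z) z) = (\<Sum>y\<in>croots f. h y (\<tau>' y))"
  by (rule sum.reindex_bij_witness[of _ \<tau>' \<tau>]) (use tau tau' tau'_tau tau_tau' in auto)

text \<open>\<open>P\<close> is the Lagrange interpolation polynomial with the given values at the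
  roots of \<open>g\<close>. Its coefficients are pairings of \<open>m\<close> times the dual basis
  of \<open>f\<close> with tails of \<open>g\<close>; these tails belong to the ring of
  \<open>g\<close>, hence to that of \<open>f\<close>, so the pairings are integers.\<close>

lemma interpolant:
  assumes j: "j < n - 1"
  shows "\<exists>d. degree d \<le> n - 2 \<and>
    (\<forall>z\<in>croots g. ev d z = of_int m * \<tau> z ^ j * ev (pderiv g) z / ev (pderiv f) (\<tau> z)) \<and>
    m' dvd poly d r' \<and>
    (\<forall>i. of_int (coeff d i) = of_int m * (\<Sum>z\<in>croots g. \<tau> z ^ j / ev (pderiv f) (\<tau> z) * tail g (Suc i) z))"
proof -
  define P where "P = (\<Sum>z\<in>croots g. smult (of_int m * \<tau> z ^ j / ev (pderiv f) (\<tau> z)) (quot g z))"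
  have cP: "coeff P i = of_int m * (\<Sum>z\<in>croots g. \<tau> z ^ j / ev (pderiv f) (\<tau> z) * tail g (Suc i) z)" for i
    by (simp add: P_def coeff_sum coeff_quot sum_distrib_left algebra_simps)
  have pair: "(\<Sum>z\<in>croots g. \<tau> z ^ j / ev (pderiv f) (\<tau> z) * (of_int m * v z)) \<in> \<int>" if "G.lat v" for v
    using F.pairing_int[OF lat_tau'[OF that] j]
      sum_tau[of "\<lambda>y z. y ^ j / ev (pderiv f) y * (of_int m * v z)"] by simp
  have "coeff P i \<in> \<int>" for i
    using pair[OF G.lat_tail, of "Suc i"] unfolding cP by (simp add: sum_distrib_left algebra_simps)
  then obtain d where d: "P = of_int_poly d" using int_poly_of_Ints_coeffs by blast
  have cd: "of_int (coeff d i) = coeff P i" for i using d by simp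
  \<comment> \<open>Interpolation alone gives degree at most \<open>n - 1\<close>. The saved degree
    matters: it makes \<open>u\<close> and \<open>v\<close> at most linear in
    \<open>d_0 = s v^(n - 2)\<close> and \<open>d_(n - 2) = s u^(n - 2)\<close>.\<close>
  have "degree d \<le> n - 2"
  proof (rule degree_le, intro allI impI)
    fix i assume i: "n - 2 < i"
    have "coeff P i = 0"
    proof (cases "i = n - 1")
      case True
      hence "Suc i = degree g" using G.deg F.n_pos by simp
      hence tg: "tail g (Suc i) z = of_int (lead_coeff g)" for z using tail_degree[of g z] by simp
      have "coeff P i = of_int m * ((\<Sum>z\<in>croots g. \<tau> z ^ j / ev (pderiv f) (\<tau> z)) * of_int (lead_coeff g))"
        unfolding cP tg by (simp only: sum_distrib_right)
      also have "(\<Sum>z\<in>croots g. \<tau> z ^ j / ev (pderiv f) (\<tau> z)) = 0"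
        using sum_tau[of "\<lambda>y z. y ^ j / ev (pderiv f) y"] F.euler_sum_power[OF j] by simp
      finally show ?thesis by simp
    next
      case False
      thus ?thesis unfolding cP using i G.deg by (simp add: tail_gt)
    qed
    thus "coeff d i = 0" using cd[of i] by simp
  qed
  moreover have "ev d z = of_int m * \<tau> z ^ j * ev (pderiv g) z / ev (pderiv f) (\<tau> z)" if z: "z \<in> croots g" for z
  proof -
    have "ev d z = (\<Sum>x\<in>croots g. of_int m * \<tau> x ^ j / ev (pderiv f) (\<tau> x) * poly (quot g x) z)"
      unfolding d[symmetric] P_def by (simp add: poly_sum)
    also have "\<dots> = (\<Sum>x\<in>croots g. if x = z then of_int m * \<tau> z ^ j * ev (pderiv g) z / ev (pderiv f) (\<tau> z) else 0)"
      by (rule sum.cong[OF refl]) (use z in \<open>auto simp: poly_quot_other poly_quot_self\<close>)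
    finally show ?thesis using z G.finite_roots by simp
  qed
  \<comment> \<open>The values at \<open>r'\<close> of the quotients \<open>g(x)/(x - z)\<close> are
    \<open>m'\<close> times those of \<open>G.w\<close>, so \<open>poly d r'\<close> is
    \<open>m'\<close> times an integral pairing.\<close>
  moreover have "m' dvd poly d r'"
  proof -
    have "of_int (poly d r') = poly P (of_int r')" unfolding d by simp
    also have "\<dots> = (\<Sum>x\<in>croots g. of_int m * \<tau> x ^ j / ev (pderiv f) (\<tau> x) * poly (quot g x) (of_int r'))"
      unfolding P_def by (simp add: poly_sum)
    also have "\<dots> = of_int m' * (\<Sum>z\<in>croots g. \<tau> z ^ j / ev (pderiv f) (\<tau> z) * (of_int m * G.w z))"
      unfolding sum_distrib_left by (rule sum.cong) (use G.m_pos in \<open>simp_all add: G.w_def\<close>)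
    finally obtain t where "of_int (poly d r') = (of_int m' * of_int t :: complex)"
      using pair[OF G.lat_w] by (metis Ints_cases)
    hence "poly d r' = m' * t" by (simp only: of_int_mult[symmetric] of_int_eq_iff)
    thus ?thesis by simp
  qed
  ultimately show ?thesis using cd cP by metis
qed

definition dp :: "nat \<Rightarrow> int poly" where
  "dp j = (SOME d. degree d \<le> n - 2 \<and>
    (\<forall>z\<in>croots g. ev d z = of_int m * \<tau> z ^ j * ev (pderiv g) z / ev (pderiv f) (\<tau> z)) \<and>
    m' dvd poly d r' \<and>
    (\<forall>i. of_int (coeff d i) = of_int m * (\<Sum>z\<in>croots g. \<tau> z ^ j / ev (pderiv f) (\<tau> z) * tail g (Suc i) z)))"

lemma dp:
  assumes "j < n - 1"
  shows "degree (dp j) \<le> n - 2"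
    "z \<in> croots g \<Longrightarrow> ev (dp j) z = of_int m * \<tau> z ^ j * ev (pderiv g) z / ev (pderiv f) (\<tau> z)"
    "m' dvd poly (dp j) r'"
    "of_int (coeff (dp j) i) = of_int m * (\<Sum>z\<in>croots g. \<tau> z ^ j / ev (pderiv f) (\<tau> z) * tail g (Suc i) z)"
  using someI_ex[OF interpolant[OF assms]] unfolding dp_def[symmetric] by blast+

end

section \<open>Geometric progressions of polynomials\<close>

lemma coeff_mult_le:
  fixes p q :: "int poly" and A B :: real
  assumes p: "\<And>i. \<bar>real_of_int (coeff p i)\<bar> \<le> A" and q: "\<And>i. \<bar>real_of_int (coeff q i)\<bar> \<le> B"
    and d: "degree p < k"
  shows "\<bar>real_of_int (coeff (p * q) i)\<bar> \<le> k * (A * B)"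
proof -
  have A: "A \<ge> 0" and B: "B \<ge> 0" using p[of 0] q[of 0] by linarith+
  have "coeff (p * q) i = (\<Sum>j\<le>i. coeff p j * coeff q (i - j))" by (rule coeff_mult)
  also have "\<dots> = (\<Sum>j\<in>{..i} \<inter> {..<k}. coeff p j * coeff q (i - j))"
    by (rule sum.mono_neutral_right) (use d in \<open>auto simp: not_less intro!: coeff_eq_0\<close>)
  finally have "\<bar>real_of_int (coeff (p * q) i)\<bar> \<le> (\<Sum>j\<in>{..i} \<inter> {..<k}. \<bar>real_of_int (coeff p j * coeff q (i - j))\<bar>)"
    by (simp only: of_int_sum) (rule sum_abs)
  also have "\<dots> \<le> (\<Sum>j\<in>{..i} \<inter> {..<k}. A * B)"
    by (rule sum_mono) (simp add: abs_mult mult_mono p q A)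
  also have "\<dots> = card ({..i} \<inter> {..<k}) * (A * B)" by simp
  also have "\<dots> \<le> k * (A * B)"
    by (intro mult_right_mono) (use A B card_mono[of "{..<k}" "{..i} \<inter> {..<k}"] in auto)
  finally show ?thesis .
qed

text \<open>Let \<open>t\<close> be the gcd and \<open>b / a = u / v\<close> in lowest terms. The
  hypothesis becomes \<open>u^(k+1) * t = v^k * c\<close>, so \<open>v^k\<close> divides
  \<open>t\<close> by coprimality, with quotient \<open>s\<close>.\<close>

lemma geometric_factor:
  fixes a b c :: "int poly"
  assumes ab: "a \<noteq> 0" and eq: "b ^ Suc k = a ^ k * c"
  shows "\<exists>s u v. a = s * v ^ Suc k \<and> b = s * u * v ^ k \<and> c = s * u ^ Suc k"
proof -
  define t where "t = gcd a b"
  have t: "t \<noteq> 0" using ab by (simp add: t_def)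
  obtain v u where vu: "a = v * t" "b = u * t" "coprime v u"
    using gcd_coprime_exists[of a b] t unfolding t_def by blast
  have v: "v \<noteq> 0" using vu ab by auto
  have "t ^ k * (u ^ Suc k * t) = t ^ k * (v ^ k * c)"
    using eq unfolding vu by (simp add: power_mult_distrib algebra_simps)
  hence e: "u ^ Suc k * t = v ^ k * c" using t by simp
  have "coprime (v ^ k) (u ^ Suc k)" using vu(3) by simp
  moreover have "v ^ k dvd u ^ Suc k * t" using e by simp
  ultimately have "v ^ k dvd t" by (simp only: coprime_dvd_mult_right_iff)
  then obtain s where s: "t = v ^ k * s" by (elim dvdE)
  have "v ^ k * (u ^ Suc k * s) = v ^ k * c" using e s by (simp add: algebra_simps)
  hence "c = u ^ Suc k * s" using v by simp
  thus ?thesis using vu s by (intro exI[of _ s] exI[of _ u] exI[of _ v]) (simp add: algebra_simps)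
qed

lemma degree_power_le_imp:
  fixes u :: "int poly"
  assumes "s * u ^ k \<noteq> 0" "degree (s * u ^ k) \<le> k" "k > 0"
  shows "degree u \<le> 1" "degree u = 1 \<Longrightarrow> degree s = 0"
proof -
  have "s \<noteq> 0" "u ^ k \<noteq> 0" using assms(1) by auto
  hence d: "degree s + k * degree u \<le> k" using assms(2,3)
    by (simp add: degree_mult_eq degree_power_eq mult.commute)
  show "degree u \<le> 1"
  proof (rule ccontr)
    assume "\<not> degree u \<le> 1"
    hence "k * 2 \<le> k * degree u" by (intro mult_le_mono2) simp
    thus False using d assms(3) by linarith
  qed
  show "degree u = 1 \<Longrightarrow> degree s = 0" using d by simp
qed

lemma coeff_power_linear:
  fixes u :: "int poly"
  assumes "degree u \<le> 1" "k > 0"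
  shows "coeff (u ^ k) k = coeff u 1 ^ k" "coeff (u ^ k) 0 = coeff u 0 ^ k"
proof -
  show "coeff (u ^ k) 0 = coeff u 0 ^ k" by (simp add: poly_0_coeff_0[symmetric])
  show "coeff (u ^ k) k = coeff u 1 ^ k"
  proof (cases "degree u = 1")
    case True
    hence "u \<noteq> 0" by auto
    hence "degree (u ^ k) = k" using True by (simp add: degree_power_eq)
    thus ?thesis using True lead_coeff_power[of u k] by simp
  next
    case False
    hence du: "degree u = 0" using assms(1) by simp
    hence "degree (u ^ k) = 0" using degree_power_le[of u k] by simp
    thus ?thesis using assms(2) du by (simp add: coeff_eq_0 power_0_left)
  qed
qed

text \<open>\<open>K\<close> bounds each summand of a coefficient of \<open>dp\<close>, up to
  \<open>m\<close>; the factor \<open>n\<close> allows for the \<open>n\<close> roots in the sum.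
  The assumptions are symmetric in \<open>f\<close> and \<open>g\<close>, so that whatever holds for
  \<open>\<tau>\<close> also holds for its inverse.\<close>

locale small_iso_pair = iso_pair +
  fixes K :: real
  assumes n4: "n \<ge> 4" and prim_f: "content f = 1" and prim_g: "content g = 1"
    and bound_f: "\<And>y z j i. y \<in> croots f \<Longrightarrow> z \<in> croots g \<Longrightarrow> j < n \<Longrightarrow>
      n * (norm (y ^ j / ev (pderiv f) y) * norm (tail g (Suc i) z)) \<le> K"
    and bound_g: "\<And>y z j i. y \<in> croots f \<Longrightarrow> z \<in> croots g \<Longrightarrow> j < n \<Longrightarrow>
      n * (norm (z ^ j / ev (pderiv g) z) * norm (tail f (Suc i) y)) \<le> K"
    and lead_f: "2 * n * (K * m')\<^sup>2 < \<bar>lead_coeff f\<bar>"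
    and lead_g: "2 * n * (K * m)\<^sup>2 < \<bar>lead_coeff g\<bar>"
begin

lemma swap_small: "small_iso_pair n g m' r' f m r \<tau>' \<tau> K"
proof -
  interpret S: iso_pair n g m' r' f m r \<tau>' \<tau> by (rule swap)
  show ?thesis by unfold_locales (use n4 prim_f prim_g bound_f bound_g lead_f lead_g in auto)
qed

lemma coeff_dp_le:
  assumes j: "j < n - 1"
  shows "\<bar>real_of_int (coeff (dp j) i)\<bar> \<le> K * m"
proof -
  have "norm (\<Sum>z\<in>croots g. \<tau> z ^ j / ev (pderiv f) (\<tau> z) * tail g (Suc i) z) \<le> (\<Sum>z\<in>croots g. K / n)"
  proof (rule sum_norm_le)
    fix z assume "z \<in> croots g"
    hence "n * (norm (\<tau> z ^ j / ev (pderiv f) (\<tau> z)) * norm (tail g (Suc i) z)) \<le> K"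
      using j by (intro bound_f tau) auto
    thus "norm (\<tau> z ^ j / ev (pderiv f) (\<tau> z) * tail g (Suc i) z) \<le> K / n"
      using n4 unfolding norm_mult by (simp add: pos_le_divide_eq mult.commute)
  qed
  also have "\<dots> = K" using G.card_roots n4 by simp
  finally have "of_int m * norm (\<Sum>z\<in>croots g. \<tau> z ^ j / ev (pderiv f) (\<tau> z) * tail g (Suc i) z) \<le> of_int m * K"
    using F.m_pos by (intro mult_left_mono) auto
  hence "norm (of_int (coeff (dp j) i) :: complex) \<le> of_int m * K"
    unfolding dp(4)[OF j] norm_mult using F.m_pos by simp
  thus ?thesis by (simp add: mult.commute)
qed

lemma dp_cross:
  assumes j: "Suc j < n - 1"
  shows "dp 0 * dp (Suc j) = dp 1 * dp j"
proof -
  let ?P = "dp 0 * dp (Suc j) - dp 1 * dp j"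
  have lt: "0 < n - 1" "1 < n - 1" "j < n - 1" using n4 j by auto
  have "g dvd ?P"
  proof (rule primitive_dvd_of_common_roots[OF prim_g, of "croots g"])
    show "card (croots g) = degree g" using G.card_roots G.deg by simp
    show "degree g > 0" using G.deg n4 by simp
    show "ev g z = 0" if "z \<in> croots g" for z using that by (simp add: croots_def)
    show "ev ?P z = 0" if z: "z \<in> croots g" for z
      unfolding of_int_poly_hom.hom_minus of_int_poly_hom.hom_mult poly_diff poly_mult
        dp(2)[OF lt(1) z] dp(2)[OF j z] dp(2)[OF lt(2) z] dp(2)[OF lt(3) z]
      by simp
  qed
  then obtain h where h: "?P = g * h" by (elim dvdE)
  have "?P = 0"
  proof (rule ccontr)
    assume nz: "?P \<noteq> 0"
    hence "h \<noteq> 0" using h by auto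
    hence "\<bar>lead_coeff g\<bar> * 1 \<le> \<bar>lead_coeff g\<bar> * \<bar>lead_coeff h\<bar>"
      by (intro mult_left_mono) (use leading_coeff_0_iff[of h] in linarith, simp)
    hence le: "\<bar>lead_coeff g\<bar> \<le> \<bar>lead_coeff ?P\<bar>" unfolding h by (simp add: lead_coeff_mult abs_mult)
    \<comment> \<open>A coefficient of each product is a sum of at most \<open>n\<close> terms, and
      two products are subtracted; this is the constant in \<open>lead_g\<close>.\<close>
    have c: "\<bar>real_of_int (coeff (dp a * dp b) i)\<bar> \<le> n * ((K * m) * (K * m))" if "a < n - 1" "b < n - 1" for a b i
      by (rule coeff_mult_le) (use that coeff_dp_le dp(1)[OF that(1)] n4 in auto)
    have "\<bar>real_of_int (coeff ?P i)\<bar> \<le> 2 * n * (K * m)\<^sup>2" for i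
      using c[OF lt(1) j, of i] c[OF lt(2,3), of i] by (simp add: power2_eq_square)
    from this[of "degree ?P"] have "real_of_int \<bar>lead_coeff ?P\<bar> \<le> 2 * n * (K * m)\<^sup>2" by (simp only: of_int_abs)
    thus False using lead_g le by linarith
  qed
  thus ?thesis by simp
qed

lemma dp_nz: "z \<in> croots g \<Longrightarrow> ev (dp 0) z \<noteq> 0"
  using dp(2)[of 0 z] n4 F.m_pos G.simple[of z] F.simple[OF tau, of z] by simp

lemma dp_geometric: "Suc k < n - 1 \<Longrightarrow> dp 1 ^ Suc k = dp 0 ^ k * dp (Suc k)"
proof (induction k)
  case (Suc k)
  have "dp 1 ^ Suc (Suc k) = dp 1 * (dp 0 ^ k * dp (Suc k))" using Suc by simp
  also have "\<dots> = dp 0 ^ k * (dp 1 * dp (Suc k))" by (simp add: algebra_simps)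
  also have "\<dots> = dp 0 ^ k * (dp 0 * dp (Suc (Suc k)))" using dp_cross[of "Suc k"] Suc.prems by simp
  finally show ?case by (simp add: algebra_simps)
qed simp

text \<open>The polynomials \<open>dp j\<close> are in geometric progression with ratio
  \<open>\<tau>\<close> at the roots, which yields \<open>s v^(n - 2)\<close>,
  \<open>s u v^(n - 3)\<close> and \<open>s u^(n - 2)\<close> for the first, second and last. All
  have degree at most \<open>n - 2\<close>, so \<open>u\<close> and \<open>v\<close> are at most
  linear, and \<open>s\<close> is constant once one of them is not.\<close>

lemma moebius:
  "\<exists>s u v. s \<noteq> 0 \<and> dp 0 = smult s (v ^ (n - 2)) \<and> dp (n - 2) = smult s (u ^ (n - 2)) \<and>
     degree u \<le> 1 \<and> degree v \<le> 1 \<and> (\<forall>z\<in>croots g. ev v z \<noteq> 0 \<and> \<tau> z = ev u z / ev v z)"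
proof -
  have nn: "Suc (n - 3) = n - 2" using n4 by simp
  have "croots g \<noteq> {}" using G.card_roots n4 by auto
  then obtain z0 where z0: "z0 \<in> croots g" by blast
  have d0: "dp 0 \<noteq> 0" using dp_nz[OF z0] by auto
  have "dp 1 ^ Suc (n - 3) = dp 0 ^ (n - 3) * dp (Suc (n - 3))"
    by (rule dp_geometric) (use n4 in simp)
  from geometric_factor[OF d0 this] obtain s u v where
    suv: "dp 0 = s * v ^ (n - 2)" "dp 1 = s * u * v ^ (n - 3)" "dp (n - 2) = s * u ^ (n - 2)"
    unfolding nn by blast
  have sv: "ev s z \<noteq> 0" "ev v z \<noteq> 0" if "z \<in> croots g" for z
    using dp_nz[OF that] n4 unfolding suv(1) by (auto simp: hom_distribs)
  have tz: "\<tau> z = ev u z / ev v z" if z: "z \<in> croots g" for z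
  proof -
    have "ev (dp 1) z = \<tau> z * ev (dp 0) z" using dp(2)[of 0 z] dp(2)[of 1 z] z n4 by simp
    hence "ev s z * ev v z ^ (n - 3) * ev u z = ev s z * ev v z ^ (n - 3) * (\<tau> z * ev v z)"
      unfolding suv nn[symmetric] by (simp add: hom_distribs algebra_simps)
    thus ?thesis using sv[OF z] by (simp add: field_simps)
  qed
  have n2: "n - 2 > 0" using n4 by simp
  have dv: "degree v \<le> 1" "degree v = 1 \<Longrightarrow> degree s = 0"
    using degree_power_le_imp[of s v "n - 2"] dp(1)[of 0] d0 n4 unfolding suv(1) by auto
  have s0: "s \<noteq> 0" using d0 suv(1) by auto
  have du: "u = 0 \<or> degree u \<le> 1 \<and> (degree u = 1 \<longrightarrow> degree s = 0)"
    using degree_power_le_imp[of s u "n - 2"] dp(1)[of "n - 2"] s0 n4 unfolding suv(3) by auto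
  \<comment> \<open>Constant \<open>u\<close> and \<open>v\<close> would make \<open>\<tau>\<close>
    constant, against its injectivity on the roots of \<open>g\<close>.\<close>
  have "\<not> (degree u = 0 \<and> degree v = 0)"
  proof
    assume "degree u = 0 \<and> degree v = 0"
    then obtain a b where "u = [:a:]" "v = [:b:]" by (metis degree_eq_zeroE)
    hence "\<tau> z = of_int a / of_int b" if "z \<in> croots g" for z using tz[OF that] by simp
    hence "\<tau>' (\<tau> z) = \<tau>' (of_int a / of_int b)" if "z \<in> croots g" for z using that by simp
    hence "croots g \<subseteq> {\<tau>' (of_int a / of_int b)}" using tau'_tau by fastforce
    hence "card (croots g) \<le> 1" using card_mono[of "{\<tau>' (of_int a / of_int b)}"] by simp
    thus False using G.card_roots n4 by simp
  qed
  hence "degree s = 0" using du dv by auto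
  then obtain c where c: "s = [:c:]" by (rule degree_eq_zeroE)
  show ?thesis
    by (rule exI[of _ c], rule exI[of _ u], rule exI[of _ v])
      (use s0 c suv du dv(1) sv(2) tz in auto)
qed

end

section \<open>The possible Moebius transformations\<close>

lemma linear_poly: "degree u \<le> 1 \<Longrightarrow> u = [:coeff u 0, coeff u 1:]"
  by (rule poly_eqI) (auto simp: coeff_pCons coeff_eq_0 split: nat.split)

lemma ev_linear: "degree u \<le> 1 \<Longrightarrow> ev u z = of_int (coeff u 0) + of_int (coeff u 1) * z"
  by (subst linear_poly) (simp_all add: mult.commute)

lemma poly_linear: "degree u \<le> 1 \<Longrightarrow> poly u r = coeff u 0 + coeff u 1 * (r :: int)"
  by (subst linear_poly) (simp_all add: mult.commute)

text \<open>A prime factor \<open>q\<close> of \<open>k\<close> occurs twice in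
  \<open>m * m'\<close>, so \<open>m = m' = q\<close>, and cancelling \<open>q^2\<close> makes
  \<open>s\<close> a unit. It is applied with \<open>N = n - 2\<close>, whence the need for
  \<open>n \<ge> 4\<close>.\<close>

lemma prime_product_power:
  fixes m m' k s t :: int
  assumes p: "prime m" "prime m'" and eq: "m * m' = s * t * k ^ N" and N: "N \<ge> 2" and k: "\<not> is_unit k"
  shows "m = m' \<and> is_unit s"
proof -
  have "m * m' \<noteq> 0" using p by (auto simp: prime_ge_0_int)
  hence "k \<noteq> 0" using eq N by (auto simp: power_0_left)
  then obtain q where q: "prime q" "q dvd k" using prime_divisor_exists[of k] k by auto
  then obtain l where l: "k = q * l" by (elim dvdE)
  have "k ^ N = q\<^sup>2 * (q ^ (N - 2) * l ^ N)"
  proof -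
    have "q ^ N = q\<^sup>2 * q ^ (N - 2)" using N by (metis le_add_diff_inverse power_add)
    thus ?thesis unfolding l power_mult_distrib by simp
  qed
  hence e: "m * m' = q * (q * (s * t * (q ^ (N - 2) * l ^ N)))" using eq by (simp add: power2_eq_square algebra_simps)
  have "q dvd m * m'" using e by simp
  hence "q dvd m \<or> q dvd m'" using q(1) by (simp add: prime_dvd_mult_iff)
  hence "q = m \<or> q = m'" using primes_dvd_imp_eq q(1) p by blast
  hence "m = q \<and> m' = q"
  proof
    assume "q = m"
    hence "m' = q * (s * t * (q ^ (N - 2) * l ^ N))" using e p(1) by auto
    hence "q dvd m'" by (rule dvdI)
    thus ?thesis using primes_dvd_imp_eq[OF q(1) p(2)] \<open>q = m\<close> by simp
  next
    assume "q = m'"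
    hence "m = q * (s * t * (q ^ (N - 2) * l ^ N))" using e p(2) by (auto simp: mult.commute)
    hence "q dvd m" by (rule dvdI)
    thus ?thesis using primes_dvd_imp_eq[OF q(1) p(1)] \<open>q = m'\<close> by simp
  qed
  hence m: "m = q" "m' = q" by auto
  have "q * q * 1 = q * q * (s * (t * (q ^ (N - 2) * l ^ N)))" using e unfolding m by (simp add: algebra_simps)
  moreover have "q * q \<noteq> 0" using q(1) by auto
  ultimately have "1 = s * (t * (q ^ (N - 2) * l ^ N))" by (auto simp only: mult_cancel_left)
  hence "s dvd 1" by (rule dvdI)
  thus ?thesis using m by simp
qed

context small_iso_pair
begin

text \<open>The composite of the two transformations fixes the roots of \<open>g\<close>, so the
  product of their matrices is scalar, and \<open>k\<close> is this scalar. In detail,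
  \<open>A(z) = z * B(z)\<close> at \<open>n\<close> points forces \<open>A = x * B\<close> as
  polynomials; since \<open>A\<close> has degree at most 1, \<open>B\<close> is constant.\<close>

lemma moebius_inverse:
  assumes u: "degree u \<le> 1" "degree v \<le> 1" "\<forall>z\<in>croots g. ev v z \<noteq> 0 \<and> \<tau> z = ev u z / ev v z"
    and u': "degree u' \<le> 1" "degree v' \<le> 1" "\<forall>y\<in>croots f. ev v' y \<noteq> 0 \<and> \<tau>' y = ev u' y / ev v' y"
  shows "\<exists>k :: int. \<forall>z\<in>croots g. ev v z * ev v' (\<tau> z) = of_int k"
proof -
  define A where "A = smult (coeff u' 0) v + smult (coeff u' 1) u"
  define B where "B = smult (coeff v' 0) v + smult (coeff v' 1) u"
  have AB: "ev A z = ev v z * ev u' (\<tau> z)" "ev B z = ev v z * ev v' (\<tau> z)" if z: "z \<in> croots g" for z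
  proof -
    have "ev u z = ev v z * \<tau> z" using u(3) z by simp
    thus "ev A z = ev v z * ev u' (\<tau> z)" "ev B z = ev v z * ev v' (\<tau> z)"
      by (simp_all add: A_def B_def hom_distribs ev_linear[OF u'(1)] ev_linear[OF u'(2)] algebra_simps)
  qed
  have dA: "degree A \<le> 1" and dB: "degree B \<le> 1"
    unfolding A_def B_def using u(1,2) by (auto intro!: degree_add_le le_trans[OF degree_smult_le])
  have "(of_int_poly A :: complex poly) = of_int_poly (pCons 0 B)"
  proof (rule G.eq_of_roots)
    show "degree (of_int_poly A :: complex poly) < n" using dA n4 by simp
    show "degree (of_int_poly (pCons 0 B) :: complex poly) < n" using dB n4 degree_pCons_le[of 0 B] by simp
    fix z assume z: "z \<in> croots g"
    have "z = ev u' (\<tau> z) / ev v' (\<tau> z)" using u'(3) tau[OF z] tau'_tau[OF z] by simp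
    hence "ev u' (\<tau> z) = z * ev v' (\<tau> z)" using u'(3) tau[OF z] by (simp add: field_simps)
    thus "ev A z = ev (pCons 0 B) z" using AB[OF z] by simp
  qed
  hence "A = pCons 0 B" by (simp only: of_int_poly_hom.eq_iff)
  hence "degree B = 0" using dA by (cases "B = 0") auto
  then obtain k where "B = [:k:]" by (rule degree_eq_zeroE)
  thus ?thesis using AB(2) by (intro exI[of _ k]) auto
qed

lemma coeff_scaled_power:
  assumes "dp j = smult s (u ^ (n - 2))" "j < n - 1" "degree u \<le> 1" "x \<in> {coeff u 0, coeff u 1}"
  shows "real_of_int (\<bar>s\<bar> * \<bar>x\<bar> ^ (n - 2)) \<le> K * m"
proof -
  have "coeff (dp j) 0 = s * coeff u 0 ^ (n - 2)" "coeff (dp j) (n - 2) = s * coeff u 1 ^ (n - 2)"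
    using assms(1) coeff_power_linear[OF assms(3), of "n - 2"] n4 by simp_all
  hence "\<exists>i. s * x ^ (n - 2) = coeff (dp j) i"
    using assms(4) by (metis insertE singletonD)
  then obtain i where "s * x ^ (n - 2) = coeff (dp j) i" by blast
  thus ?thesis using coeff_dp_le[OF assms(2), of i] by (metis abs_mult of_int_abs power_abs)
qed

text \<open>In the product of \<open>dp 0\<close> at \<open>z\<close> and its counterpart at
  \<open>\<tau> z\<close> the derivatives cancel, which leaves
  \<open>m * m' = s * s' * k^(n - 2)\<close>. If \<open>k\<close> is a unit, then
  \<open>\<bar>s'\<bar> \<le> K * m'\<close> forces \<open>m \<le> \<bar>s\<bar> * K\<close>, and
  the bound \<open>K * m\<close> on the coefficients of \<open>dp\<close> bounds the entries by
  \<open>K^2\<close>. Otherwise \<open>m = m'\<close> and \<open>s\<close> is a unit: the entries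
  are only bounded by the square root of \<open>K * m'\<close>, but \<open>m'\<close> divides
  \<open>s * v(r')^(n - 2)\<close> and \<open>s * u(r')^(n - 2)\<close>, hence \<open>v(r')\<close>
  and \<open>u(r')\<close>.\<close>

lemma classification:
  assumes p: "prime m" "prime m'"
  shows "\<exists>u0 u1 v0 v1 :: int.
    (\<forall>z\<in>croots g. \<tau> z = (of_int u0 + of_int u1 * z) / (of_int v0 + of_int v1 * z)) \<and> u0 * v1 \<noteq> u1 * v0 \<and>
    ((\<forall>x\<in>{u0, u1, v0, v1}. \<bar>x\<bar> \<le> K\<^sup>2) \<or>
     (\<forall>x\<in>{u0, u1, v0, v1}. x\<^sup>2 \<le> K * m') \<and> m' dvd u0 + u1 * r' \<and> m' dvd v0 + v1 * r')"
proof -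
  interpret S: small_iso_pair n g m' r' f m r \<tau>' \<tau> K by (rule swap_small)
  obtain s u v where 1: "s \<noteq> 0" "dp 0 = smult s (v ^ (n - 2))" "dp (n - 2) = smult s (u ^ (n - 2))"
    "degree u \<le> 1" "degree v \<le> 1" "\<forall>z\<in>croots g. ev v z \<noteq> 0 \<and> \<tau> z = ev u z / ev v z"
    using moebius by blast
  obtain s' u' v' where 2: "s' \<noteq> 0" "S.dp 0 = smult s' (v' ^ (n - 2))" "S.dp (n - 2) = smult s' (u' ^ (n - 2))"
    "degree u' \<le> 1" "degree v' \<le> 1" "\<forall>y\<in>croots f. ev v' y \<noteq> 0 \<and> \<tau>' y = ev u' y / ev v' y"
    using S.moebius by blast
  obtain k :: int where k: "\<forall>z\<in>croots g. ev v z * ev v' (\<tau> z) = of_int k"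
    using moebius_inverse[OF 1(4-6) 2(4-6)] by blast
  have "card (croots g) \<ge> 2" using G.card_roots n4 by simp
  then obtain z0 z1 where z: "z0 \<in> croots g" "z1 \<in> croots g" "z0 \<noteq> z1"
    by (metis card_le_Suc0_iff_eq G.finite_roots not_less_eq_eq numeral_2_eq_2)
  have n1: "0 < n - 1" "n - 2 < n - 1" using n4 by auto
  have "(of_int (m * m') :: complex) = ev (dp 0) z0 * ev (S.dp 0) (\<tau> z0)"
    using dp(2)[OF n1(1) z(1)] S.dp(2)[OF n1(1) tau[OF z(1)]] tau'_tau[OF z(1)]
      G.simple[OF z(1)] F.simple[OF tau[OF z(1)]] by simp
  also have "\<dots> = of_int (s * s') * (ev v z0 * ev v' (\<tau> z0)) ^ (n - 2)"
    unfolding 1(2) 2(2) by (simp add: hom_distribs power_mult_distrib)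
  also have "\<dots> = of_int (s * s' * k ^ (n - 2))" using k z(1) by simp
  finally have mm: "m * m' = s * s' * k ^ (n - 2)" by (simp only: of_int_eq_iff)
  define C where "C = {coeff u 0, coeff u 1, coeff v 0, coeff v 1}"
  have bnd: "real_of_int (\<bar>s\<bar> * \<bar>x\<bar> ^ (n - 2)) \<le> K * m" if "x \<in> C" for x
    using coeff_scaled_power[OF 1(3) n1(2) 1(4), of x] coeff_scaled_power[OF 1(2) n1(1) 1(5), of x] that
    unfolding C_def by blast
  have pw: "\<bar>x\<bar> \<le> \<bar>x\<bar> ^ (n - 2)" "x\<^sup>2 \<le> \<bar>x\<bar> ^ (n - 2)" for x :: int
  proof -
    show "\<bar>x\<bar> \<le> \<bar>x\<bar> ^ (n - 2)" using n4 self_le_power[of "\<bar>x\<bar>" "n - 2"] by (cases "x = 0") auto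
    have "\<bar>x\<bar> ^ 2 \<le> \<bar>x\<bar> ^ (n - 2)" if "x \<noteq> 0" by (rule power_increasing) (use n4 that in auto)
    thus "x\<^sup>2 \<le> \<bar>x\<bar> ^ (n - 2)" using n4 by (cases "x = 0") auto
  qed
  have det: "coeff u 0 * coeff v 1 \<noteq> coeff u 1 * coeff v 0"
  proof
    assume d: "coeff u 0 * coeff v 1 = coeff u 1 * coeff v 0"
    have "ev u z0 * ev v z1 - ev u z1 * ev v z0 =
      of_int (coeff u 1 * coeff v 0 - coeff u 0 * coeff v 1) * (z0 - z1)"
      unfolding ev_linear[OF 1(4)] ev_linear[OF 1(5)] by (simp add: algebra_simps)
    also have "coeff u 1 * coeff v 0 - coeff u 0 * coeff v 1 = 0" using d by simp
    finally have "ev u z0 * ev v z1 = ev u z1 * ev v z0" by simp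
    hence "\<tau> z0 = \<tau> z1" using 1(6) z by (simp add: field_simps)
    hence "z0 = z1" using tau'_tau z by metis
    thus False using z(3) by simp
  qed
  have "(\<forall>x\<in>C. \<bar>x\<bar> \<le> K\<^sup>2) \<or> (\<forall>x\<in>C. x\<^sup>2 \<le> K * m') \<and> m' dvd poly u r' \<and> m' dvd poly v r'"
  proof (cases "is_unit k")
    case True
    hence "\<bar>k ^ (n - 2)\<bar> = 1" by (simp add: power_abs)
    hence ss: "\<bar>s\<bar> * \<bar>s'\<bar> = m * m'" using mm F.m_pos G.m_pos by (metis abs_mult abs_of_pos mult.right_neutral mult_pos_pos)
    \<comment> \<open>A nonzero integral coefficient of \<open>v'\<close> is at least 1 in absolute
      value, so the coefficient bound passes to \<open>s'\<close>.\<close>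
    have "v' \<noteq> 0" using 2(6) tau[OF z(1)] by auto
    hence "coeff v' 0 \<noteq> 0 \<or> coeff v' 1 \<noteq> 0" using linear_poly[OF 2(5)] by auto
    then obtain x where x: "x \<in> {coeff v' 0, coeff v' 1}" "x \<noteq> 0" by blast
    have "\<bar>s'\<bar> * 1 \<le> \<bar>s'\<bar> * \<bar>x\<bar> ^ (n - 2)" using x(2) by (intro mult_left_mono) (auto simp: one_le_power)
    hence "real_of_int \<bar>s'\<bar> \<le> K * m'"
      using S.coeff_scaled_power[OF 2(2) n1(1) 2(5) x(1)] by linarith
    hence "real_of_int \<bar>s\<bar> * real_of_int \<bar>s'\<bar> \<le> real_of_int \<bar>s\<bar> * (K * m')" by (intro mult_left_mono) auto
    hence "real_of_int m * real_of_int m' \<le> real_of_int \<bar>s\<bar> * (K * m')" using ss by (metis of_int_mult)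
    hence "real_of_int m' * real_of_int m \<le> real_of_int m' * (real_of_int \<bar>s\<bar> * K)" by (simp add: algebra_simps)
    hence ms: "real_of_int m \<le> real_of_int \<bar>s\<bar> * K" using G.m_pos by (subst (asm) mult_le_cancel_left_pos) auto
    have K: "K \<ge> 0" using order_trans[OF _ ms, of 0] F.m_pos 1(1) by (simp add: zero_le_mult_iff)
    have "\<bar>x\<bar> \<le> K\<^sup>2" if "x \<in> C" for x
    proof -
      have "real_of_int \<bar>s\<bar> * real_of_int (\<bar>x\<bar> ^ (n - 2)) \<le> K * m" using bnd[OF that] by simp
      also have "\<dots> \<le> K * (real_of_int \<bar>s\<bar> * K)" by (rule mult_left_mono[OF ms K])
      also have "\<dots> = real_of_int \<bar>s\<bar> * K\<^sup>2" by (simp add: power2_eq_square)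
      finally have "real_of_int (\<bar>x\<bar> ^ (n - 2)) \<le> K\<^sup>2" using 1(1) by (subst (asm) mult_le_cancel_left_pos) auto
      moreover have "real_of_int \<bar>x\<bar> \<le> real_of_int (\<bar>x\<bar> ^ (n - 2))" using pw(1) by (simp only: of_int_le_iff)
      ultimately show ?thesis by linarith
    qed
    thus ?thesis by blast
  next
    case False
    have n2: "2 \<le> n - 2" using n4 by simp
    have "m = m'" and s: "is_unit s" using prime_product_power[OF p mm n2 False] by auto
    have "x\<^sup>2 \<le> K * m'" if "x \<in> C" for x
    proof -
      have "\<bar>s\<bar> = 1" using s by simp
      hence "real_of_int (\<bar>x\<bar> ^ (n - 2)) \<le> K * m" using bnd[OF that] by simp
      moreover have "real_of_int (x\<^sup>2) \<le> real_of_int (\<bar>x\<bar> ^ (n - 2))" using pw(2) by (simp only: of_int_le_iff)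
      ultimately show ?thesis using \<open>m = m'\<close> by simp
    qed
    moreover have "m' dvd s * poly v r' ^ (n - 2)" "m' dvd s * poly u r' ^ (n - 2)"
      using dp(3)[OF n1(1)] dp(3)[OF n1(2)] unfolding 1(2,3) by simp_all
    hence "m' dvd poly v r' ^ (n - 2)" "m' dvd poly u r' ^ (n - 2)"
      using s by (simp_all add: dvd_mult_unit_iff')
    hence "m' dvd poly v r'" "m' dvd poly u r'" using p(2) by (auto dest: prime_dvd_power)
    ultimately show ?thesis by blast
  qed
  thus ?thesis
    using det 1(6) unfolding C_def ev_linear[OF 1(4)] ev_linear[OF 1(5)] poly_linear[OF 1(4)] poly_linear[OF 1(5)]
    by (intro exI[of _ "coeff u 0"] exI[of _ "coeff u 1"] exI[of _ "coeff v 0"] exI[of _ "coeff v 1"]) auto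
qed

end

section \<open>Recovering a triple from its transformation\<close>

lemma same_roots_imp_eq:
  assumes "simple_roots n f" "simple_roots n g" "croots f = croots g"
    and "content f = 1" "content g = 1" "lead_coeff f > 0" "lead_coeff g > 0"
  shows "f = g"
proof -
  interpret F: simple_roots n f by fact
  interpret G: simple_roots n g by fact
  have "f dvd g"
    by (rule primitive_dvd_of_common_roots[OF assms(4), of "croots f"])
      (use F.card_roots F.deg F.n_pos assms(3) in \<open>auto simp: croots_def\<close>)
  then obtain h where h: "g = f * h" by (elim dvdE)
  have "h \<noteq> 0" using h G.f_nz by auto
  hence "degree h = 0" using h F.deg G.deg F.f_nz by (simp add: degree_mult_eq)
  then obtain c where c: "h = [:c:]" by (rule degree_eq_zeroE)
  have g: "g = smult c f" using h c by simp
  have "lead_coeff g = c * lead_coeff f" unfolding g by (rule lead_coeff_smult)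
  hence "c > 0" using assms(6,7) by (simp only: zero_less_mult_iff) linarith
  moreover have "\<bar>c\<bar> = 1" using g assms(4,5) by simp
  ultimately show ?thesis using g by simp
qed

text \<open>The roots of \<open>f\<close> are the images under \<open>\<tau>\<close> of those of
  \<open>g\<close>, and a primitive form with positive leading coefficient is determined by its
  roots. The lattice of \<open>f\<close> is that of \<open>g\<close> transported along
  \<open>\<tau>\<close>, and it determines \<open>m\<close> and \<open>r\<close>.\<close>

lemma same_moebius_imp_eq:
  assumes 1: "iso_pair n f1 m1 r1 g m' r' \<tau>1 \<tau>1'" and 2: "iso_pair n f2 m2 r2 g m' r' \<tau>2 \<tau>2'"
    and n: "n \<ge> 3" and eq: "\<And>z. z \<in> croots g \<Longrightarrow> \<tau>1 z = \<tau>2 z"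
    and f: "content f1 = 1" "content f2 = 1" "lead_coeff f1 > 0" "lead_coeff f2 > 0"
    and r: "0 \<le> r1" "r1 < m1" "0 \<le> r2" "r2 < m2"
  shows "(f1, m1, r1) = (f2, m2, r2)"
proof -
  interpret P1: iso_pair n f1 m1 r1 g m' r' \<tau>1 \<tau>1' by fact
  interpret P2: iso_pair n f2 m2 r2 g m' r' \<tau>2 \<tau>2' by fact
  have "croots f1 = \<tau>1 ` croots g" using P1.tau P1.tau' P1.tau_tau' by force
  moreover have "croots f2 = \<tau>2 ` croots g" using P2.tau P2.tau' P2.tau_tau' by force
  ultimately have roots: "croots f1 = croots f2" using eq by (simp cong: image_cong)
  have ff: "f1 = f2"
    by (rule same_roots_imp_eq[OF P1.F.simple_roots_axioms P2.F.simple_roots_axioms roots f])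
  have "P2.F.lat u" if "P1.F.lat u" for u
  proof -
    have "P1.G.lat (\<lambda>z. u (\<tau>1 z))" by (rule P1.lat_tau[OF that])
    hence "P1.G.lat (\<lambda>z. u (\<tau>2 z))" using P1.G.lat_cong[of "\<lambda>z. u (\<tau>1 z)" "\<lambda>z. u (\<tau>2 z)"] eq by simp
    hence "P2.F.lat (\<lambda>y. u (\<tau>2 (\<tau>2' y)))" by (rule P2.lat_tau')
    thus ?thesis using P2.F.lat_cong[of "\<lambda>y. u (\<tau>2 (\<tau>2' y))" u] P2.tau_tau' by simp
  qed
  moreover have "P1.F.lat u" if "P2.F.lat u" for u
  proof -
    have "P1.G.lat (\<lambda>z. u (\<tau>2 z))" by (rule P2.lat_tau[OF that])
    hence "P1.G.lat (\<lambda>z. u (\<tau>1 z))" using P1.G.lat_cong[of "\<lambda>z. u (\<tau>1 z)" "\<lambda>z. u (\<tau>2 z)"] eq by simp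
    hence "P1.F.lat (\<lambda>y. u (\<tau>1 (\<tau>1' y)))" by (rule P1.lat_tau')
    thus ?thesis using P1.F.lat_cong[of "\<lambda>y. u (\<tau>1 (\<tau>1' y))" u] P1.tau_tau' by simp
  qed
  ultimately have "m1 = m2 \<and> r1 = r2"
    using P1.F.double_root_axioms P2.F.double_root_axioms
    by (intro lat_determines_root[of n f1 m1 r1 m2 r2] n r) (auto simp: ff)
  thus ?thesis using ff by simp
qed

section \<open>Fibers of the map from forms to rings\<close>

text \<open>The summands count the two alternatives of \<open>classification\<close>: quadruples
  with entries at most \<open>K^2\<close>, and quadruples given by four determinants at most
  \<open>2 * K\<close>.\<close>

definition fiber_bound :: "real \<Rightarrow> nat" where
  "fiber_bound K = nat (2 * \<lfloor>K\<^sup>2\<rfloor> + 1) ^ 4 + nat (2 * \<lfloor>2 * K\<rfloor> + 1) ^ 4"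

lemma card_box4: "card ({-a..a} \<times> {-a..a} \<times> {-a..a} \<times> {-a..a}) = nat (2 * a + 1) ^ 4" for a :: int
  by (simp add: card_cartesian_product numeral_eq_Suc algebra_simps)

text \<open>The rows lie in a lattice of index \<open>m\<close>: two of them have a determinant
  divisible by \<open>m\<close> and at most \<open>2 * K * m\<close>, so \<open>L\<close>, the
  determinant over \<open>m\<close>, takes boundedly many values. By Cramer's rule a row is
  determined by its determinants with the two independent rows of one fixed quadruple.\<close>

lemma card_bounded_quadruples:
  fixes Q :: "(int \<times> int \<times> int \<times> int) set" and m r :: int and K :: real
  assumes m: "m > 0"
    and Q: "\<And>u0 u1 v0 v1. (u0, u1, v0, v1) \<in> Q \<Longrightarrow> u0 * v1 \<noteq> u1 * v0 \<and>
      (\<forall>x\<in>{u0, u1, v0, v1}. x\<^sup>2 \<le> K * m) \<and> m dvd u0 + u1 * r \<and> m dvd v0 + v1 * r"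
  shows "finite Q \<and> card Q \<le> nat (2 * \<lfloor>2 * K\<rfloor> + 1) ^ 4"
proof (cases "Q = {}")
  case False
  then obtain p0 p1 q0 q1 where pq: "(p0, p1, q0, q1) \<in> Q" by (metis all_not_in_conv prod_cases4)
  define c where "c = \<lfloor>2 * K\<rfloor>"
  define L where "L a b x y = (a * y - b * x) div m" for a b x y :: int
  have L: "m * L a b x y = a * y - b * x \<and> L a b x y \<in> {-c..c}"
    if h: "a\<^sup>2 \<le> K * m" "b\<^sup>2 \<le> K * m" "x\<^sup>2 \<le> K * m" "y\<^sup>2 \<le> K * m"
      and d: "m dvd a + b * r" "m dvd x + y * r" for a b x y :: int
  proof -
    have "a * y - b * x = (a + b * r) * y - b * (x + y * r)" by (simp add: algebra_simps)
    also have "m dvd \<dots>" using d by (intro dvd_diff dvd_mult dvd_mult2) auto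
    finally have e: "m * L a b x y = a * y - b * x" by (simp add: L_def)
    have two: "\<bar>real_of_int s * real_of_int t\<bar> \<le> K * m" if "s\<^sup>2 \<le> K * m" "t\<^sup>2 \<le> K * m" for s t :: int
    proof -
      have "0 \<le> (\<bar>real_of_int s\<bar> - \<bar>real_of_int t\<bar>)\<^sup>2" by simp
      hence "2 * (\<bar>real_of_int s\<bar> * \<bar>real_of_int t\<bar>) \<le> (real_of_int s)\<^sup>2 + (real_of_int t)\<^sup>2"
        by (simp add: power2_diff)
      thus ?thesis using that by (simp add: abs_mult)
    qed
    have "\<bar>real_of_int (a * y - b * x)\<bar> \<le> 2 * K * m"
      using two[OF h(1,4)] two[OF h(2,3)] by simp
    hence "real_of_int m * \<bar>real_of_int (L a b x y)\<bar> \<le> real_of_int m * (2 * K)"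
      using m unfolding e[symmetric] by (simp add: abs_mult algebra_simps)
    hence "\<bar>real_of_int (L a b x y)\<bar> \<le> 2 * K" using m by simp
    hence "\<bar>L a b x y\<bar> \<le> c" unfolding c_def by (simp add: le_floor_iff)
    thus ?thesis using e by auto
  qed
  define \<phi> where "\<phi> = (\<lambda>(u0, u1, v0, v1). (L u0 u1 q0 q1, L p0 p1 u0 u1, L v0 v1 q0 q1, L p0 p1 v0 v1))"
  define B where "B = {-c..c} \<times> {-c..c} \<times> {-c..c} \<times> {-c..c}"
  have sub: "\<phi> ` Q \<subseteq> B"
  proof
    fix x assume "x \<in> \<phi> ` Q"
    then obtain u0 u1 v0 v1 where u: "(u0, u1, v0, v1) \<in> Q" "x = \<phi> (u0, u1, v0, v1)" by (metis imageE prod_cases4)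
    show "x \<in> B" unfolding u(2) \<phi>_def B_def prod.case
      by (intro SigmaI L[THEN conjunct2]) (use Q[OF u(1)] Q[OF pq] in simp_all)
  qed
  have solve: "u0 = s0 \<and> u1 = s1"
    if "u0 * q1 - u1 * q0 = s0 * q1 - s1 * q0" "p0 * u1 - p1 * u0 = p0 * s1 - p1 * s0" for u0 u1 s0 s1
  proof -
    have "(p0 * q1 - p1 * q0) * (u0 - s0) = p0 * ((u0 * q1 - u1 * q0) - (s0 * q1 - s1 * q0))
      + q0 * ((p0 * u1 - p1 * u0) - (p0 * s1 - p1 * s0))"
      "(p0 * q1 - p1 * q0) * (u1 - s1) = p1 * ((u0 * q1 - u1 * q0) - (s0 * q1 - s1 * q0))
      + q1 * ((p0 * u1 - p1 * u0) - (p0 * s1 - p1 * s0))"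
      by (simp_all add: algebra_simps)
    moreover have "p0 * q1 - p1 * q0 \<noteq> 0" using Q[OF pq] by simp
    ultimately show ?thesis unfolding that by simp
  qed
  have inj: "inj_on \<phi> Q"
  proof (rule inj_onI)
    fix x y assume xy: "x \<in> Q" "y \<in> Q" "\<phi> x = \<phi> y"
    obtain u0 u1 v0 v1 where x: "x = (u0, u1, v0, v1)" by (cases x)
    obtain s0 s1 t0 t1 where y: "y = (s0, s1, t0, t1)" by (cases y)
    note qx = Q[OF xy(1)[unfolded x]] and qy = Q[OF xy(2)[unfolded y]] and qp = Q[OF pq]
    have e: "L u0 u1 q0 q1 = L s0 s1 q0 q1" "L p0 p1 u0 u1 = L p0 p1 s0 s1"
      "L v0 v1 q0 q1 = L t0 t1 q0 q1" "L p0 p1 v0 v1 = L p0 p1 t0 t1"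
      using xy(3) unfolding x y \<phi>_def by auto
    have "u0 * q1 - u1 * q0 = s0 * q1 - s1 * q0" "p0 * u1 - p1 * u0 = p0 * s1 - p1 * s0"
      "v0 * q1 - v1 * q0 = t0 * q1 - t1 * q0" "p0 * v1 - p1 * v0 = p0 * t1 - p1 * t0"
      using L[of u0 u1 q0 q1] L[of s0 s1 q0 q1] L[of p0 p1 u0 u1] L[of p0 p1 s0 s1]
        L[of v0 v1 q0 q1] L[of t0 t1 q0 q1] L[of p0 p1 v0 v1] L[of p0 p1 t0 t1] qx qy qp e
      by simp_all
    thus "x = y" using solve x y by blast
  qed
  have "finite B" by (simp add: B_def)
  moreover have "card Q \<le> card B" by (rule card_inj_on_le[OF inj sub \<open>finite B\<close>])
  ultimately show ?thesis using inj_on_finite[OF inj sub] card_box4[of c] by (simp add: B_def c_def)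
qed simp

lemma fiber_card_le:
  fixes T :: "(int poly \<times> int \<times> int) set" and K :: real
  assumes n: "n \<ge> 4"
    and T: "\<And>f m r. (f, m, r) \<in> T \<Longrightarrow> double_root n f m r \<and> content f = 1 \<and> lead_coeff f > 0 \<and>
      prime m \<and> 0 \<le> r \<and> r < m"
    and bound: "\<And>f m r g m' r' y z j i. (f, m, r) \<in> T \<Longrightarrow> (g, m', r') \<in> T \<Longrightarrow>
      y \<in> croots f \<Longrightarrow> z \<in> croots g \<Longrightarrow> j < n \<Longrightarrow>
      n * (norm (y ^ j / ev (pderiv f) y) * norm (tail g (Suc i) z)) \<le> K"
    and lead: "\<And>f m r g m' r'. (f, m, r) \<in> T \<Longrightarrow> (g, m', r') \<in> T \<Longrightarrow> 2 * n * (K * m')\<^sup>2 < lead_coeff f"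
    and g: "(g, m', r') \<in> T"
  shows "card {(f, m, r) \<in> T. double_root.wring n f m r \<simeq> double_root.wring n g m' r'} \<le> fiber_bound K"
proof -
  define \<Phi> where "\<Phi> = {(f, m, r) \<in> T. double_root.wring n f m r \<simeq> double_root.wring n g m' r'}"
  define good1 where "good1 = (\<lambda>(u0 :: int, u1 :: int, v0 :: int, v1 :: int). \<forall>x\<in>{u0, u1, v0, v1}. \<bar>real_of_int x\<bar> \<le> K\<^sup>2)"
  define good2 where "good2 = (\<lambda>(u0 :: int, u1 :: int, v0 :: int, v1 :: int). u0 * v1 \<noteq> u1 * v0 \<and>
      (\<forall>x\<in>{u0, u1, v0, v1}. (real_of_int x)\<^sup>2 \<le> K * m') \<and> m' dvd u0 + u1 * r' \<and> m' dvd v0 + v1 * r')"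
  define mob where "mob = (\<lambda>(u0 :: int, u1 :: int, v0 :: int, v1 :: int) (z :: complex).
      (of_int u0 + of_int u1 * z) / (of_int v0 + of_int v1 * z))"
  define ok where "ok = (\<lambda>(f, m, r) q. (good1 q \<or> good2 q) \<and>
      (\<exists>\<tau> \<tau>'. iso_pair n f m r g m' r' \<tau> \<tau>' \<and> (\<forall>z\<in>croots g. \<tau> z = mob q z)))"
  note Tg = T[OF g]
  have ex: "\<exists>q. ok t q" if t: "t \<in> \<Phi>" for t
  proof -
    obtain f m r where tf: "t = (f, m, r)" "(f, m, r) \<in> T" "double_root.wring n f m r \<simeq> double_root.wring n g m' r'"
      using t unfolding \<Phi>_def by auto
    note Tf = T[OF tf(2)]
    obtain \<tau> \<tau>' where i: "iso_pair n f m r g m' r' \<tau> \<tau>'" using iso_pairI[OF _ _ tf(3)] Tf Tg by blast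
    interpret iso_pair n f m r g m' r' \<tau> \<tau>' by (rule i)
    interpret small_iso_pair n f m r g m' r' \<tau> \<tau>' K
      by unfold_locales (use n Tf Tg bound[OF tf(2) g] bound[OF g tf(2)] lead[OF tf(2) g] lead[OF g tf(2)] in auto)
    obtain u0 u1 v0 v1 :: int where c: "\<forall>z\<in>croots g. \<tau> z = (of_int u0 + of_int u1 * z) / (of_int v0 + of_int v1 * z)"
      "u0 * v1 \<noteq> u1 * v0" "(\<forall>x\<in>{u0, u1, v0, v1}. \<bar>x\<bar> \<le> K\<^sup>2) \<or>
        (\<forall>x\<in>{u0, u1, v0, v1}. x\<^sup>2 \<le> K * m') \<and> m' dvd u0 + u1 * r' \<and> m' dvd v0 + v1 * r'"
      using classification Tf Tg by blast
    have "ok t (u0, u1, v0, v1)" unfolding ok_def tf(1) prod.case mob_def good1_def good2_def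
      using i c by blast
    thus ?thesis by blast
  qed
  \<comment> \<open>A transformation determines the triple by \<open>same_moebius_imp_eq\<close>, so
    any choice of quadruples is injective.\<close>
  define q where "q t = (SOME q. ok t q)" for t
  have q: "ok t (q t)" if "t \<in> \<Phi>" for t unfolding q_def by (rule someI_ex[OF ex[OF that]])
  have inj: "inj_on q \<Phi>"
  proof (rule inj_onI)
    fix t1 t2 assume t: "t1 \<in> \<Phi>" "t2 \<in> \<Phi>" "q t1 = q t2"
    obtain f1 m1 r1 where t1: "t1 = (f1, m1, r1)" "(f1, m1, r1) \<in> T" using t(1) unfolding \<Phi>_def by auto
    obtain f2 m2 r2 where t2: "t2 = (f2, m2, r2)" "(f2, m2, r2) \<in> T" using t(2) unfolding \<Phi>_def by auto
    obtain \<tau>1 \<tau>1' where i1: "iso_pair n f1 m1 r1 g m' r' \<tau>1 \<tau>1'" "\<forall>z\<in>croots g. \<tau>1 z = mob (q t1) z"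
      using q[OF t(1)] unfolding ok_def t1(1) by auto
    obtain \<tau>2 \<tau>2' where i2: "iso_pair n f2 m2 r2 g m' r' \<tau>2 \<tau>2'" "\<forall>z\<in>croots g. \<tau>2 z = mob (q t1) z"
      using q[OF t(2)] unfolding ok_def t2(1) t(3)[unfolded t1(1) t2(1)] t1(1) by auto
    show "t1 = t2" unfolding t1(1) t2(1)
      by (rule same_moebius_imp_eq[OF i1(1) i2(1)]) (use n i1(2) i2(2) T[OF t1(2)] T[OF t2(2)] in auto)
  qed
  define a where "a = \<lfloor>K\<^sup>2\<rfloor>"
  define B where "B = {-a..a} \<times> {-a..a} \<times> {-a..a} \<times> {-a..a}"
  define Q where "Q = {x \<in> q ` \<Phi>. good2 x}"
  have "finite Q \<and> card Q \<le> nat (2 * \<lfloor>2 * K\<rfloor> + 1) ^ 4"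
  proof (rule card_bounded_quadruples[of m' Q K r'])
    show "m' > 0" using Tg by (simp add: prime_gt_0_int)
    fix u0 u1 v0 v1 assume "(u0, u1, v0, v1) \<in> Q"
    thus "u0 * v1 \<noteq> u1 * v0 \<and> (\<forall>x\<in>{u0, u1, v0, v1}. x\<^sup>2 \<le> K * m') \<and> m' dvd u0 + u1 * r' \<and> m' dvd v0 + v1 * r'"
      unfolding Q_def good2_def by simp
  qed
  moreover have B: "finite B" "card B = nat (2 * \<lfloor>K\<^sup>2\<rfloor> + 1) ^ 4"
    using card_box4[of a] by (simp_all add: B_def a_def)
  ultimately have BQ: "finite (B \<union> Q)" "card (B \<union> Q) \<le> fiber_bound K"
    using card_Un_le[of B Q] unfolding fiber_bound_def by auto
  have "q ` \<Phi> \<subseteq> B \<union> Q"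
  proof
    fix x assume x: "x \<in> q ` \<Phi>"
    then obtain t where "t \<in> \<Phi>" "x = q t" by blast
    hence "good1 x \<or> good2 x" using q[of t] unfolding ok_def by (auto split: prod.splits)
    thus "x \<in> B \<union> Q"
    proof
      assume "good1 x"
      moreover obtain u0 u1 v0 v1 where "x = (u0, u1, v0, v1)" by (cases x)
      moreover have "z \<in> {-a..a}" if "\<bar>z\<bar> \<le> K\<^sup>2" for z :: int
      proof -
        have "\<bar>z\<bar> \<le> a" using that by (simp add: a_def le_floor_iff)
        thus ?thesis by auto
      qed
      ultimately have "x \<in> B" unfolding good1_def B_def by simp
      thus ?thesis by simp
    qed (use x in \<open>simp add: Q_def\<close>)
  qed
  hence "card \<Phi> \<le> card (B \<union> Q)" by (rule card_inj_on_le[OF inj _ BQ(1)])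
  thus ?thesis using BQ(2) unfolding \<Phi>_def by simp
qed

section \<open>Many primes\<close>

text \<open>The Leibniz harmonic triangle: \<open>1 / (k * (n choose k))\<close> is an integral combination
  of \<open>1, 1/2, \<dots>, 1/n\<close>.\<close>

lemma mult_choose_dvd_Lcm:
  fixes n k :: nat
  assumes "1 \<le> k" "k \<le> n"
  shows "k * (n choose k) dvd Lcm {1..n}"
  using assms
proof (induction k arbitrary: n rule: nat_induct_at_least)
  case base
  thus ?case by (simp add: dvd_Lcm)
next
  case (Suc k)
  define L where "L = Lcm {1..n}"
  obtain n' where n': "n = Suc n'" using Suc.prems by (cases n) auto
  have k: "k \<le> n'" "k \<ge> 1" "k < n" using Suc n' by auto
  have "k * (n' choose k) dvd Lcm {1..n'}" using Suc.IH k by simp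
  also have "Lcm {1..n'} dvd L" unfolding L_def n' by (rule Lcm_subset) auto
  finally obtain a where a: "L = k * (n' choose k) * a" by (elim dvdE)
  have "k * (n choose k) dvd L" using Suc.IH[of n] Suc.prems unfolding L_def by simp
  then obtain b where b: "L = k * (n choose k) * b" by (elim dvdE)
  define x where "x = n' choose k"
  have x: "x > 0" using k by (simp add: x_def)
  have c1: "Suc k * (n choose Suc k) = n * x" unfolding n' x_def by (rule Suc_times_binomial)
  have c2: "(n - k) * (n choose k) = n * x" using binomial_absorb_comp[of n k] n' by (simp add: x_def)
  have "k * (x * a) = k * ((n choose k) * b)" using a b unfolding x_def by (metis mult.assoc)
  hence "x * a = (n choose k) * b" using k by simp
  hence "(n - k) * (x * a) = n * x * b" using c2 by (metis mult.assoc)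
  hence "x * ((n - k) * a) = x * (n * b)" by (simp add: algebra_simps)
  hence nb: "(n - k) * a = n * b" using x by simp
  have nka: "n * a = (n - k) * a + k * a" using k by (metis add_mult_distrib le_add_diff_inverse2 less_imp_le)
  \<comment> \<open>With \<open>a = L / (k * (n' choose k))\<close> and
    \<open>b = L / (k * (n choose k))\<close>, the recurrence of the triangle says that
    \<open>a - b\<close> is \<open>L / (Suc k * (n choose Suc k))\<close>.\<close>
  have "n * (a - b) = k * a" using nka nb by (simp add: diff_mult_distrib2)
  hence "Suc k * (n choose Suc k) * (a - b) = L" unfolding c1 a x_def[symmetric] by (metis mult.assoc mult.commute)
  thus ?case unfolding L_def by (metis dvd_triv_left)
qed

text \<open>The highest power of a prime that occurs divides some number in \<open>{1..N}\<close>,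
  so it is at most \<open>N\<close>.\<close>

lemma Lcm_le_power_primes:
  fixes N :: nat
  assumes "N \<ge> 1"
  shows "Lcm {1..N} \<le> N ^ card {p. prime p \<and> p \<le> N}"
proof -
  define P where "P = {p. prime p \<and> p \<le> N}"
  have fin: "finite P" unfolding P_def by (rule finite_subset[of _ "{..N}"]) auto
  define e where "e p = Max ((\<lambda>j. multiplicity p j) ` {1..N})" for p :: nat
  have le: "multiplicity p j \<le> e p" if "j \<in> {1..N}" for p j
    unfolding e_def by (rule Max_ge) (use that in auto)
  have pe: "p ^ e p \<le> N" if p: "p \<in> P" for p
  proof -
    have "e p \<in> (\<lambda>j. multiplicity p j) ` {1..N}" unfolding e_def by (rule Max_in) (use assms in auto)
    then obtain j where j: "j \<in> {1..N}" "e p = multiplicity p j" by blast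
    have "p ^ e p dvd j" unfolding j(2) by (rule multiplicity_dvd)
    thus ?thesis using j(1) by (auto dest: dvd_imp_le)
  qed
  have "Lcm {1..N} dvd (\<Prod>p\<in>P. p ^ e p)"
  proof (rule Lcm_least)
    fix j assume j: "j \<in> {1..N}"
    have sub: "prime_factors j \<subseteq> P"
    proof
      fix p assume "p \<in> prime_factors j"
      hence "prime p" "p dvd j" by (auto simp: in_prime_factors_iff)
      thus "p \<in> P" unfolding P_def using dvd_imp_le[of p j] j by auto
    qed
    have "j = (\<Prod>p\<in>prime_factors j. p ^ multiplicity p j)" using j by (simp add: prod_prime_factors)
    also have "\<dots> dvd (\<Prod>p\<in>P. p ^ e p)"
      by (rule prod_dvd_prod_subset2[OF fin sub]) (use le[OF j] in \<open>auto intro: le_imp_power_dvd\<close>)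
    finally show "j dvd (\<Prod>p\<in>P. p ^ e p)" .
  qed
  moreover have "(\<Prod>p\<in>P. p ^ e p) > 0" using fin by (auto simp: P_def prime_gt_0_nat intro!: prod_pos)
  ultimately have "Lcm {1..N} \<le> (\<Prod>p\<in>P. p ^ e p)" by (rule dvd_imp_le)
  also have "\<dots> \<le> (\<Prod>p\<in>P. N)" by (rule prod_mono) (use pe in auto)
  finally show ?thesis by (simp add: P_def)
qed

text \<open>Nair's argument: \<open>k * ((2 * k) choose k)\<close> divides the least common multiple
  and is at least \<open>4^k / 2\<close>, which for \<open>k = N div 2\<close> is at least
  \<open>2^(N - 2)\<close>.\<close>

lemma chebyshev_lower:
  fixes N :: nat
  assumes "N \<ge> 2"
  shows "(real N - 2) * ln 2 \<le> real (card {p. prime p \<and> p \<le> N}) * ln (real N)"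
proof -
  define k where "k = N div 2"
  have k: "1 \<le> k" "2 * k \<le> N" "N \<le> 2 * k + 1" using assms by (auto simp: k_def)
  define L where "L = Lcm {1..N}"
  have "L \<noteq> 0" by (simp add: L_def Lcm_0_iff)
  hence L0: "L > 0" by (simp only: neq0_conv)
  have "k * ((2 * k) choose k) dvd Lcm {1..2 * k}" by (rule mult_choose_dvd_Lcm) (use k in auto)
  also have "\<dots> dvd L" unfolding L_def by (rule Lcm_subset) (use k in auto)
  finally have "k * ((2 * k) choose k) \<le> L" using L0 by (rule dvd_imp_le)
  hence "real k * real ((2 * k) choose k) \<le> real L" by (metis of_nat_le_iff of_nat_mult)
  moreover have "real k * (4 ^ k / (2 * real k)) \<le> real k * real ((2 * k) choose k)"
    by (intro mult_left_mono central_binomial_lower_bound) (use k in auto)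
  moreover have "real k * (4 ^ k / (2 * real k)) = 4 ^ k / 2" using k by simp
  ultimately have "4 ^ k / 2 \<le> real L" by linarith
  also have "L \<le> N ^ card {p. prime p \<and> p \<le> N}" unfolding L_def by (rule Lcm_le_power_primes) (use assms in auto)
  finally have "4 ^ k / 2 \<le> real N ^ card {p. prime p \<and> p \<le> N}" by (simp add: of_nat_power)
  hence "ln (4 ^ k / 2) \<le> ln (real N ^ card {p. prime p \<and> p \<le> N})"
    using assms by (subst ln_le_cancel_iff) auto
  moreover have "ln (4 ^ k / 2 :: real) = (2 * real k - 1) * ln 2"
  proof -
    have "(4::real) ^ k = 2 ^ (2 * k)" by (simp add: power_mult)
    thus ?thesis by (simp add: ln_div ln_realpow algebra_simps)
  qed
  moreover have "(real N - 2) * ln 2 \<le> (2 * real k - 1) * ln 2"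
    using k by (intro mult_right_mono) auto
  moreover have "ln (real N ^ card {p. prime p \<and> p \<le> N}) = real (card {p. prime p \<and> p \<le> N}) * ln (real N)"
    using assms by (simp add: ln_realpow)
  ultimately show ?thesis by linarith
qed

lemma eventually_many_primes:
  fixes \<delta> :: real
  assumes "\<delta> > 0"
  shows "\<forall>\<^sub>F N in sequentially. real N powr (1 - \<delta>) \<le> real (card {p::nat. prime p \<and> p \<le> N})"
proof -
  have "\<forall>\<^sub>F N in sequentially. real N powr (1 - \<delta>) * ln (real N) \<le> (real N - 2) * ln 2"
    using assms by real_asymp
  moreover have "\<forall>\<^sub>F N::nat in sequentially. N \<ge> 2" by (rule eventually_ge_at_top)
  ultimately show ?thesis
  proof eventually_elim
    case (elim N)
    hence "real N powr (1 - \<delta>) * ln (real N) \<le> real (card {p. prime p \<and> p \<le> N}) * ln (real N)"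
      using chebyshev_lower[of N] by linarith
    thus ?case using elim(2) by simp
  qed
qed

section \<open>Forms in a box\<close>

lemma norm_le_of_eq_minus: "c = - (a + b) \<Longrightarrow> norm c \<le> norm a + norm b" for a b c :: complex
  using norm_triangle_ineq[of a b] by (simp only: norm_minus_cancel)

text \<open>Forms close to a multiple of \<open>a x^n + b\<close>: their roots are bounded and well separated.\<close>

definition in_box :: "nat \<Rightarrow> real \<Rightarrow> int poly \<Rightarrow> bool" where
  "in_box n H f \<longleftrightarrow> degree f = n \<and>
     H \<le> real_of_int (coeff f n) \<and> real_of_int (coeff f n) \<le> 2 * H \<and>
     H \<le> real_of_int (coeff f 0) \<and> real_of_int (coeff f 0) \<le> 2 * H \<and>
     (\<forall>i\<in>{1..<n}. 0 \<le> coeff f i \<and> real_of_int (coeff f i) \<le> H / (8 * n))"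

text \<open>This is \<open>n\<close> times \<open>3^n / (n * H / 2)\<close>, the bound for the dual
  basis, times \<open>2 * (n + 1) * 3^n * H\<close>, the bound for tails. It serves as the constant
  \<open>K\<close> above.\<close>

definition box_const :: "nat \<Rightarrow> nat" where
  "box_const n = 4 * (n + 1) * 9 ^ n"

context
  fixes n :: nat and H :: real and f :: "int poly"
  assumes box: "in_box n H f" and H: "H > 0" and n: "n \<ge> 2"
begin

lemma box_mid_sum:
  fixes \<rho> :: real
  assumes \<rho>: "\<rho> \<ge> 0" and R: "\<And>i. i \<in> {1..<n} \<Longrightarrow> \<rho> ^ i \<le> R"
  shows "(\<Sum>i\<in>{1..<n}. real_of_int (coeff f i) * \<rho> ^ i) \<le> H / 8 * R"
proof -
  have "(\<Sum>i\<in>{1..<n}. real_of_int (coeff f i) * \<rho> ^ i) \<le> (\<Sum>i\<in>{1..<n}. H / (8 * n) * R)"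
    using box H R \<rho> unfolding in_box_def by (intro sum_mono mult_mono) auto
  also have "\<dots> = (real n - 1) * (H / (8 * n) * R)" using n by (simp add: of_nat_diff)
  also have "\<dots> \<le> real n * (H / (8 * n) * R)"
  proof -
    have "R \<ge> 0" using R[of 1] n \<rho> by simp
    thus ?thesis using H by (intro mult_right_mono) auto
  qed
  also have "\<dots> = H / 8 * R" using n by simp
  finally show ?thesis .
qed

lemma ev_atMost: "degree p \<le> n \<Longrightarrow> ev p z = (\<Sum>i\<le>n. of_int (coeff p i) * z ^ i)"
  unfolding poly_altdef of_int_hom.coeff_map_poly_hom
  by (rule sum.mono_neutral_left) (auto simp: coeff_eq_0 not_le)

lemma ev_split:
  assumes "degree p \<le> n"
  shows "ev p z = of_int (coeff p 0) + (\<Sum>i\<in>{1..<n}. of_int (coeff p i) * z ^ i) + of_int (coeff p n) * z ^ n"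
proof -
  have "ev p z = (\<Sum>i\<le>n. of_int (coeff p i) * z ^ i)" by (rule ev_atMost[OF assms])
  also have "{..n} = insert 0 (insert n {1..<n})" using n by auto
  finally show ?thesis using n by (simp add: algebra_simps)
qed

lemma norm_mid_sum: "norm (\<Sum>i\<in>{1..<n}. of_int (coeff f i) * z ^ i :: complex)
    \<le> (\<Sum>i\<in>{1..<n}. real_of_int (coeff f i) * norm z ^ i)"
proof (rule sum_norm_le)
  fix i assume "i \<in> {1..<n}"
  thus "norm (of_int (coeff f i) * z ^ i :: complex) \<le> real_of_int (coeff f i) * norm z ^ i"
    using box unfolding in_box_def by (simp add: norm_mult norm_power)
qed

text \<open>Beyond radius 3 the leading term is at least
  \<open>3 * H * \<bar>z\<bar>^(n - 1)\<close>, the other terms together at most \<open>17/8\<close>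
  of \<open>H * \<bar>z\<bar>^(n - 1)\<close>.\<close>

lemma box_root_le:
  assumes z: "z \<in> croots f"
  shows "norm z \<le> 3"
proof (rule ccontr)
  assume "\<not> norm z \<le> 3"
  hence z3: "norm z > 3" by simp
  have d: "degree f \<le> n" using box by (simp add: in_box_def)
  have "of_int (coeff f 0) + (\<Sum>i\<in>{1..<n}. of_int (coeff f i) * z ^ i) + of_int (coeff f n) * z ^ n = 0"
    using ev_split[OF d, of z] z unfolding croots_def by simp
  hence "of_int (coeff f n) * z ^ n = - (of_int (coeff f 0) + (\<Sum>i\<in>{1..<n}. of_int (coeff f i) * z ^ i))"
    by (simp only: add_eq_0_iff)
  hence "norm (of_int (coeff f n) * z ^ n) \<le> norm (of_int (coeff f 0) :: complex)
      + norm (\<Sum>i\<in>{1..<n}. of_int (coeff f i) * z ^ i :: complex)"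
    by (rule norm_le_of_eq_minus)
  hence "real_of_int (coeff f n) * norm z ^ n \<le> real_of_int (coeff f 0)
      + norm (\<Sum>i\<in>{1..<n}. of_int (coeff f i) * z ^ i :: complex)"
    using box H unfolding in_box_def by (simp add: norm_mult norm_power)
  also have "\<dots> \<le> 2 * H + H / 8 * norm z ^ (n - 1)"
    using box unfolding in_box_def
    by (intro add_mono order_trans[OF norm_mid_sum] box_mid_sum power_increasing) (use z3 in auto)
  finally have 1: "real_of_int (coeff f n) * norm z ^ n \<le> 2 * H + H / 8 * norm z ^ (n - 1)" .
  have "norm z ^ n = norm z * norm z ^ (n - 1)" using n by (simp flip: power_Suc)
  have "H * (3 * norm z ^ (n - 1)) \<le> real_of_int (coeff f n) * norm z ^ n"
    unfolding \<open>norm z ^ n = _\<close> using box H z3 unfolding in_box_def by (intro mult_mono) auto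
  also note 1
  also have "2 * H + H / 8 * norm z ^ (n - 1) \<le> 2 * H * norm z ^ (n - 1) + H / 8 * norm z ^ (n - 1)"
    using H z3 by (simp add: one_le_power)
  also have "\<dots> = 17 / 8 * (H * norm z ^ (n - 1))" by (simp add: algebra_simps)
  also have "\<dots> < 3 * (H * norm z ^ (n - 1))"
    by (rule mult_strict_right_mono) (use H z3 in \<open>auto intro!: mult_pos_pos zero_less_power\<close>)
  finally show False by simp
qed

text \<open>Up to the middle terms, \<open>z * f'(z)\<close> is \<open>n\<close> times the leading
  term of \<open>f(z)\<close>. For \<open>\<bar>z\<bar> \<ge> 1\<close> this term dominates the
  middle ones; for \<open>\<bar>z\<bar> < 1\<close> the equation \<open>f(z) = 0\<close> makes it
  nearly as large as the constant term. Both bounds keep the factor \<open>H\<close> explicit, so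
  that it cancels against the tails.\<close>

lemma box_deriv_ge:
  assumes z: "z \<in> croots f"
  shows "norm (ev (pderiv f) z) \<ge> n * H / 2"
proof -
  define S where "S = (\<Sum>i\<in>{1..<n}. real_of_int (coeff f i) * norm z ^ i)"
  have d: "degree f \<le> n" using box by (simp add: in_box_def)
  have cf: "degree (pCons 0 (pderiv f)) \<le> n"
    using d n degree_pCons_le[of 0 "pderiv f"] degree_pderiv[of f] by linarith
  have "z * ev (pderiv f) z = (\<Sum>i\<in>{1..<n}. of_int (coeff (pCons 0 (pderiv f)) i) * z ^ i)
      + of_int (coeff (pCons 0 (pderiv f)) n) * z ^ n"
    using ev_split[OF cf, of z] by simp
  also have "(\<Sum>i\<in>{1..<n}. of_int (coeff (pCons 0 (pderiv f)) i) * z ^ i) =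
      (\<Sum>i\<in>{1..<n}. of_nat i * (of_int (coeff f i) * z ^ i))"
    by (rule sum.cong[OF refl]) (auto simp: coeff_pCons coeff_pderiv split: nat.split)
  also have "of_int (coeff (pCons 0 (pderiv f)) n) = (of_nat n * of_int (coeff f n) :: complex)"
    using n by (auto simp: coeff_pCons coeff_pderiv split: nat.split)
  finally have e: "z * ev (pderiv f) z = of_nat n * of_int (coeff f n) * z ^ n
      + (\<Sum>i\<in>{1..<n}. of_nat i * (of_int (coeff f i) * z ^ i))" by (simp add: add.commute)
  have "norm (\<Sum>i\<in>{1..<n}. of_nat i * (of_int (coeff f i) * z ^ i) :: complex) \<le>
      (\<Sum>i\<in>{1..<n}. real n * (real_of_int (coeff f i) * norm z ^ i))"
  proof (rule sum_norm_le)
    fix i assume "i \<in> {1..<n}"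
    thus "norm (of_nat i * (of_int (coeff f i) * z ^ i) :: complex) \<le> real n * (real_of_int (coeff f i) * norm z ^ i)"
      using box unfolding in_box_def by (simp add: norm_mult norm_power mult_right_mono)
  qed
  also have "\<dots> = n * S" by (simp add: S_def sum_distrib_left)
  finally have "norm (z * ev (pderiv f) z) \<ge> norm (of_nat n * of_int (coeff f n) * z ^ n) - n * S"
    unfolding e using norm_diff_ineq[of "of_nat n * of_int (coeff f n) * z ^ n"
        "\<Sum>i\<in>{1..<n}. of_nat i * (of_int (coeff f i) * z ^ i)"] by linarith
  moreover have "norm (of_nat n * of_int (coeff f n) * z ^ n) = n * (real_of_int (coeff f n) * norm z ^ n)"
    using box H unfolding in_box_def by (simp add: norm_mult norm_power)
  ultimately have g: "norm z * norm (ev (pderiv f) z) \<ge> n * (real_of_int (coeff f n) * norm z ^ n - S)"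
    unfolding right_diff_distrib norm_mult[of z] by linarith
  show ?thesis
  proof (cases "norm z \<ge> 1")
    case True
    have S: "S \<le> H / 8 * norm z ^ (n - 1)" unfolding S_def
      by (rule box_mid_sum) (use True in \<open>auto intro: power_increasing\<close>)
    have zn: "norm z ^ n = norm z * norm z ^ (n - 1)" using n by (simp flip: power_Suc)
    have "H / 8 * norm z ^ (n - 1) \<le> H / 8 * (norm z * norm z ^ (n - 1))"
      using True H by (intro mult_left_mono mult_right_mono[of 1 "norm z", simplified]) auto
    moreover have "H * (norm z * norm z ^ (n - 1)) \<le> real_of_int (coeff f n) * (norm z * norm z ^ (n - 1))"
      using box unfolding in_box_def by (intro mult_right_mono) auto
    ultimately have "real_of_int (coeff f n) * norm z ^ n - S \<ge> 7 / 8 * H * (norm z * norm z ^ (n - 1))"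
      using S unfolding zn by linarith
    moreover have "7 / 8 * H * (norm z * norm z ^ (n - 1)) \<ge> norm z * (H / 2)"
    proof -
      have "norm z * (H / 2) * 1 \<le> norm z * (7 / 8 * H) * norm z ^ (n - 1)"
        using True H by (intro mult_mono mult_left_mono) (auto simp: one_le_power)
      thus ?thesis by (simp only: mult_ac mult_1_right)
    qed
    ultimately have "norm z * (H / 2) \<le> real_of_int (coeff f n) * norm z ^ n - S" by linarith
    hence "n * (norm z * (H / 2)) \<le> n * (real_of_int (coeff f n) * norm z ^ n - S)"
      by (rule mult_left_mono) simp
    hence "norm z * (n * H / 2) \<le> norm z * norm (ev (pderiv f) z)" using g by (simp add: algebra_simps)
    thus ?thesis using True by (subst (asm) mult_le_cancel_left_pos) auto
  next
    case False
    hence S: "S \<le> H / 8 * 1" unfolding S_def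
      by (intro box_mid_sum) (auto intro: power_le_one)
    have "of_int (coeff f 0) + (\<Sum>i\<in>{1..<n}. of_int (coeff f i) * z ^ i) + of_int (coeff f n) * z ^ n = 0"
      using ev_split[OF d, of z] z unfolding croots_def by simp
    hence "(of_int (coeff f n) * z ^ n + (\<Sum>i\<in>{1..<n}. of_int (coeff f i) * z ^ i)) + of_int (coeff f 0) = 0"
      by (simp only: ac_simps)
    hence "of_int (coeff f 0) = - (of_int (coeff f n) * z ^ n + (\<Sum>i\<in>{1..<n}. of_int (coeff f i) * z ^ i))"
      by (simp only: add_eq_0_iff)
    hence "norm (of_int (coeff f 0) :: complex) \<le> norm (of_int (coeff f n) * z ^ n)
      + norm (\<Sum>i\<in>{1..<n}. of_int (coeff f i) * z ^ i :: complex)"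
      by (rule norm_le_of_eq_minus)
    hence "real_of_int (coeff f 0) \<le> real_of_int (coeff f n) * norm z ^ n + S"
      using norm_mid_sum[of z] box H unfolding in_box_def S_def by (simp add: norm_mult norm_power)
    hence "real_of_int (coeff f n) * norm z ^ n - S \<ge> H / 2" using S box H unfolding in_box_def by linarith
    hence "n * (H / 2) \<le> n * (real_of_int (coeff f n) * norm z ^ n - S)" by (intro mult_left_mono) auto
    also note g
    also have "norm z * norm (ev (pderiv f) z) \<le> 1 * norm (ev (pderiv f) z)"
      using False by (intro mult_right_mono) auto
    finally show ?thesis by simp
  qed
qed

lemma box_tail_le:
  assumes z: "z \<in> croots f"
  shows "norm (tail f j z) \<le> 2 * (n + 1) * 3 ^ n * H"
proof -
  have z3: "norm z \<le> 3" by (rule box_root_le[OF z])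
  have c: "\<bar>real_of_int (coeff f i)\<bar> \<le> 2 * H" for i
  proof -
    consider "i = 0" | "i \<in> {1..<n}" | "i = n" | "i > n" by fastforce
    thus ?thesis
    proof cases
      case 2
      hence "0 \<le> coeff f i" "real_of_int (coeff f i) \<le> H / (8 * n)" using box unfolding in_box_def by auto
      moreover have "H / (8 * n) \<le> H / 1" using H n by (intro divide_left_mono) auto
      ultimately show ?thesis using H by simp
    next
      case 4 thus ?thesis using box H unfolding in_box_def by (simp add: coeff_eq_0)
    qed (use box H in \<open>auto simp: in_box_def\<close>)
  qed
  have "degree (poly_shift j f) \<le> n"
    using box unfolding in_box_def by (intro degree_le) (auto simp: coeff_poly_shift coeff_eq_0)
  hence "tail f j z = (\<Sum>i\<le>n. of_int (coeff f (i + j)) * z ^ i)"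
    unfolding tail_def by (simp add: ev_atMost coeff_poly_shift)
  also have "norm \<dots> \<le> (\<Sum>i\<le>n. 2 * H * 3 ^ n)"
  proof (rule sum_norm_le)
    fix i assume i: "i \<in> {..n}"
    have "norm z ^ i \<le> 3 ^ i" using z3 by (intro power_mono) auto
    also have "\<dots> \<le> 3 ^ n" using i by (intro power_increasing) auto
    finally show "norm (of_int (coeff f (i + j)) * z ^ i) \<le> 2 * H * 3 ^ n"
      using c[of "i + j"] H by (simp add: norm_mult norm_power mult_mono)
  qed
  finally show ?thesis by (simp add: algebra_simps)
qed

end

lemma box_pair_bound:
  assumes f: "in_box n H f" and g: "in_box n H g" and H: "H > 0" and n: "n \<ge> 2"
    and y: "y \<in> croots f" and z: "z \<in> croots g" and j: "j < n"
  shows "n * (norm (y ^ j / ev (pderiv f) y) * norm (tail g (Suc i) z)) \<le> box_const n"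
proof -
  have d: "n * H / 2 \<le> norm (ev (pderiv f) y)" by (rule box_deriv_ge[OF f H n y])
  have "norm y ^ j \<le> 3 ^ j" using box_root_le[OF f H n y] by (intro power_mono) auto
  also have "\<dots> \<le> 3 ^ n" using j by (intro power_increasing) auto
  finally have "norm (y ^ j / ev (pderiv f) y) \<le> 3 ^ n / (n * H / 2)"
    unfolding norm_divide norm_power by (intro frac_le) (use d H n in auto)
  hence "n * (norm (y ^ j / ev (pderiv f) y) * norm (tail g (Suc i) z))
    \<le> n * (3 ^ n / (n * H / 2) * (2 * (n + 1) * 3 ^ n * H))"
    using box_tail_le[OF g H n z] H by (intro mult_left_mono mult_mono) auto
  also have "\<dots> = 4 * (real n + 1) * (3 ^ n * 3 ^ n)" using H n by (simp add: field_simps)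
  finally have "n * (norm (y ^ j / ev (pderiv f) y) * norm (tail g (Suc i) z)) \<le> 4 * (real n + 1) * (3 ^ n * 3 ^ n)" .
  moreover have "(3::real) ^ n * 3 ^ n = 9 ^ n" by (simp flip: power_mult_distrib)
  moreover have "real (box_const n) = 4 * (real n + 1) * 9 ^ n" by (simp add: box_const_def)
  ultimately show ?thesis by (simp only:)
qed

lemma box_simple_roots:
  assumes "in_box n H f" "H > 0" "n \<ge> 2"
  shows "simple_roots n f"
proof
  show "degree f = n" using assms(1) by (simp add: in_box_def)
  show "ev (pderiv f) z \<noteq> 0" if "z \<in> croots f" for z
  proof -
    have "0 < n * H / 2" using assms(2,3) by simp
    thus ?thesis using box_deriv_ge[OF assms that] by auto
  qed
qed (rule assms(3))

section \<open>A family of forms\<close>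

text \<open>The bound \<open>H / (8 * n)\<close> of \<open>in_box\<close> becomes
  \<open>(4 + K^2) * M^2\<close> with \<open>K = box_const n\<close>. The 4 makes room for middle
  coefficients up to \<open>4 * M^2\<close>; the \<open>K^2\<close> makes leading coefficients
  exceed \<open>2 * n * (K * m)^2\<close>, as \<open>small_iso_pair\<close> requires.\<close>

definition height :: "nat \<Rightarrow> nat \<Rightarrow> int" where
  "height n M = 8 * int n * (4 + (int (box_const n))\<^sup>2) * (int M)\<^sup>2"

text \<open>For even \<open>H\<close> the value is odd, as Eisenstein's criterion at 2 requires.
  Adding 2 avoids multiples of \<open>q\<close>, and the steps of 4 keep \<open>b\<close>
  recoverable in spite of this shift.\<close>

definition lead_par :: "int \<Rightarrow> nat \<Rightarrow> nat \<Rightarrow> int" where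
  "lead_par H q b = (let a = H + 1 + 4 * int b in if int q dvd a then a + 2 else a)"

text \<open>Coefficients below the top are even for Eisenstein's criterion. The coefficient
  \<open>2 * q\<close> is coprime to the leading one and so forces content 1; taking
  \<open>q\<close> prime costs only a small power of \<open>M\<close>.\<close>

definition high_part :: "nat \<Rightarrow> int \<Rightarrow> nat \<Rightarrow> nat \<Rightarrow> (nat \<Rightarrow> nat) \<Rightarrow> int poly" where
  "high_part n H q b \<beta> = monom (lead_par H q b) n + monom (2 * int q) (n - 1) +
     (\<Sum>i\<in>{2..<n - 1}. monom (2 * int (\<beta> i)) i)"

text \<open>The coefficients of \<open>x\<close> and \<open>1\<close> are determined by the conditions modulo \<open>m\<close> and \<open>m\<^sup>2\<close>
  together with those modulo 2 and 4.\<close>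

definition lin_res :: "int \<Rightarrow> int poly \<Rightarrow> int \<Rightarrow> int" where
  "lin_res m h r = (let s = (- poly (pderiv h) r) mod m in if even s then s else s + m)"

definition const_res :: "int \<Rightarrow> int \<Rightarrow> int poly \<Rightarrow> int \<Rightarrow> int" where
  "const_res H m h r = (let s = (- poly h r - H) mod m\<^sup>2 in s + m\<^sup>2 * ((2 - H - s) mod 4))"

text \<open>The derivative does not see the constant term, so the linear coefficient is adjusted
  first. It stays free in steps of \<open>2 * m\<close>, counted by \<open>k\<close>, while the
  constant term is then fixed completely.\<close>

definition member :: "nat \<Rightarrow> int \<Rightarrow> int \<Rightarrow> int \<Rightarrow> nat \<Rightarrow> nat \<Rightarrow> (nat \<Rightarrow> nat) \<Rightarrow> nat \<Rightarrow> int poly" where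
  "member n H m r q b \<beta> k = (let h = high_part n H q b \<beta>;
     h1 = h + monom (lin_res m h r + 2 * m * int k) 1 in h1 + monom (H + const_res H m h1 r) 0)"

lemma coeff_high_part:
  assumes n: "n \<ge> 4"
  shows "coeff (high_part n H q b \<beta>) i = (if i = n then lead_par H q b else if i = n - 1 then 2 * int q
    else if i \<in> {2..<n - 1} then 2 * int (\<beta> i) else 0)"
proof -
  have "(\<Sum>j\<in>{2..<n - 1}. coeff (monom (2 * int (\<beta> j)) j) i) = (if i \<in> {2..<n - 1} then 2 * int (\<beta> i) else 0)"
    by simp
  thus ?thesis using n by (auto simp: high_part_def coeff_sum)
qed

lemma lin_res:
  assumes "odd m" "m > 0"
  shows "even (lin_res m h r)" "0 \<le> lin_res m h r" "lin_res m h r < 2 * m"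
    "m dvd poly (pderiv h) r + lin_res m h r"
proof -
  define s where "s = (- poly (pderiv h) r) mod m"
  have s: "0 \<le> s" "s < m" using assms by (simp_all add: s_def)
  have l: "lin_res m h r = (if even s then s else s + m)" by (simp add: lin_res_def s_def Let_def)
  show "even (lin_res m h r)" "0 \<le> lin_res m h r" "lin_res m h r < 2 * m"
    unfolding l using s assms by auto
  have "m dvd poly (pderiv h) r + s" unfolding s_def
    by (metis add.commute add_diff_cancel_left' diff_0 dvd_eq_mod_eq_0 mod_0 mod_add_left_eq uminus_add_conv_diff)
  thus "m dvd poly (pderiv h) r + lin_res m h r" unfolding l by (simp flip: add.assoc)
qed

lemma const_res:
  assumes "odd m" "even H"
  shows "0 \<le> const_res H m h r" "const_res H m h r < 4 * m\<^sup>2"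
    "m\<^sup>2 dvd poly h r + (H + const_res H m h r)" "(H + const_res H m h r) mod 4 = 2"
proof -
  have m2: "m\<^sup>2 > 0" using assms by auto
  define s where "s = (- poly h r - H) mod m\<^sup>2"
  define j where "j = (2 - H - s) mod 4"
  have s: "0 \<le> s" "s < m\<^sup>2" using m2 by (simp_all add: s_def)
  have j: "0 \<le> j" "j \<le> 3" using pos_mod_bound[of 4 "2 - H - s"] by (simp_all add: j_def)
  have c: "const_res H m h r = s + m\<^sup>2 * j" by (simp add: const_res_def s_def j_def Let_def)
  show "0 \<le> const_res H m h r" unfolding c using s j m2 by simp
  have "m\<^sup>2 * j \<le> m\<^sup>2 * 3" using j m2 by (intro mult_left_mono) auto
  thus "const_res H m h r < 4 * m\<^sup>2" unfolding c using s by linarith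
  obtain t where t: "- poly h r - H = m\<^sup>2 * t + s"
    using mult_div_mod_eq[of "m\<^sup>2" "- poly h r - H"] unfolding s_def by metis
  have "poly h r + (H + const_res H m h r) = m\<^sup>2 * (j - t)" unfolding c using t by (simp add: algebra_simps)
  thus "m\<^sup>2 dvd poly h r + (H + const_res H m h r)" by simp
  obtain a where a: "m = 2 * a + 1" using assms(1) by (elim oddE)
  \<comment> \<open>An odd square is 1 modulo 4, so adding \<open>m^2 * j\<close> shifts the residue
    modulo 4 by \<open>j\<close> and keeps the residue modulo \<open>m^2\<close>.\<close>
  have "m\<^sup>2 = 4 * (a * a + a) + 1" unfolding a by (simp add: power2_eq_square algebra_simps)
  moreover obtain t' where "2 - H - s = 4 * t' + j"
    using mult_div_mod_eq[of 4 "2 - H - s"] unfolding j_def by metis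
  ultimately have "H + const_res H m h r = 4 * ((a * a + a) * j - t') + 2"
    unfolding c by (simp add: algebra_simps)
  moreover have "(4 * x + 2) mod 4 = 2" for x :: int by simp
  ultimately show "(H + const_res H m h r) mod 4 = 2" by (simp only:)
qed

lemma lead_par:
  assumes "even H" "prime q"
  shows "odd (lead_par H q b)" "\<not> int q dvd lead_par H q b" "H < lead_par H q b"
    "lead_par H q b \<le> H + 3 + 4 * int b" "int b = (lead_par H q b - H - 1) div 4"
proof -
  define a where "a = H + 1 + 4 * int b"
  have o: "odd a" using assms by (simp add: a_def)
  have l: "lead_par H q b = (if int q dvd a then a + 2 else a)" by (simp add: lead_par_def a_def Let_def)
  show "odd (lead_par H q b)" "H < lead_par H q b" "lead_par H q b \<le> H + 3 + 4 * int b"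
    "int b = (lead_par H q b - H - 1) div 4"
    unfolding l using o by (auto simp: a_def)
  show "\<not> int q dvd lead_par H q b"
  proof (cases "int q dvd a")
    case True
    have "\<not> int q dvd a + 2"
    proof
      assume "int q dvd a + 2"
      hence "int q dvd 2" using True by (simp add: dvd_add_right_iff)
      hence "q dvd 2" by (metis int_dvd_int_iff of_nat_numeral)
      hence "q = 2" using assms(2) by (metis primes_dvd_imp_eq two_is_prime_nat)
      thus False using True o by simp
    qed
    thus ?thesis using True l by simp
  qed (simp add: l)
qed

context
  fixes n M :: nat and m r :: int and q b k :: nat and \<beta> :: "nat \<Rightarrow> nat"
  assumes n: "n \<ge> 4" and m: "odd m" "m > 0" "m \<le> int M" and r: "0 \<le> r" "r < m"
    and q: "prime q" "q \<le> M\<^sup>2" and b: "b < M\<^sup>2" and \<beta>: "\<And>i. i \<in> {2..<n - 1} \<Longrightarrow> \<beta> i < M\<^sup>2" and k: "k < M"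
begin

abbreviation "mem \<equiv> member n (height n M) m r q b \<beta> k"
abbreviation "hp \<equiv> high_part n (height n M) q b \<beta>"
abbreviation "hp1 \<equiv> hp + monom (lin_res m hp r + 2 * m * int k) 1"

lemma height_even: "even (height n M)" by (simp add: height_def)

lemma height_ge: "32 * (int M)\<^sup>2 \<le> height n M" "(int M)\<^sup>2 > 0"
  "real_of_int (height n M) / real (8 * n) = (4 + (real (box_const n))\<^sup>2) * (real M)\<^sup>2"
proof -
  have "8 * 1 * (4 + 0) * (int M)\<^sup>2 \<le> 8 * int n * (4 + (int (box_const n))\<^sup>2) * (int M)\<^sup>2"
    using n by (intro mult_right_mono mult_mono add_mono) auto
  thus "32 * (int M)\<^sup>2 \<le> height n M" by (simp add: height_def)
  show "(int M)\<^sup>2 > 0" using k by simp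
  show "real_of_int (height n M) / real (8 * n) = (4 + (real (box_const n))\<^sup>2) * (real M)\<^sup>2"
    using n by (simp add: height_def field_simps)
qed

lemma height_pos: "height n M > 0" using height_ge(1,2) by linarith

lemma n1: "n - Suc 0 \<noteq> Suc 0" "n - Suc 0 \<noteq> n" "n - Suc 0 \<noteq> 0" "2 \<le> n - Suc 0" using n by auto

lemmas coeff_hp = coeff_high_part[OF n]

lemma coeff_mem: "coeff mem i = (if i = 0 then height n M + const_res (height n M) m hp1 r
    else if i = 1 then lin_res m hp r + 2 * m * int k else coeff hp i)"
  unfolding member_def Let_def using n by (auto simp: coeff_hp)

lemma degree_mem: "degree mem = n"
proof (rule antisym)
  show "degree mem \<le> n" by (rule degree_le) (use n in \<open>auto simp: coeff_mem coeff_hp\<close>)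
  show "n \<le> degree mem"
    by (rule le_degree) (use n lead_par(3)[OF height_even q(1), of b] height_pos in \<open>auto simp: coeff_mem coeff_hp\<close>)
qed

lemma lead_mem: "coeff mem n = lead_par (height n M) q b"
  using n by (simp add: coeff_mem coeff_hp)

lemma mem_even: "i < n \<Longrightarrow> even (coeff mem i)"
proof -
  have even4: "x mod 4 = 2 \<Longrightarrow> even x" for x :: int by presburger
  have "even (height n M + const_res (height n M) m hp1 r)"
    using even4[OF const_res(4)[OF m(1) height_even, of hp1 r]] .
  thus "i < n \<Longrightarrow> even (coeff mem i)" using lin_res(1)[OF m(1,2), of hp r] by (auto simp: coeff_mem coeff_hp)
qed

lemma mem_const: "\<not> 4 dvd coeff mem 0"
  using const_res(4)[OF m(1) height_even, of hp1 r] by (auto simp: coeff_mem)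

lemma mem_content: "content mem = 1"
proof -
  have "content mem dvd coeff mem n" "content mem dvd coeff mem (n - 1)" by (rule content_dvd_coeff)+
  hence d: "content mem dvd lead_par (height n M) q b" "content mem dvd 2 * int q"
    using n n1 by (simp_all add: coeff_mem coeff_hp)
  have "coprime (int q) (lead_par (height n M) q b)"
    by (rule prime_imp_coprime) (use q(1) lead_par(2)[OF height_even q(1), of b] in auto)
  moreover have "coprime 2 (lead_par (height n M) q b)"
    using lead_par(1)[OF height_even q(1), of b] by simp
  ultimately have "coprime (2 * int q) (lead_par (height n M) q b)" by simp
  hence "is_unit (content mem)" using d by (metis coprime_common_divisor)
  thus ?thesis by (metis is_unit_normalize normalize_content)
qed

lemma mem_box: "in_box n (height n M) mem"
  unfolding in_box_def
proof (intro conjI ballI)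
  have M1: "int M \<le> (int M)\<^sup>2" by (cases "M = 0") (auto simp: power2_eq_square)
  have mM: "m\<^sup>2 \<le> (int M)\<^sup>2" using m by (intro power_mono) auto
  note c = const_res[OF m(1) height_even, of hp1 r] and l = lin_res[OF m(1,2), of hp r]
    and a = lead_par[OF height_even q(1), of b]
  have b': "int b < (int M)\<^sup>2" using b by (metis of_nat_less_iff of_nat_power)
  show "degree mem = n" by (rule degree_mem)
  show "real_of_int (height n M) \<le> real_of_int (coeff mem n)" unfolding lead_mem using a by simp
  have "lead_par (height n M) q b \<le> 2 * height n M" using a(4) b' height_ge(1,2) by linarith
  thus "real_of_int (coeff mem n) \<le> 2 * real_of_int (height n M)" unfolding lead_mem by linarith
  show "real_of_int (height n M) \<le> real_of_int (coeff mem 0)" using c(1) by (simp add: coeff_mem)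
  have "height n M + const_res (height n M) m hp1 r \<le> 2 * height n M" using c(2) mM height_ge(1,2) by linarith
  thus "real_of_int (coeff mem 0) \<le> 2 * real_of_int (height n M)" by (simp add: coeff_mem)
  fix i assume i: "i \<in> {1..<n}"
  have bnd: "0 \<le> coeff mem i \<and> coeff mem i \<le> 4 * (int M)\<^sup>2"
  proof -
    consider "i = 1" | "i = n - 1" "i \<noteq> 1" | "i \<in> {2..<n - 1}" using i n by fastforce
    thus ?thesis
    proof cases
      case 1
      have "2 * m * int k \<le> 2 * int M * (int M - 1)"
        using m k by (intro mult_mono) auto
      hence "lin_res m hp r + 2 * m * int k \<le> 2 * (int M)\<^sup>2"
        using l(3) m(3) by (simp add: power2_eq_square algebra_simps)
      moreover have "0 \<le> 2 * m * int k" using m(2) by simp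
      ultimately have "0 \<le> lin_res m hp r + 2 * m * int k \<and> lin_res m hp r + 2 * m * int k \<le> 4 * (int M)\<^sup>2"
        using l(2) height_ge(2) by linarith
      thus ?thesis using 1 coeff_mem[of 1] by simp
    next
      case 2
      have "int q \<le> (int M)\<^sup>2" using q(2) by (metis of_nat_le_iff of_nat_power)
      moreover have "coeff mem i = 2 * int q" using 2 n1 by (simp add: coeff_mem coeff_hp)
      ultimately show ?thesis using height_ge(2) by linarith
    next
      case 3
      have "int (\<beta> i) < (int M)\<^sup>2" using \<beta>[OF 3] by (metis of_nat_less_iff of_nat_power)
      moreover have "i \<noteq> n" "i \<noteq> n - Suc 0" using 3 by auto
      hence "coeff mem i = 2 * int (\<beta> i)" using 3 by (simp add: coeff_mem coeff_hp)
      ultimately show ?thesis using height_ge(2) by linarith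
    qed
  qed
  thus "0 \<le> coeff mem i" by simp
  have "real_of_int (coeff mem i) \<le> real_of_int (4 * (int M)\<^sup>2)"
    using bnd by (simp only: of_int_le_iff)
  also have "\<dots> = 4 * (real M)\<^sup>2" by simp
  also have "\<dots> \<le> (4 + (real (box_const n))\<^sup>2) * (real M)\<^sup>2" by (intro mult_right_mono) auto
  finally show "real_of_int (coeff mem i) \<le> real_of_int (height n M) / real (8 * n)" by (simp only: height_ge(3))
qed

lemma mem_double_root: "double_root_domain n mem m r"
proof -
  have H: "real_of_int (height n M) > 0" using height_ge(1,2) by linarith
  interpret simple_roots n mem by (rule box_simple_roots[OF mem_box H]) (use n in simp)
  have d1: "m dvd poly (pderiv mem) r"
  proof -
    have "poly (pderiv mem) r = (poly (pderiv hp) r + lin_res m hp r) + m * (2 * int k)"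
      unfolding member_def Let_def by (simp add: pderiv_add pderiv_monom poly_monom algebra_simps)
    also have "m dvd \<dots>" by (rule dvd_add[OF lin_res(4)[OF m(1,2)]]) simp
    finally show ?thesis .
  qed
  have d2: "m\<^sup>2 dvd poly mem r"
    using const_res(3)[OF m(1) height_even, of hp1 r] unfolding member_def Let_def
    by (simp add: poly_monom)
  show ?thesis
  proof
    show "m > 0" "m dvd poly (pderiv mem) r" "m\<^sup>2 dvd poly mem r" by fact+
    fix p z assume p: "degree p < n" "z \<in> croots mem" "ev p z = 0"
    show "p = 0"
    proof (rule eisenstein_two_root[of mem z])
      show "odd (lead_coeff mem)" using lead_par(1)[OF height_even q(1), of b] by (simp add: degree_mem lead_mem)
      show "\<And>i. i < degree mem \<Longrightarrow> even (coeff mem i)" using mem_even degree_mem by simp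
      show "\<not> 4 dvd coeff mem 0" by (rule mem_const)
    qed (use p degree_mem in \<open>auto simp: croots_def\<close>)
  qed
qed

end

lemma member_inj:
  assumes n: "n \<ge> 4" and m: "odd m" "m > 0" and q: "prime q" "prime q'"
    and \<beta>: "\<beta> \<in> {2..<n - 1} \<rightarrow>\<^sub>E UNIV" "\<beta>' \<in> {2..<n - 1} \<rightarrow>\<^sub>E UNIV"
    and eq: "member n (height n M) m r q b \<beta> k = member n (height n M) m r q' b' \<beta>' k'"
  shows "q = q' \<and> b = b' \<and> \<beta> = \<beta>' \<and> k = k'"
proof -
  have He: "even (height n M)" by (simp add: height_def)
  note ch = coeff_high_part[OF n]
  have cm: "i \<ge> 2 \<Longrightarrow> coeff (member n (height n M) m r q b \<beta> k) i = coeff (high_part n (height n M) q b \<beta>) i"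
    "coeff (member n (height n M) m r q b \<beta> k) 1 = lin_res m (high_part n (height n M) q b \<beta>) r + 2 * m * int k"
    for i q b \<beta> k
    unfolding member_def Let_def using n by (auto simp: ch)
  have eqc: "coeff (high_part n (height n M) q b \<beta>) i = coeff (high_part n (height n M) q' b' \<beta>') i" if "i \<ge> 2" for i
    using cm(1)[OF that] eq by metis
  have "n - Suc 0 \<noteq> n" "2 \<le> n - Suc 0" using n by auto
  hence qq: "q = q'" using eqc[of "n - 1"] by (simp add: ch)
  have "lead_par (height n M) q b = lead_par (height n M) q b'" using eqc[of n] n qq by (simp add: ch)
  hence bb: "b = b'" using lead_par(5)[OF He q(1), of b] lead_par(5)[OF He q(1), of b'] by simp
  have bet: "\<beta> = \<beta>'"
  proof (rule PiE_ext[OF \<beta>])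
    fix i assume i: "i \<in> {2..<n - 1}"
    hence "i \<noteq> n" "i \<noteq> n - Suc 0" by auto
    thus "\<beta> i = \<beta>' i" using eqc[of i] i by (simp add: ch)
  qed
  have "lin_res m (high_part n (height n M) q b \<beta>) r + 2 * m * int k =
      lin_res m (high_part n (height n M) q b \<beta>) r + 2 * m * int k'"
    using cm(2)[of q b \<beta> k] cm(2)[of q' b' \<beta>' k'] eq qq bb bet by metis
  hence "k = k'" using m by simp
  thus ?thesis using qq bb bet by blast
qed

section \<open>Counting\<close>

lemma num_domain_classes_ge:
  fixes N :: "'a \<Rightarrow> nat ring"
  assumes fin: "finite T" and dom: "\<And>t. t \<in> T \<Longrightarrow> N t \<in> domains_of_rank n X"
    and fib: "\<And>t'. t' \<in> T \<Longrightarrow> card {t \<in> T. N t \<simeq> N t'} \<le> C" and C: "C > 0"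
  shows "ennreal (real (card T) / real C) \<le> num_domain_classes n X"
proof -
  define D where "D = domains_of_rank n X"
  define R where "R = {(R, S). R \<in> D \<and> S \<in> D \<and> R \<simeq> S}"
  define cls where "cls t = R `` {N t}" for t
  have sub: "cls ` T \<subseteq> D // R" unfolding cls_def using dom by (auto intro: quotientI simp: D_def)
  have eq: "N t \<simeq> N t'" if t: "t \<in> T" "t' \<in> T" "cls t = cls t'" for t t'
  proof -
    have "N t' \<in> cls t'" using dom[OF t(2)] unfolding cls_def R_def D_def by (simp add: ring_iso_refl)
    thus ?thesis using t(3) unfolding cls_def R_def by auto
  qed
  have "card T = (\<Sum>c\<in>cls ` T. card {t \<in> T. cls t = c})"
    using sum.image_gen[OF fin, of "\<lambda>_. 1 :: nat" cls] by simp
  also have "\<dots> \<le> (\<Sum>c\<in>cls ` T. C)"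
  proof (rule sum_mono)
    fix c assume "c \<in> cls ` T"
    then obtain t' where t': "t' \<in> T" "c = cls t'" by blast
    have "card {t \<in> T. cls t = c} \<le> card {t \<in> T. N t \<simeq> N t'}"
      by (rule card_mono) (use fin eq t' in auto)
    thus "card {t \<in> T. cls t = c} \<le> C" using fib[OF t'(1)] by simp
  qed
  finally have "real (card T) / real C \<le> real (card (cls ` T))"
    using C by (simp add: divide_le_eq flip: of_nat_mult)
  hence "ennreal (real (card T) / real C) \<le> ennreal (real (card (cls ` T)))" by (rule ennreal_leI)
  also have "\<dots> = emeasure (count_space UNIV) (cls ` T)" using fin by (simp add: emeasure_count_space ennreal_of_nat_eq_real_of_nat)
  also have "\<dots> \<le> emeasure (count_space UNIV) (D // R)" by (rule emeasure_mono[OF sub]) simp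
  finally show ?thesis unfolding num_domain_classes_def D_def R_def .
qed

text \<open>A lower bound \<open>lo\<close> close to \<open>M\<close> ensures that the index
  \<open>m\<close> lowers the discriminant by nearly \<open>M^2\<close>. The prime 2 is reserved for
  Eisenstein's criterion.\<close>

definition primes_between :: "real \<Rightarrow> nat \<Rightarrow> nat set" where
  "primes_between lo M = {m. prime m \<and> odd m \<and> lo < real m \<and> m \<le> M}"

text \<open>Up to small powers of \<open>M\<close> there are \<open>M^2\<close> pairs
  \<open>(m, r)\<close>, \<open>M^2\<close> choices for each of \<open>q\<close>, \<open>b\<close>
  and the \<open>n - 3\<close> values of \<open>\<beta>\<close>, and \<open>M\<close> for
  \<open>k\<close>, which makes \<open>M^(2 n + 1)\<close>.\<close>

definition params :: "nat \<Rightarrow> nat \<Rightarrow> real \<Rightarrow> ((nat \<times> nat) \<times> nat \<times> nat \<times> (nat \<Rightarrow> nat) \<times> nat) set" where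
  "params n M lo = (SIGMA m : primes_between lo M. {..<m}) \<times> {q. prime q \<and> q \<le> M\<^sup>2} \<times> {..<M\<^sup>2} \<times>
     ({2..<n - 1} \<rightarrow>\<^sub>E {..<M\<^sup>2}) \<times> {..<M}"

definition triple :: "nat \<Rightarrow> nat \<Rightarrow> (nat \<times> nat) \<times> nat \<times> nat \<times> (nat \<Rightarrow> nat) \<times> nat \<Rightarrow> int poly \<times> int \<times> int" where
  "triple n M = (\<lambda>((m, r), q, b, \<beta>, k). (member n (height n M) (int m) (int r) q b \<beta> k, int m, int r))"

lemma finite_primes_between: "finite (primes_between lo M)"
  unfolding primes_between_def by (rule finite_subset[of _ "{..M}"]) auto

lemma finite_primes_le: "finite {q::nat. prime q \<and> q \<le> N}"
  by (rule finite_subset[of _ "{..N}"]) auto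

lemma finite_params: "finite (params n M lo)"
  unfolding params_def
  by (intro finite_cartesian_product finite_SigmaI finite_primes_between finite_primes_le finite_PiE) auto

lemma card_params:
  "card (params n M lo) = (\<Sum>m\<in>primes_between lo M. m) * card {q. prime q \<and> q \<le> M\<^sup>2} * M\<^sup>2 * (M\<^sup>2) ^ (n - 3) * M"
proof -
  have "card ({2..<n - 1} \<rightarrow>\<^sub>E {..<M\<^sup>2}) = (M\<^sup>2) ^ (n - 3)"
    by (subst card_PiE) (auto simp: numeral_eq_Suc)
  moreover have "card (SIGMA m : primes_between lo M. {..<m}) = (\<Sum>m\<in>primes_between lo M. m)"
    by (subst card_SigmaI) (auto simp: finite_primes_between)
  ultimately show ?thesis unfolding params_def by (simp add: card_cartesian_product mult.assoc)
qed

lemma inj_triple: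
  assumes n: "n \<ge> 4"
  shows "inj_on (triple n M) (params n M lo)"
proof (rule inj_onI)
  fix x y assume xy: "x \<in> params n M lo" "y \<in> params n M lo" "triple n M x = triple n M y"
  obtain m r q b \<beta> k where x: "x = ((m, r), q, b, \<beta>, k)" by (metis prod.exhaust)
  obtain m' r' q' b' \<beta>' k' where y: "y = ((m', r'), q', b', \<beta>', k')" by (metis prod.exhaust)
  have mr: "m = m'" "r = r'" using xy(3) unfolding x y triple_def by auto
  have "q = q' \<and> b = b' \<and> \<beta> = \<beta>' \<and> k = k'"
  proof (rule member_inj[OF n])
    show "odd (int m)" "int m > 0" "prime q" "prime q'"
      using xy(1,2) unfolding x y params_def primes_between_def by (auto simp: prime_gt_0_nat)
    show "\<beta> \<in> {2..<n - 1} \<rightarrow>\<^sub>E UNIV" "\<beta>' \<in> {2..<n - 1} \<rightarrow>\<^sub>E UNIV"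
      using xy(1,2) unfolding x y params_def by (auto simp: PiE_iff)
    show "member n (height n M) (int m) (int r) q b \<beta> k = member n (height n M) (int m) (int r) q' b' \<beta>' k'"
      using xy(3) mr unfolding x y triple_def by simp
  qed
  thus "x = y" using x y mr by simp
qed

lemma triple_props:
  assumes n: "n \<ge> 4" and t: "(f, m, r) \<in> triple n M ` params n M lo"
  shows "double_root_domain n f m r" "content f = 1" "height n M < lead_coeff f" "prime m" "0 \<le> r" "r < m"
    "lo < real_of_int m" "m \<le> int M" "in_box n (height n M) f" "height n M > 0"
proof -
  obtain p where p: "p \<in> params n M lo" "(f, m, r) = triple n M p" using t by blast
  obtain m' r' q b \<beta> k where pe: "p = ((m', r'), q, b, \<beta>, k)" by (metis prod.exhaust)
  have e: "f = member n (height n M) m r q b \<beta> k" "m = int m'" "r = int r'"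
    using p(2) unfolding pe triple_def by auto
  have pm: "prime m'" "odd m'" "lo < real m'" "m' \<le> M" "r' < m'" "prime q" "q \<le> M\<^sup>2" "b < M\<^sup>2" "k < M"
    and \<beta>: "\<And>i. i \<in> {2..<n - 1} \<Longrightarrow> \<beta> i < M\<^sup>2"
    using p(1) unfolding pe params_def primes_between_def by (auto simp: PiE_iff)
  have a: "odd m" "m > 0" "m \<le> int M" "0 \<le> r" "r < m"
    using pm e by (auto simp: prime_gt_0_nat)
  note args = n a pm(6,7,8) \<beta> pm(9)
  show "double_root_domain n f m r" "content f = 1" "in_box n (height n M) f"
    unfolding e(1) by (rule mem_double_root mem_content mem_box; use args in simp)+
  have "degree f = n" "coeff f n = lead_par (height n M) q b"
    unfolding e(1) by (rule degree_mem lead_mem; use args in simp)+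
  moreover have "even (height n M)" by (simp add: height_def)
  ultimately show "height n M < lead_coeff f" using lead_par(3)[of "height n M" q b] pm(6) by simp
  show "prime m" using pm(1) e by simp
  show "0 \<le> r" "r < m" "m \<le> int M" "lo < real_of_int m" using a pm e by auto
  show "height n M > 0" by (rule height_pos) (use args in auto)
qed

text \<open>This collects the constants of \<open>nat_copy\<close> for the tail bound
  \<open>2 * (n + 1) * 3^n * H\<close> with \<open>H\<close> from \<open>height\<close>, apart from
  \<open>m\<close> and the powers of \<open>M\<close>.\<close>

definition disc_const :: "nat \<Rightarrow> real" where
  "disc_const n = fact n * (2 * (real n + 1) * 3 ^ n * (8 * real n * (4 + (real (box_const n))\<^sup>2))) ^ (n - 1)"

lemma classes_ge_card_params:
  assumes n: "n \<ge> 4" and lo: "lo > 0"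
    and X: "(disc_const n * real M ^ (2 * (n - 1)) / lo)\<^sup>2 \<le> X"
  shows "ennreal (real (card (params n M lo)) / fiber_bound (box_const n)) \<le> num_domain_classes n X"
proof -
  define T where "T = triple n M ` params n M lo"
  define W where "W = (\<lambda>(f, m, r). double_root.wring n f m r)"
  define H where "H = real_of_int (height n M)"
  define B where "B = 2 * (n + 1) * 3 ^ n * H"
  have P: "double_root_domain n f m r" "content f = 1" "height n M < lead_coeff f" "prime m" "0 \<le> r" "r < m"
    "lo < real_of_int m" "m \<le> int M" "in_box n H f" "H > 0" if "(f, m, r) \<in> T" for f m r
    using triple_props[OF n that[unfolded T_def]] by (simp_all add: H_def)
  have n2: "n \<ge> 2" using n by simp
  have ex: "\<exists>N. N \<in> domains_of_rank n X \<and> W t \<simeq> N" if t: "t \<in> T" for t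
  proof -
    obtain f m r where tf: "t = (f, m, r)" by (cases t)
    note p = P[OF t[unfolded tf]]
    interpret double_root_domain n f m r by (rule p(1))
    obtain N :: "nat ring" where N: "domain N" "ring_of_rank n N" "wring \<simeq> N"
      "\<bar>real_of_int (ring_discriminant n N)\<bar> \<le> (fact n * B ^ (n - 1) / of_int m)\<^sup>2"
      using nat_copy[of B] box_tail_le[OF p(9,10) n2] unfolding B_def by blast
    have e: "fact n * B ^ (n - 1) = disc_const n * real M ^ (2 * (n - 1))"
    proof -
      define c where "c = 2 * (real n + 1) * 3 ^ n * (8 * real n * (4 + (real (box_const n))\<^sup>2))"
      have "B = c * (real M)\<^sup>2" by (simp add: B_def H_def height_def c_def algebra_simps)
      moreover have "disc_const n = fact n * c ^ (n - 1)" by (simp only: disc_const_def c_def)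
      ultimately show ?thesis by (simp add: power_mult_distrib power_mult)
    qed
    have d0: "disc_const n \<ge> 0" unfolding disc_const_def by simp
    have "(fact n * B ^ (n - 1) / of_int m)\<^sup>2 \<le> (disc_const n * real M ^ (2 * (n - 1)) / lo)\<^sup>2"
      unfolding e using p(7) lo d0 by (intro power_mono divide_left_mono) auto
    hence "\<bar>real_of_int (ring_discriminant n N)\<bar> \<le> X" using N(4) X by linarith
    hence "N \<in> domains_of_rank n X" using N unfolding domains_of_rank_def by simp
    thus ?thesis using N(3) unfolding W_def tf prod.case by (intro exI conjI)
  qed
  define N where "N t = (SOME N. N \<in> domains_of_rank n X \<and> W t \<simeq> N)" for t
  have N: "N t \<in> domains_of_rank n X" "W t \<simeq> N t" if "t \<in> T" for t
    using someI_ex[OF ex[OF that]] unfolding N_def by auto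
  have ringW: "ring (W t)" if t: "t \<in> T" for t
  proof -
    obtain f m r where tf: "t = (f, m, r)" by (cases t)
    interpret double_root_domain n f m r by (rule P(1)[OF t[unfolded tf]])
    show ?thesis using cring.axioms(1)[OF cring_wring] unfolding W_def tf by simp
  qed
  have finT: "finite T" unfolding T_def by (intro finite_imageI finite_params)
  have fib: "card {t \<in> T. N t \<simeq> N t'} \<le> fiber_bound (box_const n)" if t': "t' \<in> T" for t'
  proof -
    obtain g m' r' where tg: "t' = (g, m', r')" by (cases t')
    have "W t \<simeq> W t'" if t: "t \<in> T" "N t \<simeq> N t'" for t
    proof -
      have "N t' \<simeq> W t'" by (rule ring_iso_sym[OF ringW[OF t'] N(2)[OF t']])
      thus ?thesis using N(2)[OF t(1)] t(2) ring_iso_trans by metis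
    qed
    hence sub: "{t \<in> T. N t \<simeq> N t'} \<subseteq> {(f, m, r) \<in> T. double_root.wring n f m r \<simeq> double_root.wring n g m' r'}"
      unfolding W_def tg by auto
    have "card {t \<in> T. N t \<simeq> N t'} \<le> card {(f, m, r) \<in> T. double_root.wring n f m r \<simeq> double_root.wring n g m' r'}"
      by (rule card_mono[OF finite_subset[OF _ finT] sub]) auto
    also have "\<dots> \<le> fiber_bound (box_const n)"
    proof (rule fiber_card_le[OF n])
      show "(g, m', r') \<in> T" using t' tg by simp
    next
      fix f m r assume t: "(f, m, r) \<in> T"
      note p = P[OF t]
      show "double_root n f m r \<and> content f = 1 \<and> lead_coeff f > 0 \<and> prime m \<and> 0 \<le> r \<and> r < m"
        using p double_root_domain.axioms(1)[OF p(1)] unfolding H_def by auto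
    next
      fix f m r g m' r' y z j i
      assume t: "(f, m, r) \<in> T" "(g, m', r') \<in> T" and yz: "y \<in> croots f" "z \<in> croots g" "j < n"
      show "n * (norm (y ^ j / ev (pderiv f) y) * norm (tail g (Suc i) z)) \<le> real (box_const n)"
        by (rule box_pair_bound[OF P(9)[OF t(1)] P(9)[OF t(2)] P(10)[OF t(1)] n2 yz])
    next
      fix f m r g m' r'
      assume t: "(f, m, r) \<in> T" "(g, m', r') \<in> T"
      have "0 \<le> m'" "m' \<le> int M" using P(4,8)[OF t(2)] by (auto simp: prime_ge_0_int)
      hence "m'\<^sup>2 \<le> (int M)\<^sup>2" by (intro power_mono)
      \<comment> \<open>The square of \<open>box_const n\<close> was put into \<open>height\<close>
        for this inequality.\<close>
      hence "2 * int n * (int (box_const n))\<^sup>2 * m'\<^sup>2 \<le> (8 * int n * (4 + (int (box_const n))\<^sup>2)) * (int M)\<^sup>2"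
        by (intro mult_mono) (auto simp: algebra_simps)
      hence "2 * int n * (int (box_const n))\<^sup>2 * m'\<^sup>2 < lead_coeff f"
        using P(3)[OF t(1)] unfolding height_def by linarith
      hence "real_of_int (2 * int n * (int (box_const n))\<^sup>2 * m'\<^sup>2) < real_of_int (lead_coeff f)"
        by (simp only: of_int_less_iff)
      thus "2 * real n * (real (box_const n) * real_of_int m')\<^sup>2 < real_of_int (lead_coeff f)"
        by (simp add: power_mult_distrib mult.assoc)
    qed
    finally show ?thesis .
  qed
  have "fiber_bound (box_const n) > 0" by (simp add: fiber_bound_def)
  hence "ennreal (real (card T) / fiber_bound (box_const n)) \<le> num_domain_classes n X"
    using N(1) fib by (intro num_domain_classes_ge[OF finT]) auto
  moreover have "card T = card (params n M lo)" unfolding T_def by (rule card_image[OF inj_triple[OF n]])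
  ultimately show ?thesis by simp
qed

text \<open>The loss \<open>4 * \<epsilon>\<close> consists of one \<open>\<epsilon>\<close> for the
  number of primes \<open>m\<close>, one for their size and so the number of residues
  \<open>r\<close>, and two for the primes \<open>q\<close> up to \<open>M^2\<close>.\<close>

lemma eventually_card_params:
  fixes \<epsilon> :: real
  assumes \<epsilon>: "0 < \<epsilon>" "\<epsilon> < 1" and n: "n \<ge> 4"
  shows "\<forall>\<^sub>F M in sequentially. real M powr (2 * real n + 1 - 4 * \<epsilon>) \<le> card (params n M (real M powr (1 - \<epsilon>)))"
proof -
  have p1: "\<forall>\<^sub>F M in sequentially. real M powr (1 - \<epsilon> / 2) \<le> card {p::nat. prime p \<and> p \<le> M}"
    using eventually_many_primes[of "\<epsilon> / 2"] \<epsilon> by simp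
  \<comment> \<open>Starting from \<open>M^(1 - \<epsilon> / 2)\<close> primes, one copy of
    \<open>M^(1 - \<epsilon>)\<close> pays for the numbers up to \<open>lo\<close>, the other
    remains as the result; the 2 pays for 0 and the even prime.\<close>
  have p2: "\<forall>\<^sub>F M in sequentially. real M powr (1 - \<epsilon>) + real M powr (1 - \<epsilon>) + 2 \<le> real M powr (1 - \<epsilon> / 2)"
    using \<epsilon> by real_asymp
  have "filterlim (\<lambda>M::nat. M\<^sup>2) sequentially sequentially"
    by (rule filterlim_at_top_mono[OF filterlim_ident]) (auto simp: power2_eq_square)
  from filterlim_iff[THEN iffD1, OF this, rule_format, OF eventually_many_primes[OF \<epsilon>(1)]]
  have p3: "\<forall>\<^sub>F M in sequentially. real (M\<^sup>2) powr (1 - \<epsilon>) \<le> card {p::nat. prime p \<and> p \<le> M\<^sup>2}" .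
  have p4: "\<forall>\<^sub>F M::nat in sequentially. M \<ge> 1" by (rule eventually_ge_at_top)
  show ?thesis using p1 p2 p3 p4
  proof eventually_elim
    case (elim M)
    define lo where "lo = real M powr (1 - \<epsilon>)"
    have lo0: "lo \<ge> 0" by (simp add: lo_def)
    have "{p::nat. prime p \<and> p \<le> M} \<subseteq> insert 2 (primes_between lo M \<union> {..nat \<lfloor>lo\<rfloor>})"
    proof
      fix p assume p: "p \<in> {p::nat. prime p \<and> p \<le> M}"
      show "p \<in> insert 2 (primes_between lo M \<union> {..nat \<lfloor>lo\<rfloor>})"
      proof (cases "p = 2 \<or> lo < real p")
        case True thus ?thesis using p prime_odd_nat[of p] prime_ge_2_nat[of p] unfolding primes_between_def by fastforce
      next
        case False
        hence "int p \<le> \<lfloor>lo\<rfloor>" by (simp add: le_floor_iff)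
        hence "p \<le> nat \<lfloor>lo\<rfloor>" by linarith
        thus ?thesis by simp
      qed
    qed
    hence "card {p::nat. prime p \<and> p \<le> M} \<le> card (insert 2 (primes_between lo M \<union> {..nat \<lfloor>lo\<rfloor>}))"
      by (intro card_mono) (auto simp: finite_primes_between)
    also have "\<dots> \<le> Suc (card (primes_between lo M) + Suc (nat \<lfloor>lo\<rfloor>))"
      by (intro le_trans[OF card_insert_le_m1] ) (use card_Un_le[of "primes_between lo M" "{..nat \<lfloor>lo\<rfloor>}"] card_insert_if in auto)
    finally have "real (card {p::nat. prime p \<and> p \<le> M}) \<le> real (card (primes_between lo M)) + real (nat \<lfloor>lo\<rfloor>) + 2"
      by linarith
    moreover have "real (nat \<lfloor>lo\<rfloor>) \<le> lo" using lo0 by simp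
    ultimately have c: "lo \<le> card (primes_between lo M)" using elim(1,2) unfolding lo_def by linarith
    have "lo * lo \<le> card (primes_between lo M) * lo" using c lo0 by (rule mult_right_mono)
    also have "\<dots> = (\<Sum>m\<in>primes_between lo M. lo)" by simp
    also have "\<dots> \<le> (\<Sum>m\<in>primes_between lo M. real m)"
      by (rule sum_mono) (simp add: primes_between_def)
    finally have s: "lo * lo \<le> real (\<Sum>m\<in>primes_between lo M. m)" by simp
    have M: "real M > 0" using elim(4) by simp
    have "real M powr (2 * real n + 1 - 4 * \<epsilon>) =
       real M powr ((1 - \<epsilon>) + (1 - \<epsilon>) + 2 * (1 - \<epsilon>) + real (2 + 2 * (n - 3) + 1))"
      using n by (intro arg_cong[of _ _ "(powr) (real M)"]) (simp add: of_nat_diff algebra_simps)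
    also have "\<dots> = lo * lo * (real (M\<^sup>2)) powr (1 - \<epsilon>) * (real M ^ 2 * (real M ^ 2) ^ (n - 3) * real M)"
    proof -
      have "real (M\<^sup>2) = real M powr 2" using M by (simp add: powr_numeral)
      hence "real M powr (2 * (1 - \<epsilon>)) = real (M\<^sup>2) powr (1 - \<epsilon>)" by (simp only: powr_powr)
      moreover have "real M powr real (2 + 2 * (n - 3) + 1) = real M ^ 2 * (real M ^ 2) ^ (n - 3) * real M"
        unfolding powr_realpow[OF M] by (simp add: power_add power_mult power2_eq_square)
      ultimately show ?thesis unfolding powr_add lo_def by simp
    qed
    also have "\<dots> \<le> real (\<Sum>m\<in>primes_between lo M. m) * real (card {q. prime q \<and> q \<le> M\<^sup>2}) * (real M ^ 2 * (real M ^ 2) ^ (n - 3) * real M)"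
      using s elim(3) lo0 by (intro mult_right_mono mult_mono) (auto intro: sum_nonneg)
    also have "\<dots> = real (card (params n M lo))" unfolding card_params by simp
    finally show ?case unfolding lo_def .
  qed
qed

theorem mainTheorem1:
  fixes n :: nat
  assumes "n \<ge> 4"
  shows "\<exists>c::real. c > 0 \<and>
    (\<forall>\<^sub>F X::real in at_top.
       num_domain_classes n X \<ge> ennreal (c * X powr (1 / 2 + 1 / (real n - 4 / 3))))"
proof -
  \<comment> \<open>After cross-multiplication, \<open>(2 n + 1) / (4 n - 6)\<close> exceeds
    \<open>t\<close> by a margin of 4, of which the perturbation uses
    \<open>30 * \<epsilon> * n - 28 * \<epsilon>\<close>; with this choice that is less than
    3.\<close>
  define \<epsilon> where "\<epsilon> = 1 / (10 * real n)"
  \<comment> \<open>\<open>M^a\<close> is the order of the discriminants, the square of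
    \<open>M^(2 (n - 1)) / M^(1 - \<epsilon>)\<close>, and \<open>M^e\<close> bounds the number of
    parameters from below.\<close>
  define a where "a = 4 * real n - 6 + 2 * \<epsilon>"
  define e where "e = 2 * real n + 1 - 4 * \<epsilon>"
  define t where "t = 1 / 2 + 1 / (real n - 4 / 3)"
  define D where "D = (disc_const n)\<^sup>2"
  define C where "C = real (fiber_bound (box_const n))"
  have \<epsilon>: "0 < \<epsilon>" "\<epsilon> < 1" "\<epsilon> * n = 1 / 10" using assms by (auto simp: \<epsilon>_def)
  have a0: "a > 0" using assms \<epsilon> by (simp add: a_def)
  have e0: "e > 0" using assms \<epsilon> by (simp add: e_def)
  have "4 + (real (box_const n))\<^sup>2 > 0" by (rule add_pos_nonneg) auto
  hence D0: "D > 0" using assms by (simp add: D_def disc_const_def)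
  have "fiber_bound (box_const n) > 0" by (simp add: fiber_bound_def)
  hence C0: "C > 0" by (simp add: C_def)
  have te: "t \<le> e / a"
  proof -
    have n4: "3 * real n - 4 > 0" using assms by simp
    have "t = (3 * real n + 2) / (2 * (3 * real n - 4))" using assms n4 by (simp add: t_def field_simps)
    moreover have "(3 * real n + 2) * a \<le> e * (2 * (3 * real n - 4))"
    proof -
      have "e * (2 * (3 * real n - 4)) - (3 * real n + 2) * a = 4 - 30 * (\<epsilon> * n) + 28 * \<epsilon>"
        by (simp add: e_def a_def algebra_simps)
      thus ?thesis using \<epsilon> by simp
    qed
    ultimately show ?thesis using a0 n4 by (simp add: divide_le_eq pos_le_divide_eq mult.commute)
  qed
  obtain M0 where M0: "\<And>M. M \<ge> M0 \<Longrightarrow> real M powr e \<le> card (params n M (real M powr (1 - \<epsilon>)))"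
    using eventually_card_params[OF \<epsilon>(1,2) assms] unfolding eventually_sequentially e_def by blast
  \<comment> \<open>Rounding \<open>y\<close> down to \<open>M \<ge> 1\<close> loses at most a
    factor 2; the other factors come from \<open>y = (X / D)^(1 / a)\<close> and from the size of
    the fibers.\<close>
  define c where "c = (1 / 2) powr e * (1 / D) powr (e / a) / C"
  have c0: "c > 0" using D0 C0 by (simp add: c_def)
  have "ennreal (c * X powr t) \<le> num_domain_classes n X"
    if X: "X \<ge> 1" "X \<ge> D * (real M0 + 1) powr a" for X
  proof -
    \<comment> \<open>At \<open>M = y\<close> the discriminant bound \<open>D * M^a\<close> would be
      exactly \<open>X\<close>.\<close>
    define y where "y = (X / D) powr (1 / a)"
    define M where "M = nat \<lfloor>y\<rfloor>"
    have "(real M0 + 1) powr a \<le> X / D" using X(2) D0 by (simp add: pos_le_divide_eq mult.commute)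
    hence "((real M0 + 1) powr a) powr (1 / a) \<le> y" unfolding y_def using a0 by (intro powr_mono2) auto
    hence y: "real M0 + 1 \<le> y" using a0 by (simp add: powr_powr)
    have My: "real M \<le> y" "y \<le> real M + 1" "M \<ge> M0" "M \<ge> 1"
      using y unfolding M_def by linarith+
    have ya: "y powr a = X / D" unfolding y_def using a0 X D0 by (simp add: powr_powr)
    have lo: "real M powr (1 - \<epsilon>) > 0" using My(4) by simp
    have "(disc_const n * real M ^ (2 * (n - 1)) / real M powr (1 - \<epsilon>))\<^sup>2 = D * real M powr a"
    proof -
      have "real M ^ (2 * (n - 1)) / real M powr (1 - \<epsilon>) = real M powr (a / 2)"
      proof -
        have "real M ^ (2 * (n - 1)) = real M powr real (2 * (n - 1))" using My(4) by (subst powr_realpow) auto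
        moreover have "real (2 * (n - 1)) - (1 - \<epsilon>) = a / 2" using assms by (simp add: a_def of_nat_diff field_simps)
        ultimately show ?thesis by (simp only: powr_diff[symmetric])
      qed
      moreover have "(real M powr (a / 2))\<^sup>2 = real M powr a" by (simp add: power2_eq_square powr_add[symmetric])
      ultimately show ?thesis unfolding D_def by (metis power_mult_distrib times_divide_eq_right)
    qed
    also have "\<dots> \<le> D * y powr a" using My(1) a0 D0 by (intro mult_left_mono powr_mono2) auto
    also have "\<dots> = X" using ya D0 by simp
    finally have "ennreal (real (card (params n M (real M powr (1 - \<epsilon>)))) / C) \<le> num_domain_classes n X"
      unfolding C_def by (rule classes_ge_card_params[OF assms lo])
    moreover have "c * X powr t \<le> real (card (params n M (real M powr (1 - \<epsilon>)))) / C"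
    proof -
      have "X powr t \<le> X powr (e / a)" using te X(1) by (intro powr_mono) auto
      hence "c * X powr t \<le> c * X powr (e / a)" using c0 by simp
      also have "c * X powr (e / a) = (1 / 2) powr e * (X powr (e / a) * (1 / D) powr (e / a)) / C"
        unfolding c_def by simp
      also have "X powr (e / a) * (1 / D) powr (e / a) = y powr e"
        unfolding y_def using X D0 by (simp add: powr_powr powr_mult[symmetric])
      also have "(1 / 2) powr e * y powr e = (1 / 2 * y) powr e" using y by (simp only: powr_mult)
      also have "(1 / 2 * y) powr e / C \<le> real M powr e / C"
        using My y e0 C0 by (intro divide_right_mono powr_mono2) auto
      also have "\<dots> \<le> real (card (params n M (real M powr (1 - \<epsilon>)))) / C"
        using M0[OF My(3)] C0 by (intro divide_right_mono) auto
      finally show ?thesis .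
    qed
    ultimately show ?thesis by (meson ennreal_leI order_trans)
  qed
  hence "\<forall>\<^sub>F X in at_top. ennreal (c * X powr t) \<le> num_domain_classes n X"
    unfolding eventually_at_top_linorder
    by (intro exI[of _ "max 1 (D * (real M0 + 1) powr a)"]) auto
  thus ?thesis using c0 unfolding t_def by (intro exI[of _ c] conjI)
qed

end
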